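(* A link type $L$ in $S^3$ arises as the link of a weakly isolated singularity (at the origin) of a convenient, Newton non-degenerate mixed function $f:\mathbb{C}^2\to\mathbb{C}$ with nice Newton boundary if and only if $L$ is the link of a weakly isolated singularity (at the origin) of an inner non-degenerate mixed function $\mathbb{C}^2\to\mathbb{C}$ with nice Newton boundary.
   Context: Coordinates on $\mathbb{C}^2\cong\mathbb{R}^4$ are $(u,v)$; $S^3$ is the unit sphere. Links may be empty; link types are isotopy classes. Mixed functions: a mixed function (mixed polynomial) is a finite sum $f(u,v)=\sum c_{\mu_1,\mu_2,\nu_1,\nu_2}u^{\mu_1}\bar u^{\mu_2}v^{\nu_1}\bar v^{\nu_2}$. $V_f=f^{-1}(0)$, and $\Sigma_f$ is the set of critical points of $f$, i.e. points where the real Jacobian of $f:\mathbb{R}^4\to\mathbb{R}^2$ has rank less than 2. If $f(0)=0$ and the origin $O$ is a critical point, $O$ is a weakly isolated singularity if $V_f\cap\Sigma_f\cap U=\{O\}$ for some neighbourhood $U$ of $O$. The link of the singularity is the isotopy class of the intersection of $V_f$ with a sufficiently small 3-sphere centred at $O$, regarded in $S^3$. Newton boundary: $supp(f)$ is the set of $(\mu,\nu)\in\mathbb{N}_0^2$ for which some $c_{\mu_1,\mu_2,\nu_1,\nu_2}\neq0$ with $\mu_1+\mu_2=\mu$, $\nu_1+\nu_2=\nu$. The Newton boundary $\Gamma_f$ is the union of the compact faces (dimension 0 or 1) of the convex hull of $supp(f)+(\mathbb{R}_{\geq0})^2$. For a compact face $\Delta$, $f_\Delta$ is the sum of the terms of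 $f$ whose lattice point lies on $\Delta$. For a weight vector $P=(p_1,p_2)\in\mathbb{N}^2$ with positive entries, $f_P$ is the sum of the terms of $f$ on which $p_1\mu+p_2\nu$ is minimal over $supp(f)$. The weight vectors (with coprime entries) for which $f_P$ corresponds to a compact 1-face are denoted $P_1,\dots,P_N$, ordered so that $p_{i,1}/p_{i,2}$ is strictly decreasing in $i$. Vertices of $\Gamma_f$ other than its two end vertices are called non-extreme. Convenient: $\Gamma_f$ intersects both the horizontal coordinate axis ($u$-convenient) and the vertical coordinate axis ($v$-convenient). Newton non-degenerate: $V_{f_\Delta}\cap\Sigma_{f_\Delta}\cap(\mathbb{C}^* )^2=\emptyset$ for all compact faces $\Delta$ (dimension 0 or 1) of $\Gamma_f$. Inner non-degenerate: if $N\ge1$, (i) $f_{P_1}$ has no critical points in $V_{f_{P_1}}\cap(\mathbb{C}^2\setminus\{v=0\})$ and $f_{P_N}$ has no critical points in $V_{f_{P_N}}\cap(\mathbb{C}^2\setminus\{u=0\})$; (ii) for each 1-face and each non-extreme vertex $\Delta$, $f_\Delta$ has no critical points in $V_{f_\Delta}\cap(\mathbb{C}^* )^2$. If $\Gamma_f$ is a single vertex $\Delta$, inner non-degenerate means that $f_\Delta$ has no critical points in $V_{f_\Delta}\setminus\{(0,0)\}$. Nice: $f$ is nice (has nice Newton boundary) if $V_{f_\Delta}\cap(\mathbb{C}^* )^2=\emptyset$ for every non-extreme vertex $\Delta$. *)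

theory Defs
  imports "HOL-Analysis.Analysis" "HOL-Library.Poly_Mapping"
begin

section \<open>Mixed functions\<close>

text \<open>The monomial $u^a \bar u^b v^c \bar v^d$ is indexed by \<open>(a, b, c, d)\<close>.\<close>

type_synonym mixed_function = "(nat \<times> nat \<times> nat \<times> nat) \<Rightarrow>\<^sub>0 complex"

definition mixed_eval :: "mixed_function \<Rightarrow> complex \<times> complex \<Rightarrow> complex" where
  "mixed_eval f = (\<lambda>(u, v). \<Sum>(a, b, c, d)\<in>Poly_Mapping.keys f.
     Poly_Mapping.lookup f (a, b, c, d) * u ^ a * cnj u ^ b * v ^ c * cnj v ^ d)"

definition zero_set :: "mixed_function \<Rightarrow> (complex \<times> complex) set" where
  "zero_set f = {z. mixed_eval f z = 0}"

text \<open>The derivative is the real one, and \<^term>\<open>dim\<close> is the dimension over the reals.\<close>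

definition critical_set :: "mixed_function \<Rightarrow> (complex \<times> complex) set" where
  "critical_set f = {z. dim (range (frechet_derivative (mixed_eval f) (at z))) < 2}"

definition weakly_isolated_singularity :: "mixed_function \<Rightarrow> bool" where
  "weakly_isolated_singularity f \<longleftrightarrow>
     mixed_eval f 0 = 0 \<and> 0 \<in> critical_set f \<and>
     (\<exists>U. open U \<and> 0 \<in> U \<and> zero_set f \<inter> critical_set f \<inter> U = {0})"


section \<open>The Newton boundary\<close>

definition lattice_point :: "nat \<times> nat \<times> nat \<times> nat \<Rightarrow> real \<times> real" where
  "lattice_point = (\<lambda>(a, b, c, d). (real (a + b), real (c + d)))"

definition supp :: "mixed_function \<Rightarrow> (real \<times> real) set" where
  "supp f = lattice_point ` Poly_Mapping.keys f"

definition newton_polyhedron :: "mixed_function \<Rightarrow> (real \<times> real) set" where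
  "newton_polyhedron f = convex hull {x + y | x y. x \<in> supp f \<and> 0 \<le> fst y \<and> 0 \<le> snd y}"

definition compact_faces :: "int \<Rightarrow> mixed_function \<Rightarrow> (real \<times> real) set set" where
  "compact_faces k f = {\<Delta>. \<Delta> face_of newton_polyhedron f \<and> compact \<Delta> \<and> aff_dim \<Delta> = k}"

definition newton_boundary :: "mixed_function \<Rightarrow> (real \<times> real) set" where
  "newton_boundary f = \<Union> (compact_faces 0 f \<union> compact_faces 1 f)"

definition restrict_terms :: "(real \<times> real) set \<Rightarrow> mixed_function \<Rightarrow> mixed_function" where
  "restrict_terms S f = Poly_Mapping.mapp (\<lambda>m c. if lattice_point m \<in> S then c else 0) f"

definition weight :: "nat \<times> nat \<Rightarrow> real \<times> real \<Rightarrow> real" where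
  "weight P x = real (fst P) * fst x + real (snd P) * snd x"

definition weight_part :: "nat \<times> nat \<Rightarrow> mixed_function \<Rightarrow> mixed_function" where
  "weight_part P f = restrict_terms {x. is_arg_min (weight P) (\<lambda>y. y \<in> supp f) x} f"

text \<open>The vectors $P_1, \dots, P_N$. A compact edge contains at least two points of the
  support, so the equation below determines the edge from the weight vector.\<close>

definition edge_weights :: "mixed_function \<Rightarrow> (nat \<times> nat) set" where
  "edge_weights f = {P. 0 < fst P \<and> 0 < snd P \<and> coprime (fst P) (snd P) \<and>
     (\<exists>\<Delta>\<in>compact_faces 1 f. weight_part P f = restrict_terms \<Delta> f)}"

definition weight_ratio :: "nat \<times> nat \<Rightarrow> real" where
  "weight_ratio P = real (fst P) / real (snd P)"

text \<open>The $P_i$ are ordered by strictly decreasing ratio, so $P_1$ has the largest ratio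
  and $P_N$ the smallest one.\<close>

definition is_first_weight :: "mixed_function \<Rightarrow> nat \<times> nat \<Rightarrow> bool" where
  "is_first_weight f P \<longleftrightarrow> is_arg_max weight_ratio (\<lambda>Q. Q \<in> edge_weights f) P"

definition is_last_weight :: "mixed_function \<Rightarrow> nat \<times> nat \<Rightarrow> bool" where
  "is_last_weight f P \<longleftrightarrow> is_arg_min weight_ratio (\<lambda>Q. Q \<in> edge_weights f) P"

text \<open>The Newton boundary is a strictly descending polygonal path, so its end vertices are
  its leftmost and its rightmost point. They coincide if it is a single vertex.\<close>

definition non_extreme_vertices :: "mixed_function \<Rightarrow> (real \<times> real) set set" where
  "non_extreme_vertices f = {\<Delta> \<in> compact_faces 0 f. \<forall>x\<in>\<Delta>.
     (\<exists>y\<in>newton_boundary f. fst y < fst x) \<and> (\<exists>y\<in>newton_boundary f. fst x < fst y)}"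

definition convenient :: "mixed_function \<Rightarrow> bool" where
  "convenient f \<longleftrightarrow> (\<exists>a. (a, 0) \<in> newton_boundary f) \<and> (\<exists>b. (0, b) \<in> newton_boundary f)"

definition torus :: "(complex \<times> complex) set" where
  "torus = {(u, v). u \<noteq> 0 \<and> v \<noteq> 0}"

definition newton_nondegenerate :: "mixed_function \<Rightarrow> bool" where
  "newton_nondegenerate f \<longleftrightarrow> (\<forall>\<Delta>\<in>compact_faces 0 f \<union> compact_faces 1 f.
     zero_set (restrict_terms \<Delta> f) \<inter> critical_set (restrict_terms \<Delta> f) \<inter> torus = {})"

definition inner_nondegenerate :: "mixed_function \<Rightarrow> bool" where
  "inner_nondegenerate f \<longleftrightarrow>
     (edge_weights f \<noteq> {} \<longrightarrow>
        (\<forall>P. is_first_weight f P \<longrightarrow>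
           zero_set (weight_part P f) \<inter> critical_set (weight_part P f) \<inter> {(u, v). v \<noteq> 0} = {}) \<and>
        (\<forall>P. is_last_weight f P \<longrightarrow>
           zero_set (weight_part P f) \<inter> critical_set (weight_part P f) \<inter> {(u, v). u \<noteq> 0} = {}) \<and>
        (\<forall>\<Delta>\<in>compact_faces 1 f \<union> non_extreme_vertices f.
           zero_set (restrict_terms \<Delta> f) \<inter> critical_set (restrict_terms \<Delta> f) \<inter> torus = {})) \<and>
     (\<forall>\<Delta>\<in>compact_faces 0 f. newton_boundary f = \<Delta> \<longrightarrow>
        zero_set (restrict_terms \<Delta> f) \<inter> critical_set (restrict_terms \<Delta> f) \<subseteq> {(0, 0)})"

definition nice :: "mixed_function \<Rightarrow> bool" where
  "nice f \<longleftrightarrow> (\<forall>\<Delta>\<in>non_extreme_vertices f. zero_set (restrict_terms \<Delta> f) \<inter> torus = {})"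


section \<open>Links in the 3-sphere\<close>

abbreviation S3 :: "(complex \<times> complex) set" where
  "S3 \<equiv> sphere 0 1"

text \<open>Links are tame: near each of its points a link looks like a straight line in 3-space
  (local flatness). They are unoriented and possibly empty.\<close>

definition locally_flat :: "(complex \<times> complex) set \<Rightarrow> bool" where
  "locally_flat K \<longleftrightarrow> (\<forall>x\<in>K. \<exists>U \<phi> \<psi>. openin (top_of_set S3) U \<and> x \<in> U \<and>
     homeomorphism U (UNIV :: (real \<times> real \<times> real) set) \<phi> \<psi> \<and>
     \<phi> ` (U \<inter> K) = {(t, 0, 0) | t. True})"

definition is_link :: "(complex \<times> complex) set \<Rightarrow> bool" where
  "is_link K \<longleftrightarrow> K \<subseteq> S3 \<and> locally_flat K \<and>
     (\<exists>\<C>. finite \<C> \<and> pairwise disjnt \<C> \<and>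
        (\<forall>C\<in>\<C>. C homeomorphic (sphere 0 1 :: complex set)) \<and> K = \<Union> \<C>)"

text \<open>Ambient isotopy in the 3-sphere: a homotopy through homeomorphisms that starts
  at the identity.\<close>

definition isotopic :: "(complex \<times> complex) set \<Rightarrow> (complex \<times> complex) set \<Rightarrow> bool" where
  "isotopic K K' \<longleftrightarrow> (\<exists>h.
     homotopic_with_canon (\<lambda>g. \<exists>g'. homeomorphism S3 S3 g g') S3 S3 id h \<and> h ` K = K')"

definition link_type :: "(complex \<times> complex) set set \<Rightarrow> bool" where
  "link_type L \<longleftrightarrow> (\<exists>K. is_link K \<and> L = {K'. is_link K' \<and> isotopic K K'})"

text \<open>The intersections with the small spheres are rescaled to the unit sphere.\<close>

definition link_of_singularity :: "mixed_function \<Rightarrow> (complex \<times> complex) set set \<Rightarrow> bool" where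
  "link_of_singularity f L \<longleftrightarrow>
     (\<forall>\<^sub>F \<epsilon> in at_right 0. (\<lambda>z. z /\<^sub>R \<epsilon>) ` (zero_set f \<inter> sphere 0 \<epsilon>) \<in> L)"

end

theory Submission
  imports Defs
begin

text \<open>If \<open>f\<close> is convenient, regularity on the torus at an end vertex, which lies on an axis, extends to
  that axis, so Newton non-degeneracy implies inner non-degeneracy and \<open>f\<close> itself can be kept.

  Conversely, add small generic terms \<open>\<kappa> v ^ n\<close> and \<open>\<kappa>' u ^ n'\<close> to an inner non-degenerate \<open>f\<close>, where
  \<open>(0, n)\<close> is the end vertex of the Newton boundary if this lies on the axis, and \<open>n = 2 m0 + 2\<close> if the
  end vertex is \<open>(1, m0)\<close>; no other end vertex is possible. For generic coefficients the new
  end vertices are zero-free on the torus. All sufficiently small perturbations with these exponents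
  are transverse to all sufficiently small round spheres: along a sequence of counterexamples that
  tends to the origin, the dominant monomials lie on a face, and after rescaling the coordinates the
  sequence converges to a zero of the face polynomial, where Euler's identity yields a contradiction.
  Therefore the family \<open>f + t (g - f)\<close> is transverse to a fixed small sphere, and the flow of a vector
  field carries the link of \<open>f\<close> to the link of \<open>g\<close>. Quasi-homogeneity transfers the same
  transversality statement, applied to an edge polynomial, to all zeros on the torus, which makes the
  perturbed edge polynomials non-degenerate.\<close>

section \<open>Ambient isotopy of transverse zero sets\<close>

text \<open>Round spheres are not invariant under the weighted scalings of the Newton boundary, so
  transversality to them cannot be obtained by scaling alone. The limit argument works because
  Euler's field at a limit zero lies in the kernel of the derivative and has positive inner product
  with the limit of the normal vectors. This needs a weight vector, and two monomials that stay
  comparable provide one. If a single monomial dominates, only the absence of zeros helps; this is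
  where niceness enters, for the vertices off the axes. At an end vertex on an axis zeros are
  allowed, and there the column next to the axis supplies both the weight and the regularity. The
  estimate has to be uniform in the coefficients, because the whole segment from \<open>f\<close> to
  \<open>g\<close> must be transverse to every sphere below one fixed radius. The coefficients of
  \<open>g\<close> are chosen only afterwards, small enough for this bound and generic at the same
  time. Hence the analysis is done for an exponent set that already contains the new points,
  although the coefficients of \<open>f\<close> there may be zero.\<close>

lemma vector_gronwall:
  fixes e e' :: "real \<Rightarrow> 'a::real_inner"
  assumes der: "\<And>t. t \<in> {0..1} \<Longrightarrow> (e has_vector_derivative e' t) (at t within {0..1})"
    and bound: "\<And>t. t \<in> {0..1} \<Longrightarrow> norm (e' t) \<le> C * norm (e t)"
    and st: "s \<in> {0..1}" "t \<in> {0..1}"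
  shows "norm (e t) \<le> exp \<bar>C\<bar> * norm (e s)"
proof -
  define D where "D = (\<lambda>t. e t \<bullet> e t)"
  have contD: "continuous_on {0..1} D"
    unfolding D_def
    by (intro continuous_intros continuous_on_vector_derivative) (use der in blast)+
  have derD: "(D has_real_derivative 2 * (e t \<bullet> e' t)) (at t)" if "0 < t" "t < 1" for t
  proof -
    have "(e has_vector_derivative e' t) (at t)"
      using der[of t] that by (simp add: at_within_Icc_at)
    then have "(e has_derivative (\<lambda>h. h *\<^sub>R e' t)) (at t)"
      by (simp add: has_vector_derivative_def)
    from has_derivative_inner[OF this this]
    show ?thesis
      unfolding D_def has_field_derivative_def
      by (rule has_derivative_eq_rhs) (auto simp: fun_eq_iff inner_commute algebra_simps)
  qed
  have bd: "\<bar>2 * (e t \<bullet> e' t)\<bar> \<le> 2 * \<bar>C\<bar> * D t" if "0 < t" "t < 1" for t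
  proof -
    have "\<bar>e t \<bullet> e' t\<bar> \<le> norm (e t) * norm (e' t)" by (rule Cauchy_Schwarz_ineq2)
    also have "\<dots> \<le> norm (e t) * (\<bar>C\<bar> * norm (e t))"
    proof (rule mult_left_mono)
      have "norm (e' t) \<le> C * norm (e t)" using bound that by simp
      also have "\<dots> \<le> \<bar>C\<bar> * norm (e t)" by (intro mult_right_mono) auto
      finally show "norm (e' t) \<le> \<bar>C\<bar> * norm (e t)" .
    qed simp
    also have "\<dots> = \<bar>C\<bar> * D t" by (simp add: D_def dot_square_norm power2_eq_square)
    finally show ?thesis by (simp add: abs_mult)
  qed
  \<comment> \<open>For \<open>\<sigma> = 1\<close> the bound makes
    \<open>exp (2 * \<bar>C\<bar> * t) * D t\<close> increasing, for \<open>\<sigma> = -1\<close> it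
    makes \<open>exp (- 2 * \<bar>C\<bar> * t) * D t\<close> decreasing. Together they compare
    \<open>e s\<close> and \<open>e t\<close> in either order of time, so a zero at one time forces
    zeros at all times.\<close>
  have mono: "exp (\<sigma> * (2 * \<bar>C\<bar> * a)) * (\<sigma> * D a) \<le> exp (\<sigma> * (2 * \<bar>C\<bar> * b)) * (\<sigma> * D b)"
    if ab: "0 \<le> a" "a \<le> b" "b \<le> 1" and \<sigma>: "\<sigma> = 1 \<or> \<sigma> = -1" for a b \<sigma>
  proof (rule DERIV_nonneg_imp_increasing_open[OF ab(2)])
    show "continuous_on {a..b} (\<lambda>u. exp (\<sigma> * (2 * \<bar>C\<bar> * u)) * (\<sigma> * D u))"
      using ab by (intro continuous_intros continuous_on_subset[OF contD]) auto
    fix u assume u: "a < u" "u < b"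
    have "((\<lambda>u. exp (\<sigma> * (2 * \<bar>C\<bar> * u)) * (\<sigma> * D u)) has_real_derivative
       exp (\<sigma> * (2 * \<bar>C\<bar> * u)) * (\<sigma> * \<sigma> * 2 * \<bar>C\<bar> * D u + \<sigma> * (2 * (e u \<bullet> e' u)))) (at u)"
      using u ab by (auto intro!: derivative_eq_intros derD simp: algebra_simps)
    moreover have "\<sigma> * \<sigma> * 2 * \<bar>C\<bar> * D u + \<sigma> * (2 * (e u \<bullet> e' u)) \<ge> 0"
      using bd[of u] u ab \<sigma> by auto
    ultimately show "\<exists>y. ((\<lambda>u. exp (\<sigma> * (2 * \<bar>C\<bar> * u)) * (\<sigma> * D u)) has_real_derivative y) (at u) \<and> 0 \<le> y"
      by (meson exp_ge_zero mult_nonneg_nonneg)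
  qed
  have Dnn: "D u \<ge> 0" for u by (simp add: D_def)
  have "D t \<le> exp (2 * \<bar>C\<bar>) * D s"
  proof (cases "s \<le> t")
    case True
    have "exp (- (2 * \<bar>C\<bar> * s)) * D s \<ge> exp (- (2 * \<bar>C\<bar> * t)) * D t"
      using mono[of s t "-1"] True st by simp
    then have "D t \<le> exp (2 * \<bar>C\<bar> * (t - s)) * D s"
      by (simp add: exp_minus exp_diff field_simps right_diff_distrib)
    also have "\<dots> \<le> exp (2 * \<bar>C\<bar>) * D s"
      using st True Dnn by (intro mult_right_mono) (auto intro!: mult_left_le)
    finally show ?thesis .
  next
    case False
    have "exp (2 * \<bar>C\<bar> * t) * D t \<le> exp (2 * \<bar>C\<bar> * s) * D s"
      using mono[of t s 1] False st by simp
    then have "D t \<le> exp (2 * \<bar>C\<bar> * (s - t)) * D s"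
      by (simp add: exp_diff field_simps right_diff_distrib)
    also have "\<dots> \<le> exp (2 * \<bar>C\<bar>) * D s"
      using st False Dnn by (intro mult_right_mono) (auto intro!: mult_left_le)
    finally show ?thesis .
  qed
  then have "(norm (e t))\<^sup>2 \<le> (exp \<bar>C\<bar> * norm (e s))\<^sup>2"
    by (simp add: D_def dot_square_norm power_mult_distrib flip: exp_double)
  then show ?thesis
    by (rule power2_le_imp_le) simp
qed

text \<open>A weighted norm makes the integral operator a contraction on all of
  \<open>[0, 1]\<close> at once, instead of gluing local solutions: the fixed point is
  \<open>exp (- c * t) *\<^sub>R y t\<close> rather than \<open>y\<close> itself.\<close>

lemma picard_lindelof:
  fixes X :: "real \<Rightarrow> 'a::euclidean_space \<Rightarrow> 'a"
  assumes cont: "continuous_on UNIV (\<lambda>p. X (fst p) (snd p))"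
    and lip: "\<And>t x y. norm (X t x - X t y) \<le> K * norm (x - y)"
  obtains y where "y 0 = x0"
    "\<And>t. t \<in> {0..1} \<Longrightarrow> (y has_vector_derivative X t (y t)) (at t within {0..1})"
proof -
  \<comment> \<open>The factor 2 gives the contraction constant
    \<open>\<bar>K\<bar> / c \<le> 1/2\<close>; the added 1 keeps \<open>c\<close> positive when
    \<open>K = 0\<close>.\<close>
  define c where "c = 2 * (\<bar>K\<bar> + 1)"
  have c: "c > 0" by (simp add: c_def add_pos_nonneg)
  define f where "f = (\<lambda>z s. X s (exp (c * s) *\<^sub>R z s))"
  define G where "G = (\<lambda>z t. exp (- c * t) *\<^sub>R (x0 + integral {0..t} (f z)))"
  \<comment> \<open>Clamping time to the unit interval lets the operator act on bounded continuous
    functions on the whole line, which form a complete type.\<close>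
  define cl where "cl = (\<lambda>t::real. max 0 (min 1 t))"
  define T :: "(real \<Rightarrow>\<^sub>C 'a) \<Rightarrow> (real \<Rightarrow>\<^sub>C 'a)" where "T = (\<lambda>z. Bcontfun (\<lambda>t. G (apply_bcontfun z) (cl t)))"
  have cl: "cl t \<in> {0..1}" "t \<in> {0..1} \<Longrightarrow> cl t = t" for t by (auto simp: cl_def)
  have contf: "continuous_on S (f (apply_bcontfun z))" for z S
  proof -
    have "continuous_on S ((\<lambda>p. X (fst p) (snd p)) \<circ> (\<lambda>s. (s, exp (c * s) *\<^sub>R apply_bcontfun z s)))"
      by (intro continuous_on_compose continuous_intros continuous_on_subset[OF cont]) auto
    then show ?thesis by (simp add: f_def o_def)
  qed
  have intf: "f (apply_bcontfun z) integrable_on {a..b}" for z a b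
    using contf by (rule integrable_continuous_interval)
  have contG: "continuous_on {0..1} (G (apply_bcontfun z))" for z
    unfolding G_def by (intro continuous_intros indefinite_integral_continuous_1 intf)
  have GB: "(\<lambda>t. G (apply_bcontfun z) (cl t)) \<in> bcontfun" for z
  proof -
    have "continuous_on UNIV (\<lambda>t. G (apply_bcontfun z) (cl t))"
      using cl by (intro continuous_on_compose2[OF contG]) (auto simp: cl_def intro!: continuous_intros)
    moreover have "bounded (range (\<lambda>t. G (apply_bcontfun z) (cl t)))"
      by (rule bounded_subset[OF compact_imp_bounded[OF compact_continuous_image[OF contG]]]) (use cl in auto)
    ultimately show ?thesis by (simp add: bcontfun_def)
  qed
  have appT: "apply_bcontfun (T z) t = G (apply_bcontfun z) (cl t)" for z t
    by (simp add: T_def Bcontfun_inverse[OF GB])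
  have "dist (T z) (T w) \<le> 1/2 * dist z w" for z w
  proof (rule dist_bound)
    fix t'
    define t where "t = cl t'"
    define d where "d = dist z w"
    have t: "0 \<le> t" "t \<le> 1" using cl(1)[of t'] by (auto simp: t_def)
    have "((\<lambda>s. \<bar>K\<bar> * d * exp (c * s)) has_integral (\<bar>K\<bar> * d * (exp (c * t) / c) - \<bar>K\<bar> * d * (exp (c * 0) / c))) {0..t}"
    proof (rule fundamental_theorem_of_calculus[OF t(1)])
      fix s assume "s \<in> {0..t}"
      have "((\<lambda>u. \<bar>K\<bar> * d * (exp (c * u) / c)) has_real_derivative \<bar>K\<bar> * d * exp (c * s)) (at s within {0..t})"
        using c by (auto intro!: derivative_eq_intros)
      then show "((\<lambda>u. \<bar>K\<bar> * d * (exp (c * u) / c)) has_vector_derivative \<bar>K\<bar> * d * exp (c * s)) (at s within {0..t})"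
        by (simp add: has_real_derivative_iff_has_vector_derivative)
    qed
    note I = this
    have "norm (integral {0..t} (\<lambda>s. f z s - f w s)) \<le> integral {0..t} (\<lambda>s. \<bar>K\<bar> * d * exp (c * s))"
    proof (rule integral_norm_bound_integral)
      show "(\<lambda>s. f z s - f w s) integrable_on {0..t}" by (intro integrable_diff intf)
      show "(\<lambda>s. \<bar>K\<bar> * d * exp (c * s)) integrable_on {0..t}" using I by blast
      fix s
      have "norm (f z s - f w s) \<le> K * norm (exp (c * s) *\<^sub>R z s - exp (c * s) *\<^sub>R w s)"
        unfolding f_def by (rule lip)
      also have "\<dots> \<le> \<bar>K\<bar> * norm (exp (c * s) *\<^sub>R z s - exp (c * s) *\<^sub>R w s)"
        by (intro mult_right_mono) auto
      also have "norm (exp (c * s) *\<^sub>R z s - exp (c * s) *\<^sub>R w s) = exp (c * s) * dist (z s) (w s)"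
        by (simp add: dist_norm flip: scaleR_diff_right)
      also have "\<bar>K\<bar> * (exp (c * s) * dist (z s) (w s)) \<le> \<bar>K\<bar> * (exp (c * s) * d)"
        unfolding d_def by (intro mult_left_mono dist_bounded) auto
      finally show "norm (f z s - f w s) \<le> \<bar>K\<bar> * d * exp (c * s)" by (simp add: algebra_simps)
    qed
    also have "\<dots> = \<bar>K\<bar> * d * (exp (c * t) / c) - \<bar>K\<bar> * d * (1 / c)"
      using integral_unique[OF I] by simp
    also have "\<dots> \<le> \<bar>K\<bar> * d * (exp (c * t) / c)"
      using c by (simp add: d_def)
    finally have A: "norm (integral {0..t} (\<lambda>s. f z s - f w s)) \<le> \<bar>K\<bar> * d * (exp (c * t) / c)" .
    have "dist (G z t) (G w t) = exp (- c * t) * norm (integral {0..t} (\<lambda>s. f z s - f w s))"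
      by (simp add: G_def dist_norm integral_diff intf flip: scaleR_diff_right)
    also have "\<dots> \<le> exp (- c * t) * (\<bar>K\<bar> * d * (exp (c * t) / c))"
      by (intro mult_left_mono A) auto
    also have "\<dots> = \<bar>K\<bar> / c * d"
      by (simp add: exp_minus field_simps)
    also have "\<dots> \<le> 1/2 * d"
      by (intro mult_right_mono) (auto simp: d_def c_def field_simps)
    finally show "dist (T z t') (T w t') \<le> 1/2 * dist z w"
      by (simp add: appT t_def d_def)
  qed
  then have "\<exists>!z. T z = z"
    by (intro banach_fix_type[of "1/2"]) auto
  then obtain z where z: "T z = z" by blast
  define y where "y = (\<lambda>t. exp (c * t) *\<^sub>R z t)"
  have fy: "f z = (\<lambda>s. X s (y s))" by (simp add: f_def y_def)
  have y: "y t = x0 + integral {0..t} (\<lambda>s. X s (y s))" if "t \<in> {0..1}" for t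
  proof -
    have "z t = G z t" using appT[of z t] cl(2)[OF that] z by simp
    then show ?thesis by (simp add: y_def G_def f_def exp_minus)
  qed
  have ycont: "continuous_on {0..1} (\<lambda>s. X s (y s))" using contf[of _ z] by (simp add: fy)
  show thesis
  proof
    show "y 0 = x0" using y[of 0] by simp
    fix t :: real assume t: "t \<in> {0..1}"
    have "((\<lambda>t. x0 + integral {0..t} (\<lambda>s. X s (y s))) has_vector_derivative X t (y t)) (at t within {0..1})"
      using integral_has_vector_derivative[OF ycont t]
      by (auto intro!: derivative_eq_intros)
    then show "(y has_vector_derivative X t (y t)) (at t within {0..1})"
      by (rule has_vector_derivative_transform[OF t, rotated]) (use y in auto)
  qed
qed

text \<open>Gronwall's inequality is used twice. Applied to differences of solutions it gives
  injectivity and Lipschitz dependence on the starting point; applied to \<open>F t (y t)\<close>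
  along integral curves on the sphere it carries zeros to zeros in both directions of time.\<close>

lemma isotopic_by_flow:
  fixes X :: "real \<Rightarrow> complex \<times> complex \<Rightarrow> complex \<times> complex"
    and F :: "real \<Rightarrow> complex \<times> complex \<Rightarrow> complex"
  assumes cont: "continuous_on UNIV (\<lambda>p. X (fst p) (snd p))"
    and lip: "\<And>t x y. norm (X t x - X t y) \<le> K * norm (x - y)"
    and tangent: "\<And>t x. x \<bullet> X t x = 0"
    and F: "\<And>t y. t \<in> {0..1} \<Longrightarrow> (y has_vector_derivative X t (y t)) (at t within {0..1}) \<Longrightarrow>
      norm (y t) = 1 \<Longrightarrow> \<exists>d. ((\<lambda>t. F t (y t)) has_vector_derivative d) (at t within {0..1}) \<and>
        norm d \<le> C * norm (F t (y t))"
  shows "isotopic {x \<in> S3. F 0 x = 0} {x \<in> S3. F 1 x = 0}"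
proof -
  have unit: "norm (y t) = 1"
    if Z: "\<And>t x. x \<bullet> Z t x = 0" and y: "\<And>t. t \<in> {0..1} \<Longrightarrow> (y has_vector_derivative Z t (y t)) (at t within {0..1})"
      and y0: "norm (y 0) = 1" and t: "t \<in> {0..1}" for y :: "real \<Rightarrow> complex \<times> complex" and Z t
  proof -
    have "((\<lambda>t. y t \<bullet> y t - 1) has_vector_derivative 0) (at t within {0..1})" if "t \<in> {0..1}" for t
    proof -
      have "(y has_derivative (\<lambda>h. h *\<^sub>R Z t (y t))) (at t within {0..1})"
        using y[OF that] by (simp add: has_vector_derivative_def)
      from has_derivative_diff[OF has_derivative_inner[OF this this] has_derivative_const[of 1]]
      show ?thesis
        unfolding has_vector_derivative_def
        by (rule has_derivative_eq_rhs) (auto simp: fun_eq_iff inner_commute Z)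
    qed
    then have "norm (y t \<bullet> y t - 1) \<le> exp \<bar>0\<bar> * norm (y 0 \<bullet> y 0 - 1)"
      by (rule vector_gronwall) (use t in auto)
    then have "(norm (y t))\<^sup>2 = 1" using y0 by (simp add: dot_square_norm)
    then have "norm (y t) = 1 \<or> norm (y t) = -1" by (simp add: power2_eq_1_iff)
    then show ?thesis using norm_ge_zero[of "y t"] by linarith
  qed
  have ex: "\<exists>y. y 0 = x \<and> (\<forall>t\<in>{0..1}. (y has_vector_derivative X t (y t)) (at t within {0..1}))" for x
    using picard_lindelof[OF cont lip] by metis
  define \<Phi> where "\<Phi> = (\<lambda>x. SOME y. y 0 = x \<and> (\<forall>t\<in>{0..1}. (y has_vector_derivative X t (y t)) (at t within {0..1})))"
  have \<Phi>: "\<Phi> x 0 = x" "t \<in> {0..1} \<Longrightarrow> (\<Phi> x has_vector_derivative X t (\<Phi> x t)) (at t within {0..1})" for x t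
    using someI_ex[OF ex[of x]] unfolding \<Phi>_def by auto
  have near: "norm (\<Phi> x t - \<Phi> x' t) \<le> exp \<bar>K\<bar> * norm (\<Phi> x s - \<Phi> x' s)"
    if "s \<in> {0..1}" "t \<in> {0..1}" for x x' s t
    by (rule vector_gronwall[OF has_vector_derivative_diff[OF \<Phi>(2) \<Phi>(2)] lip that])
  have \<Phi>unit: "norm (\<Phi> x t) = 1" if "x \<in> S3" "t \<in> {0..1}" for x t
    by (rule unit[OF tangent \<Phi>(2)]) (use \<Phi>(1) that in auto)
  \<comment> \<open>Surjectivity comes from solving the equation backwards. The time interval from 0
    to \<open>\<tau>\<close> is rescaled to the unit interval, which accounts for the factor
    \<open>\<tau>\<close> in the reversed field.\<close>
  have surj: "\<exists>x'\<in>S3. \<Phi> x' \<tau> = x" if x: "x \<in> S3" and \<tau>: "\<tau> \<in> {0..1}" for x \<tau>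
  proof -
    define Z where "Z = (\<lambda>t y. - \<tau> *\<^sub>R X (\<tau> * (1 - t)) y)"
    have contZ: "continuous_on UNIV (\<lambda>p. Z (fst p) (snd p))"
    proof -
      have "continuous_on UNIV ((\<lambda>p. X (fst p) (snd p)) \<circ> (\<lambda>p. (\<tau> * (1 - fst p), snd p)))"
        by (intro continuous_on_compose continuous_intros continuous_on_subset[OF cont]) auto
      then show ?thesis unfolding Z_def o_def by (auto intro!: continuous_intros)
    qed
    have lipZ: "norm (Z t y - Z t y') \<le> K * norm (y - y')" for t y y'
    proof -
      have "norm (Z t y - Z t y') = \<tau> * norm (X (\<tau> * (1 - t)) y - X (\<tau> * (1 - t)) y')"
        using \<tau> by (simp add: Z_def flip: scaleR_diff_right) (simp add: norm_minus_commute)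
      also have "\<dots> \<le> 1 * norm (X (\<tau> * (1 - t)) y - X (\<tau> * (1 - t)) y')"
        using \<tau> by (intro mult_right_mono) auto
      also have "\<dots> \<le> K * norm (y - y')" using lip by simp
      finally show ?thesis .
    qed
    obtain w where w: "w 0 = x"
      "\<And>t. t \<in> {0..1} \<Longrightarrow> (w has_vector_derivative Z t (w t)) (at t within {0..1})"
      using picard_lindelof[OF contZ lipZ] by blast
    have w1: "norm (w 1) = 1"
      by (rule unit[of Z, OF _ w(2)]) (use x w(1) in \<open>auto simp: Z_def tangent\<close>)
    \<comment> \<open>The reversed curve and the rescaled integral curve from \<open>w 1\<close>
      solve the same equation and agree at time 0, hence also at time 1.\<close>
    have "norm (w (1 - 1) - \<Phi> (w 1) (\<tau> * 1)) \<le> exp \<bar>K\<bar> * norm (w (1 - 0) - \<Phi> (w 1) (\<tau> * 0))"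
    proof (rule vector_gronwall)
      fix t :: real assume t: "t \<in> {0..1}"
      have "((\<lambda>t. 1 - t) has_vector_derivative -1) (at t within {0..1})"
        by (auto intro!: derivative_eq_intros)
      moreover have "(w has_vector_derivative Z (1 - t) (w (1 - t))) (at (1 - t) within (\<lambda>t. 1 - t) ` {0..1})"
        by (rule has_vector_derivative_within_subset[OF w(2)]) (use t in auto)
      ultimately have 1: "((\<lambda>t. w (1 - t)) has_vector_derivative - Z (1 - t) (w (1 - t))) (at t within {0..1})"
        using vector_diff_chain_within[of "\<lambda>t. 1 - t" "-1" t "{0..1}" w] by (simp add: o_def)
      have "((\<lambda>t. \<tau> * t) has_vector_derivative \<tau>) (at t within {0..1})"
        by (auto intro!: derivative_eq_intros)
      moreover have "(\<Phi> (w 1) has_vector_derivative X (\<tau> * t) (\<Phi> (w 1) (\<tau> * t))) (at (\<tau> * t) within (\<lambda>t. \<tau> * t) ` {0..1})"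
        by (rule has_vector_derivative_within_subset[OF \<Phi>(2)]) (use t \<tau> in \<open>auto intro!: mult_le_one\<close>)
      ultimately have 2: "((\<lambda>t. \<Phi> (w 1) (\<tau> * t)) has_vector_derivative \<tau> *\<^sub>R X (\<tau> * t) (\<Phi> (w 1) (\<tau> * t))) (at t within {0..1})"
        using vector_diff_chain_within[of "\<lambda>t. \<tau> * t" \<tau> t "{0..1}" "\<Phi> (w 1)"] by (simp add: o_def)
      show "((\<lambda>t. w (1 - t) - \<Phi> (w 1) (\<tau> * t)) has_vector_derivative
          - Z (1 - t) (w (1 - t)) - \<tau> *\<^sub>R X (\<tau> * t) (\<Phi> (w 1) (\<tau> * t))) (at t within {0..1})"
        by (rule has_vector_derivative_diff[OF 1 2])
      have "norm (- Z (1 - t) (w (1 - t)) - \<tau> *\<^sub>R X (\<tau> * t) (\<Phi> (w 1) (\<tau> * t)))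
         = norm (Z (1 - t) (w (1 - t)) - Z (1 - t) (\<Phi> (w 1) (\<tau> * t)))"
        by (simp add: Z_def norm_minus_commute)
      then show "norm (- Z (1 - t) (w (1 - t)) - \<tau> *\<^sub>R X (\<tau> * t) (\<Phi> (w 1) (\<tau> * t)))
         \<le> K * norm (w (1 - t) - \<Phi> (w 1) (\<tau> * t))" using lipZ by simp
    qed auto
    then have "\<Phi> (w 1) \<tau> = x" using \<Phi>(1)[of "w 1"] w(1) by simp
    then show ?thesis using w1 by (intro bexI[of _ "w 1"]) auto
  qed
  \<comment> \<open>Joint continuity splits into continuity in time for a fixed starting point and
    the Lipschitz bound \<open>near\<close>, which is uniform in time.\<close>
  have contH: "continuous_on ({0..1} \<times> S3) (\<lambda>p. \<Phi> (snd p) (fst p))"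
  proof (clarsimp simp: continuous_on_def split_beta)
    fix t x assume "0 \<le> t" "t \<le> (1::real)" "norm (x :: complex \<times> complex) = 1"
    let ?A = "at (t, x) within {0..1} \<times> sphere 0 1"
    have "continuous_on {0..1} (\<Phi> x)"
      by (rule continuous_on_vector_derivative) (use \<Phi>(2) in blast)
    then have "continuous_on ({0..1} \<times> S3) (\<lambda>p. \<Phi> x (fst p))"
      by (rule continuous_on_compose2) (auto intro!: continuous_intros)
    then have 1: "((\<lambda>p. \<Phi> x (fst p) - \<Phi> x t) \<longlongrightarrow> 0) ?A"
      using \<open>0 \<le> t\<close> \<open>t \<le> 1\<close> \<open>norm x = 1\<close> by (auto simp: continuous_on_def LIM_zero_iff)
    have 2: "((\<lambda>p. exp \<bar>K\<bar> * norm (snd p - x)) \<longlongrightarrow> exp \<bar>K\<bar> * norm (snd (t, x) - x)) ?A"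
      by (intro tendsto_intros)
    have "((\<lambda>p. \<Phi> (snd p) (fst p) - \<Phi> x (fst p)) \<longlongrightarrow> 0) ?A"
    proof (rule Lim_null_comparison)
      show "\<forall>\<^sub>F p in ?A. norm (\<Phi> (snd p) (fst p) - \<Phi> x (fst p)) \<le> exp \<bar>K\<bar> * norm (snd p - x)"
        unfolding eventually_at_filter
      proof (intro always_eventually allI impI)
        fix p :: "real \<times> complex \<times> complex" assume "p \<in> {0..1} \<times> S3"
        then show "norm (\<Phi> (snd p) (fst p) - \<Phi> x (fst p)) \<le> exp \<bar>K\<bar> * norm (snd p - x)"
          using near[of 0 "fst p" "snd p" x] by (auto simp: \<Phi>(1))
      qed
    qed (use 2 in simp)
    from tendsto_add[OF this 1] have "((\<lambda>p. \<Phi> (snd p) (fst p) - \<Phi> x t) \<longlongrightarrow> 0) ?A" by simp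
    then show "((\<lambda>p. \<Phi> (snd p) (fst p)) \<longlongrightarrow> \<Phi> x t) ?A" by (simp add: LIM_zero_iff)
  qed
  have homeo: "\<exists>g'. homeomorphism S3 S3 (\<lambda>x. \<Phi> x t) g'" if t: "t \<in> {0..1}" for t
  proof (rule homeomorphism_compact)
    show "continuous_on S3 (\<lambda>x. \<Phi> x t)"
      using t by (intro continuous_on_compose2[OF contH, of S3 "\<lambda>x. (t, x)", simplified])
        (auto intro!: continuous_intros)
    show "(\<lambda>x. \<Phi> x t) ` S3 = S3"
      using surj[OF _ t] \<Phi>unit[OF _ t] by (auto simp: image_iff) metis
    show "inj_on (\<lambda>x. \<Phi> x t) S3"
    proof (rule inj_onI)
      fix x y assume "\<Phi> x t = \<Phi> y t"
      then show "x = y" using near[of t 0 x y] t \<Phi>(1) by auto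
    qed
  qed auto
  have zero: "norm (F t (\<Phi> x t)) \<le> exp \<bar>C\<bar> * norm (F s (\<Phi> x s))"
    if "s \<in> {0..1}" "t \<in> {0..1}" "x \<in> S3" for s t x
  proof -
    have "\<forall>t\<in>{0..1}. \<exists>d. ((\<lambda>t. F t (\<Phi> x t)) has_vector_derivative d) (at t within {0..1}) \<and>
        norm d \<le> C * norm (F t (\<Phi> x t))"
      using F[OF _ \<Phi>(2) \<Phi>unit[OF \<open>x \<in> S3\<close>]] by blast
    then obtain d where "\<forall>t\<in>{0..1}. ((\<lambda>t. F t (\<Phi> x t)) has_vector_derivative d t) (at t within {0..1}) \<and>
        norm (d t) \<le> C * norm (F t (\<Phi> x t))"
      by metis
    then show ?thesis
      using vector_gronwall[of "\<lambda>t. F t (\<Phi> x t)" d C s t] that by blast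
  qed
  show ?thesis
    unfolding isotopic_def
  proof (intro exI conjI)
    let ?H = "\<lambda>p::real \<times> complex \<times> complex. \<Phi> (snd p) (fst p)"
    show "homotopic_with_canon (\<lambda>g. \<exists>g'. homeomorphism S3 S3 g g') S3 S3 id (\<lambda>x. \<Phi> x 1)"
      unfolding homotopic_with_def
      using contH homeo \<Phi>(1) \<Phi>unit
      by (intro exI[of _ ?H]) (auto simp: image_subset_iff_funcset[symmetric])
    show "(\<lambda>x. \<Phi> x 1) ` {x \<in> S3. F 0 x = 0} = {x \<in> S3. F 1 x = 0}"
    proof (intro set_eqI iffI)
      fix y assume "y \<in> (\<lambda>x. \<Phi> x 1) ` {x \<in> S3. F 0 x = 0}"
      then obtain x where x: "x \<in> S3" "F 0 x = 0" "y = \<Phi> x 1" by blast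
      then show "y \<in> {x \<in> S3. F 1 x = 0}"
        using zero[of 0 1 x] \<Phi>(1) \<Phi>unit[of x 1] by simp
    next
      fix y assume y: "y \<in> {x \<in> S3. F 1 x = 0}"
      then obtain x where x: "x \<in> S3" "\<Phi> x 1 = y" using surj[of y 1] by auto
      then have "F 0 x = 0" using zero[of 1 0 x] y \<Phi>(1) by auto
      then show "y \<in> (\<lambda>x. \<Phi> x 1) ` {x \<in> S3. F 0 x = 0}" using x by auto
    qed
  qed
qed

section \<open>Lipschitz functions on compact sets\<close>

definition lipschitz_fun :: "'a::metric_space set \<Rightarrow> ('a \<Rightarrow> 'b::metric_space) \<Rightarrow> bool" where
  "lipschitz_fun A f \<longleftrightarrow> (\<exists>L. L-lipschitz_on A f)"

lemma lipschitz_fun_bounded: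
  fixes f :: "'a::metric_space \<Rightarrow> 'b::real_normed_vector"
  assumes "compact A" "lipschitz_fun A f"
  obtains M where "M > 0" "\<And>x. x \<in> A \<Longrightarrow> norm (f x) \<le> M"
proof -
  have "compact (f ` A)"
    using assms lipschitz_on_continuous_on by (auto simp: lipschitz_fun_def intro: compact_continuous_image)
  then have "bounded (f ` A)" by (rule compact_imp_bounded)
  then show ?thesis using that unfolding bounded_pos by auto
qed

lemma lipschitz_fun_linear:
  assumes "bounded_linear h" "lipschitz_fun A f"
  shows "lipschitz_fun A (\<lambda>x. h (f x))"
proof -
  from assms obtain L where L: "L-lipschitz_on A f" by (auto simp: lipschitz_fun_def)
  obtain B where "B-lipschitz_on (f ` A) h" using bounded_linear.lipschitz_boundE[OF assms(1)] by blast
  from lipschitz_on_compose2[OF L this] show ?thesis by (auto simp: lipschitz_fun_def o_def)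
qed

lemma lipschitz_fun_const: "lipschitz_fun A (\<lambda>x. c)"
  unfolding lipschitz_fun_def by (rule exI, rule lipschitz_on_constant)

lemma lipschitz_fun_add:
  fixes f g :: "'a::metric_space \<Rightarrow> 'b::real_normed_vector"
  shows "lipschitz_fun A f \<Longrightarrow> lipschitz_fun A g \<Longrightarrow> lipschitz_fun A (\<lambda>x. f x + g x)"
  unfolding lipschitz_fun_def by (elim exE, rule exI, rule lipschitz_on_add)

lemma lipschitz_fun_diff:
  fixes f g :: "'a::metric_space \<Rightarrow> 'b::real_normed_vector"
  shows "lipschitz_fun A f \<Longrightarrow> lipschitz_fun A g \<Longrightarrow> lipschitz_fun A (\<lambda>x. f x - g x)"
  unfolding lipschitz_fun_def by (elim exE, rule exI, rule lipschitz_on_diff)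

lemma lipschitz_fun_sum:
  fixes f :: "'i \<Rightarrow> 'a::metric_space \<Rightarrow> 'b::real_normed_vector"
  shows "(\<And>i. i \<in> I \<Longrightarrow> lipschitz_fun A (f i)) \<Longrightarrow> lipschitz_fun A (\<lambda>x. \<Sum>i\<in>I. f i x)"
  by (induction I rule: infinite_finite_induct) (auto intro: lipschitz_fun_const lipschitz_fun_add)

text \<open>The product rule changes one factor at a time; compactness enters because the other
  factor has to be bounded.\<close>

lemma lipschitz_fun_bilinear:
  fixes f :: "'a::metric_space \<Rightarrow> 'b::real_normed_vector" and g :: "'a \<Rightarrow> 'c::real_normed_vector"
  assumes b: "bounded_bilinear b" and A: "compact A" and f: "lipschitz_fun A f" and g: "lipschitz_fun A g"
  shows "lipschitz_fun A (\<lambda>x. b (f x) (g x))"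
proof -
  interpret bounded_bilinear b by fact
  obtain K where K: "K > 0" "\<And>x y. norm (b x y) \<le> norm x * norm y * K" using pos_bounded by blast
  obtain M where M: "M > 0" "\<And>x. x \<in> A \<Longrightarrow> norm (f x) \<le> M" using lipschitz_fun_bounded[OF A f] by blast
  obtain N where N: "N > 0" "\<And>x. x \<in> A \<Longrightarrow> norm (g x) \<le> N" using lipschitz_fun_bounded[OF A g] by blast
  obtain L where L: "L-lipschitz_on A f" using f by (auto simp: lipschitz_fun_def)
  obtain R where R: "R-lipschitz_on A g" using g by (auto simp: lipschitz_fun_def)
  have "(M * R * K + L * N * K)-lipschitz_on A (\<lambda>x. b (f x) (g x))"
  proof (rule lipschitz_onI)
    fix x y assume xy: "x \<in> A" "y \<in> A"
    have "b (f x) (g x) - b (f y) (g y) = b (f x) (g x - g y) + b (f x - f y) (g y)"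
      by (simp add: diff_left diff_right)
    also have "norm \<dots> \<le> norm (f x) * norm (g x - g y) * K + norm (f x - f y) * norm (g y) * K"
      by (intro norm_triangle_le add_mono K)
    also have "\<dots> \<le> M * (R * dist x y) * K + (L * dist x y) * N * K"
      using xy K(1) M N lipschitz_onD[OF L xy] lipschitz_onD[OF R xy] lipschitz_on_nonneg[OF L]
      by (intro add_mono mult_right_mono mult_mono) (auto simp: dist_norm)
    finally show "dist (b (f x) (g x)) (b (f y) (g y)) \<le> (M * R * K + L * N * K) * dist x y"
      by (simp add: dist_norm algebra_simps)
  qed (use M N K lipschitz_on_nonneg[OF L] lipschitz_on_nonneg[OF R] in auto)
  then show ?thesis by (auto simp: lipschitz_fun_def)
qed

lemmas lipschitz_fun_mult = lipschitz_fun_bilinear[OF bounded_bilinear_mult]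
lemmas lipschitz_fun_scaleR = lipschitz_fun_bilinear[OF bounded_bilinear_scaleR]
lemmas lipschitz_fun_inner = lipschitz_fun_bilinear[OF bounded_bilinear_inner]

lemma lipschitz_fun_inverse:
  fixes f :: "'a::metric_space \<Rightarrow> real"
  assumes A: "compact A" and f: "lipschitz_fun A f" and pos: "\<And>x. x \<in> A \<Longrightarrow> f x > 0"
  shows "lipschitz_fun A (\<lambda>x. inverse (f x))"
proof (cases "A = {}")
  case False
  obtain L where L: "L-lipschitz_on A f" using f by (auto simp: lipschitz_fun_def)
  obtain x0 where x0: "x0 \<in> A" "\<And>x. x \<in> A \<Longrightarrow> f x0 \<le> f x"
    using continuous_attains_inf[OF A False lipschitz_on_continuous_on[OF L]] by blast
  define m where "m = f x0"
  have m: "m > 0" "\<And>x. x \<in> A \<Longrightarrow> m \<le> f x" using x0 pos by (auto simp: m_def)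
  have "(L / (m * m))-lipschitz_on A (\<lambda>x. inverse (f x))"
  proof (rule lipschitz_onI)
    fix x y assume xy: "x \<in> A" "y \<in> A"
    have "dist (inverse (f x)) (inverse (f y)) = \<bar>f x - f y\<bar> / (f x * f y)"
      using pos[OF xy(1)] pos[OF xy(2)]
      by (simp add: dist_real_def divide_simps abs_mult inverse_eq_divide)
    also have "\<dots> \<le> (L * dist x y) / (m * m)"
    proof (rule frac_le)
      show "\<bar>f x - f y\<bar> \<le> L * dist x y" using lipschitz_onD[OF L xy] by (simp add: dist_real_def)
      show "m * m \<le> f x * f y" using m(1) m(2)[OF xy(1)] m(2)[OF xy(2)] by (intro mult_mono) auto
    qed (use m lipschitz_on_nonneg[OF L] in auto)
    finally show "dist (inverse (f x)) (inverse (f y)) \<le> L / (m * m) * dist x y" by simp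
  qed (use m lipschitz_on_nonneg[OF L] in auto)
  then show ?thesis by (auto simp: lipschitz_fun_def)
qed (auto simp: lipschitz_fun_def)

text \<open>The extension is homogeneous of degree one along rays, which makes it Lipschitz also at
  the origin and preserves tangency to spheres; time is clamped to the unit interval. Thus the
  theory of globally Lipschitz fields applies to a field that is only given on the sphere.\<close>

lemma sphere_field_extension:
  fixes X :: "real \<Rightarrow> 'a::euclidean_space \<Rightarrow> 'a"
  assumes X: "lipschitz_fun ({0..1} \<times> sphere 0 1) (\<lambda>p. X (fst p) (snd p))"
  obtains Y K where "continuous_on UNIV (\<lambda>p. Y (fst p) (snd p))"
    "\<And>t x y. norm (Y t x - Y t y) \<le> K * norm (x - y)"
    "\<And>t x. t \<in> {0..1} \<Longrightarrow> norm x = 1 \<Longrightarrow> Y t x = X t x"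
    "\<And>t x. x \<noteq> 0 \<Longrightarrow> \<exists>s\<in>{0..1}. Y t x = norm x *\<^sub>R X s (x /\<^sub>R norm x)"
    "\<And>t. Y t 0 = 0"
proof -
  define cl where "cl = (\<lambda>t::real. max 0 (min 1 t))"
  have cl: "cl t \<in> {0..1}" "t \<in> {0..1} \<Longrightarrow> cl t = t" "\<bar>cl s - cl t\<bar> \<le> \<bar>s - t\<bar>" for s t
    by (auto simp: cl_def)
  define Y where "Y = (\<lambda>t x. norm x *\<^sub>R X (cl t) (x /\<^sub>R norm x))"
  let ?\<Omega> = "{0..1} \<times> sphere (0::'a) 1"
  obtain M where M: "M > 0" "\<And>p. p \<in> ?\<Omega> \<Longrightarrow> norm (X (fst p) (snd p)) \<le> M"
    using lipschitz_fun_bounded[OF compact_Times[OF compact_Icc compact_sphere] X] by blast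
  obtain L where L: "L-lipschitz_on ?\<Omega> (\<lambda>p. X (fst p) (snd p))"
    using X by (auto simp: lipschitz_fun_def)
  have L0: "L \<ge> 0" using lipschitz_on_nonneg[OF L] .
  have XM: "norm (X (cl t) x) \<le> M" if "norm x = 1" for t x
    using M(2)[of "(cl t, x)"] cl(1)[of t] that by simp
  have XL: "norm (X (cl t) x - X (cl t) y) \<le> L * norm (x - y)" if "norm x = 1" "norm y = 1" for t x y
    using lipschitz_onD[OF L, of "(cl t, x)" "(cl t, y)"] cl(1)[of t] that by (simp add: dist_Pair_Pair dist_norm)
  have XT: "norm (X (cl t) x - X (cl s) x) \<le> L * \<bar>t - s\<bar>" if "norm x = 1" for t s x
  proof -
    have "norm (X (cl t) x - X (cl s) x) \<le> L * \<bar>cl t - cl s\<bar>"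
      using lipschitz_onD[OF L, of "(cl t, x)" "(cl s, x)"] cl(1)[of t] cl(1)[of s] that
      by (simp add: dist_Pair_Pair dist_norm dist_real_def)
    also have "\<dots> \<le> L * \<bar>t - s\<bar>" by (intro mult_left_mono cl L0)
    finally show ?thesis .
  qed
  have YL: "norm (Y t x - Y t y) \<le> (M + 2 * L) * norm (x - y)" for t x y
  proof (cases "x = 0 \<or> y = 0")
    case True
    have "norm (Y t z) \<le> M * norm z" for z
      by (cases "z = 0") (auto simp: Y_def mult.commute intro!: mult_right_mono XM)
    moreover have "M * norm z \<le> (M + 2 * L) * norm z" for z :: 'a
      using L0 by (intro mult_right_mono) auto
    ultimately have "norm (Y t z) \<le> (M + 2 * L) * norm z" for z using order_trans by blast
    moreover have "Y t 0 = 0" by (simp add: Y_def)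
    ultimately show ?thesis using True by auto
  next
    case False
    define a b where "a = x /\<^sub>R norm x" and "b = y /\<^sub>R norm y"
    have ab: "norm a = 1" "norm b = 1" "norm x *\<^sub>R a = x" "norm y *\<^sub>R b = y"
      using False by (auto simp: a_def b_def)
    \<comment> \<open>This identity bounds the distance of the two unit vectors already multiplied
      by \<open>norm y\<close>, so the Lipschitz constant does not blow up near the origin.\<close>
    have "norm y *\<^sub>R (a - b) = (x - y) + (norm y - norm x) *\<^sub>R a"
      using ab by (simp add: algebra_simps)
    then have "norm y * norm (a - b) \<le> norm (x - y) + \<bar>norm y - norm x\<bar> * norm a"
      by (metis norm_triangle_ineq norm_scaleR abs_norm_cancel)
    also have "\<dots> \<le> 2 * norm (x - y)"
      using norm_triangle_ineq3[of y x] by (simp add: ab norm_minus_commute)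
    finally have 1: "norm y * norm (a - b) \<le> 2 * norm (x - y)" .
    have "Y t x - Y t y = norm y *\<^sub>R (X (cl t) a - X (cl t) b) + (norm x - norm y) *\<^sub>R X (cl t) a"
      by (simp add: Y_def a_def b_def algebra_simps)
    also have "norm \<dots> \<le> norm y * norm (X (cl t) a - X (cl t) b) + \<bar>norm x - norm y\<bar> * norm (X (cl t) a)"
      by (metis norm_triangle_ineq norm_scaleR abs_norm_cancel)
    also have "\<dots> \<le> norm y * (L * norm (a - b)) + norm (x - y) * M"
      by (intro add_mono mult_left_mono mult_mono XL XM norm_triangle_ineq3 ab) auto
    also have "norm y * (L * norm (a - b)) \<le> L * (2 * norm (x - y))"
      using mult_left_mono[OF 1 L0] by (simp add: algebra_simps)
    finally show ?thesis by (simp add: algebra_simps)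
  qed
  have "continuous_on UNIV (\<lambda>p. Y (fst p) (snd p))"
  proof (clarsimp simp: continuous_on_def split_beta)
    fix s y
    have "((\<lambda>p. Y (fst p) (snd p) - Y s y) \<longlongrightarrow> 0) (at (s, y))"
    proof (rule Lim_null_comparison)
      show "\<forall>\<^sub>F p in at (s, y). norm (Y (fst p) (snd p) - Y s y)
          \<le> (M + 2 * L) * norm (snd p - y) + norm y * (L * \<bar>fst p - s\<bar>)"
      proof (intro always_eventually allI)
        fix p :: "real \<times> 'a"
        have "norm (Y (fst p) y - Y s y) \<le> norm y * (L * \<bar>fst p - s\<bar>)"
        proof (cases "y = 0")
          case False
          have "norm (Y (fst p) y - Y s y) = norm y * norm (X (cl (fst p)) (y /\<^sub>R norm y) - X (cl s) (y /\<^sub>R norm y))"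
            by (simp add: Y_def flip: scaleR_diff_right)
          also have "\<dots> \<le> norm y * (L * \<bar>fst p - s\<bar>)"
            using False by (intro mult_left_mono XT) auto
          finally show ?thesis .
        qed (simp add: Y_def)
        then show "norm (Y (fst p) (snd p) - Y s y) \<le> (M + 2 * L) * norm (snd p - y) + norm y * (L * \<bar>fst p - s\<bar>)"
          using YL[of "fst p" "snd p" y] norm_triangle_ineq[of "Y (fst p) (snd p) - Y (fst p) y" "Y (fst p) y - Y s y"]
          by simp
      qed
      have "((\<lambda>p. (M + 2 * L) * norm (snd p - y) + norm y * (L * \<bar>fst p - s\<bar>)) \<longlongrightarrow>
         (M + 2 * L) * norm (snd (s, y) - y) + norm y * (L * \<bar>fst (s, y) - s\<bar>)) (at (s, y))"
        by (intro tendsto_intros)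
      then show "((\<lambda>p. (M + 2 * L) * norm (snd p - y) + norm y * (L * \<bar>fst p - s\<bar>)) \<longlongrightarrow> 0) (at (s, y))" by simp
    qed
    then show "((\<lambda>p. Y (fst p) (snd p)) \<longlongrightarrow> Y s y) (at (s, y))" by (simp add: LIM_zero_iff)
  qed
  then show thesis
  proof (rule that)
    show "norm (Y t x - Y t y) \<le> (M + 2 * L) * norm (x - y)" for t x y by (rule YL)
    show "\<exists>s\<in>{0..1}. Y t x = norm x *\<^sub>R X s (x /\<^sub>R norm x)" for t x
      using cl(1) unfolding Y_def by blast
  qed (auto simp: Y_def cl(2))
qed

text \<open>The field \<open>X\<close> solves \<open>D X = - q + \<bar>F\<bar>\<^sup>2 s\<close> instead of \<open>D X = - q\<close>. The additional term makes the
  Gram matrix invertible on the whole sphere, so that no partition of unity is needed, and it is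
  small enough for Gronwall's inequality to preserve the zeros of \<open>F\<close>.\<close>

lemma isotopic_of_transverse_family:
  fixes p q :: "complex \<times> complex \<Rightarrow> complex" and p' q' :: "complex \<times> complex \<Rightarrow> complex \<times> complex \<Rightarrow> complex"
  assumes p: "\<And>x. (p has_derivative p' x) (at x)" and q: "\<And>x. (q has_derivative q' x) (at x)"
    and lip: "lipschitz_fun S3 p" "lipschitz_fun S3 q"
      "\<And>w. lipschitz_fun S3 (\<lambda>x. p' x w)" "\<And>w. lipschitz_fun S3 (\<lambda>x. q' x w)"
      "lipschitz_fun S3 (\<lambda>x. p' x x)" "lipschitz_fun S3 (\<lambda>x. q' x x)"
    and transverse: "\<And>t x y. t \<in> {0..1} \<Longrightarrow> x \<in> S3 \<Longrightarrow> p x + t *\<^sub>R q x = 0 \<Longrightarrow>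
      \<exists>w. x \<bullet> w = 0 \<and> p' x w + t *\<^sub>R q' x w = y"
  shows "isotopic {x \<in> S3. p x = 0} {x \<in> S3. p x + q x = 0}"
proof -
  define F where "F = (\<lambda>t x. p x + t *\<^sub>R q x)"
  define D where "D = (\<lambda>t x w. p' x w + t *\<^sub>R q' x w)"
  have D: "bounded_linear (D t x)" for t x
    unfolding D_def using has_derivative_bounded_linear[OF p] has_derivative_bounded_linear[OF q]
    by (intro bounded_linear_add bounded_linear_scaleR_const bounded_linear_const_scaleR) auto
  \<comment> \<open>On the unit sphere this is the derivative composed with the orthogonal
    projection to the tangent space. The vector \<open>g \<beta> t x\<close> is the gradient of its
    component along \<open>\<beta>\<close>; \<open>g1\<close> and \<open>g2\<close> belong to the
    real and the imaginary part.\<close>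
  define D\<tau> where "D\<tau> = (\<lambda>t x w. D t x w - (x \<bullet> w) *\<^sub>R D t x x)"
  define g where "g = (\<lambda>\<beta> t x. \<Sum>b\<in>Basis. (D\<tau> t x b \<bullet> \<beta>) *\<^sub>R (b :: complex \<times> complex))"
  have linD\<tau>: "linear (D\<tau> t x)" for t x
    using bounded_linear.linear[OF D, of t x]
    by (auto simp: D\<tau>_def linear_iff inner_add_right scaleR_add_left algebra_simps)
  have g_inner: "g \<beta> t x \<bullet> w = D\<tau> t x w \<bullet> \<beta>" for \<beta> t x w
  proof -
    have "D\<tau> t x w = D\<tau> t x (\<Sum>b\<in>Basis. (w \<bullet> b) *\<^sub>R b)" by (simp add: euclidean_representation)
    also have "\<dots> = (\<Sum>b\<in>Basis. (w \<bullet> b) *\<^sub>R D\<tau> t x b)"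
      by (simp add: linear_sum[OF linD\<tau>] linear_scale[OF linD\<tau>])
    finally show ?thesis
      by (simp add: g_def inner_sum_left inner_commute[of w] mult.commute)
  qed
  have tangent: "x \<bullet> g \<beta> t x = 0" if "norm x = 1" for \<beta> t x
    using that by (subst inner_commute, subst g_inner) (simp add: D\<tau>_def dot_square_norm)
  define g1 where "g1 = g 1"
  define g2 where "g2 = g \<i>"
  define N where "N = (\<lambda>t x. F t x \<bullet> F t x)"
  \<comment> \<open>The Gram matrix of \<open>g1\<close> and \<open>g2\<close> plus \<open>N\<close>
    times the identity. Below, \<open>s1\<close> and \<open>s2\<close> solve the linear system with
    right-hand side \<open>q x\<close> by Cramer's rule.\<close>
  define M11 where "M11 = (\<lambda>t x. g1 t x \<bullet> g1 t x + N t x)"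
  define M12 where "M12 = (\<lambda>t x. g1 t x \<bullet> g2 t x)"
  define M22 where "M22 = (\<lambda>t x. g2 t x \<bullet> g2 t x + N t x)"
  define det where "det = (\<lambda>t x. M11 t x * M22 t x - M12 t x * M12 t x)"
  define s1 where "s1 = (\<lambda>t x. (M22 t x * (q x \<bullet> 1) - M12 t x * (q x \<bullet> \<i>)) * inverse (det t x))"
  define s2 where "s2 = (\<lambda>t x. (M11 t x * (q x \<bullet> \<i>) - M12 t x * (q x \<bullet> 1)) * inverse (det t x))"
  define X where "X = (\<lambda>t x. - (s1 t x *\<^sub>R g1 t x + s2 t x *\<^sub>R g2 t x))"
  let ?\<Omega> = "{0..1::real} \<times> S3"
  have \<Omega>: "compact ?\<Omega>" by (intro compact_Times) auto
  have det_pos: "det t x > 0" if t: "t \<in> {0..1}" and x: "x \<in> S3" for t x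
  proof -
    have CS: "(g1 t x \<bullet> g2 t x)\<^sup>2 \<le> (g1 t x \<bullet> g1 t x) * (g2 t x \<bullet> g2 t x)" by (rule Cauchy_Schwarz_ineq)
    have det: "det t x = ((g1 t x \<bullet> g1 t x) * (g2 t x \<bullet> g2 t x) - (g1 t x \<bullet> g2 t x)\<^sup>2)
        + N t x * (g1 t x \<bullet> g1 t x + g2 t x \<bullet> g2 t x) + N t x * N t x"
      by (simp add: det_def M11_def M12_def M22_def power2_eq_square algebra_simps)
    have N: "N t x \<ge> 0" by (simp add: N_def)
    show ?thesis
    proof (cases "F t x = 0")
      case False
      then have "N t x * N t x > 0" by (simp add: N_def)
      moreover have "N t x * (g1 t x \<bullet> g1 t x + g2 t x \<bullet> g2 t x) \<ge> 0" using N by simp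
      ultimately show ?thesis using CS unfolding det by linarith
    next
      case True
      then have sol: "\<exists>w. x \<bullet> w = 0 \<and> D t x w = y" for y
        using transverse[OF t x] unfolding F_def D_def by blast
      \<comment> \<open>Tangent preimages of \<open>1\<close> and \<open>\<i>\<close> are dual to
        \<open>g1\<close> and \<open>g2\<close>, which are therefore linearly independent.\<close>
      obtain w1 where w1: "x \<bullet> w1 = 0" "D t x w1 = 1" using sol by blast
      obtain w2 where w2: "x \<bullet> w2 = 0" "D t x w2 = \<i>" using sol by blast
      have gw: "g1 t x \<bullet> w1 = 1" "g2 t x \<bullet> w1 = 0" "g1 t x \<bullet> w2 = 0" "g2 t x \<bullet> w2 = 1"
        using w1 w2 by (simp_all add: g1_def g2_def g_inner D\<tau>_def)
      \<comment> \<open>Up to the factor \<open>g2 t x \<bullet> g2 t x\<close> this is the part of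
        \<open>g1\<close> orthogonal to \<open>g2\<close>; its squared norm is a positive multiple
        of the Gram determinant.\<close>
      define v where "v = (g2 t x \<bullet> g2 t x) *\<^sub>R g1 t x - (g1 t x \<bullet> g2 t x) *\<^sub>R g2 t x"
      have "g2 t x \<noteq> 0" using gw(4) by auto
      then have E: "g2 t x \<bullet> g2 t x > 0" by simp
      have "v \<bullet> w1 = g2 t x \<bullet> g2 t x" by (simp add: v_def inner_diff_left gw)
      then have "v \<noteq> 0" using E by auto
      then have "v \<bullet> v > 0" by simp
      also have "v \<bullet> v = (g2 t x \<bullet> g2 t x) * ((g1 t x \<bullet> g1 t x) * (g2 t x \<bullet> g2 t x) - (g1 t x \<bullet> g2 t x)\<^sup>2)"
        by (simp add: v_def inner_diff_left inner_diff_right inner_commute[of "g2 t x" "g1 t x"] power2_eq_square algebra_simps)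
      finally have "(g1 t x \<bullet> g1 t x) * (g2 t x \<bullet> g2 t x) - (g1 t x \<bullet> g2 t x)\<^sup>2 > 0"
        using E by (simp add: zero_less_mult_iff)
      then show ?thesis using N True by (simp add: det N_def)
    qed
  qed
  have solves: "q x + D t x (X t x) = N t x *\<^sub>R (complex_of_real (s1 t x) + \<i> * complex_of_real (s2 t x))"
    if t: "t \<in> {0..1}" and x: "x \<in> S3" for t x
  proof -
    have d: "det t x \<noteq> 0" using det_pos[OF t x] by simp
    have e1: "M11 t x * s1 t x + M12 t x * s2 t x = q x \<bullet> 1"
    proof -
      have "M11 t x * s1 t x + M12 t x * s2 t x = (q x \<bullet> 1) * det t x * inverse (det t x)"
        by (simp add: s1_def s2_def det_def algebra_simps)
      then show ?thesis using d by simp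
    qed
    have e2: "M12 t x * s1 t x + M22 t x * s2 t x = q x \<bullet> \<i>"
    proof -
      have "M12 t x * s1 t x + M22 t x * s2 t x = (q x \<bullet> \<i>) * det t x * inverse (det t x)"
        by (simp add: s1_def s2_def det_def algebra_simps)
      then show ?thesis using d by simp
    qed
    have xX: "x \<bullet> X t x = 0" using tangent x by (simp add: X_def g1_def g2_def inner_diff_right)
    have "D t x (X t x) \<bullet> 1 = g1 t x \<bullet> X t x" "D t x (X t x) \<bullet> \<i> = g2 t x \<bullet> X t x"
      by (simp_all only: g1_def g2_def g_inner) (simp_all add: D\<tau>_def xX)
    then have "D t x (X t x) \<bullet> 1 = - (q x \<bullet> 1 - N t x * s1 t x)" "D t x (X t x) \<bullet> \<i> = - (q x \<bullet> \<i> - N t x * s2 t x)"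
      using e1 e2 by (simp_all add: X_def M11_def M12_def M22_def inner_add_right inner_commute[of "g2 t x" "g1 t x"] algebra_simps)
    then show ?thesis by (simp add: complex_eq_iff inner_complex_def)
  qed
  have LF: "lipschitz_fun ?\<Omega> (\<lambda>z. f (snd z))" if "lipschitz_fun S3 f" for f :: "complex \<times> complex \<Rightarrow> 'd::metric_space"
  proof -
    from that obtain L where L: "L-lipschitz_on S3 f" by (auto simp: lipschitz_fun_def)
    have "1-lipschitz_on ?\<Omega> snd" by (rule lipschitz_onI) (auto simp: dist_snd_le)
    moreover have "L-lipschitz_on (snd ` ?\<Omega>) f" by (rule lipschitz_on_subset[OF L]) auto
    ultimately have "(L * 1)-lipschitz_on ?\<Omega> (\<lambda>z. f (snd z))" by (rule lipschitz_on_compose2)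
    then show ?thesis by (auto simp: lipschitz_fun_def)
  qed
  have Lfst: "lipschitz_fun ?\<Omega> fst"
    unfolding lipschitz_fun_def by (rule exI[of _ 1], rule lipschitz_onI) (auto simp: dist_fst_le)
  have Lid: "lipschitz_fun S3 (\<lambda>x. x)"
    unfolding lipschitz_fun_def by (rule exI, rule lipschitz_on_id)
  note Lintros = lipschitz_fun_add lipschitz_fun_diff lipschitz_fun_const lipschitz_fun_mult[OF \<Omega>]
    lipschitz_fun_scaleR[OF \<Omega>] lipschitz_fun_inner[OF \<Omega>] LF lip Lid Lfst
  have LFF: "lipschitz_fun ?\<Omega> (\<lambda>z. F (fst z) (snd z))"
    unfolding F_def by (intro Lintros)
  have LD\<tau>: "lipschitz_fun ?\<Omega> (\<lambda>z. D\<tau> (fst z) (snd z) w)" for w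
    unfolding D\<tau>_def D_def by (intro Lintros)
  have Lg: "lipschitz_fun ?\<Omega> (\<lambda>z. g \<beta> (fst z) (snd z))" for \<beta>
    unfolding g_def by (intro lipschitz_fun_sum Lintros LD\<tau>)
  have LN: "lipschitz_fun ?\<Omega> (\<lambda>z. N (fst z) (snd z))" unfolding N_def by (intro Lintros LFF)
  have LM: "lipschitz_fun ?\<Omega> (\<lambda>z. M11 (fst z) (snd z))" "lipschitz_fun ?\<Omega> (\<lambda>z. M12 (fst z) (snd z))"
    "lipschitz_fun ?\<Omega> (\<lambda>z. M22 (fst z) (snd z))"
    unfolding M11_def M12_def M22_def g1_def g2_def by (intro Lintros LN Lg)+
  have Ldet: "lipschitz_fun ?\<Omega> (\<lambda>z. inverse (det (fst z) (snd z)))"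
    by (rule lipschitz_fun_inverse[OF \<Omega>]) (use det_pos in \<open>auto simp: det_def intro!: Lintros LM\<close>)
  have Ls: "lipschitz_fun ?\<Omega> (\<lambda>z. s1 (fst z) (snd z))" "lipschitz_fun ?\<Omega> (\<lambda>z. s2 (fst z) (snd z))"
    unfolding s1_def s2_def by (intro Lintros LM Ldet)+
  have LX: "lipschitz_fun ?\<Omega> (\<lambda>z. X (fst z) (snd z))"
  proof -
    have "lipschitz_fun ?\<Omega> (\<lambda>z. 0 - (s1 (fst z) (snd z) *\<^sub>R g1 (fst z) (snd z) + s2 (fst z) (snd z) *\<^sub>R g2 (fst z) (snd z)))"
      unfolding g1_def g2_def by (intro Lintros Ls Lg)
    then show ?thesis by (simp add: X_def)
  qed
  obtain Y K where Y: "continuous_on UNIV (\<lambda>p. Y (fst p) (snd p))"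
    "\<And>t x y. norm (Y t x - Y t y) \<le> K * norm (x - y)"
    "\<And>t x. t \<in> {0..1} \<Longrightarrow> norm x = 1 \<Longrightarrow> Y t x = X t x"
    "\<And>t x. x \<noteq> 0 \<Longrightarrow> \<exists>s\<in>{0..1}. Y t x = norm x *\<^sub>R X s (x /\<^sub>R norm x)"
    "\<And>t. Y t 0 = 0"
    by (rule sphere_field_extension[OF LX]) (rule that)
  obtain B1 where B1: "B1 > 0" "\<And>z. z \<in> ?\<Omega> \<Longrightarrow> norm (F (fst z) (snd z)) \<le> B1"
    using lipschitz_fun_bounded[OF \<Omega> LFF] by blast
  obtain B2 where B2: "B2 > 0" "\<And>z. z \<in> ?\<Omega> \<Longrightarrow> norm (s1 (fst z) (snd z)) \<le> B2"
    using lipschitz_fun_bounded[OF \<Omega> Ls(1)] by blast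
  obtain B3 where B3: "B3 > 0" "\<And>z. z \<in> ?\<Omega> \<Longrightarrow> norm (s2 (fst z) (snd z)) \<le> B3"
    using lipschitz_fun_bounded[OF \<Omega> Ls(2)] by blast
  have "isotopic {x \<in> S3. F 0 x = 0} {x \<in> S3. F 1 x = 0}"
  proof (rule isotopic_by_flow[OF Y(1,2)])
    fix t :: real and x :: "complex \<times> complex"
    show "x \<bullet> Y t x = 0"
    proof (cases "x = 0")
      case False
      then obtain s where s: "Y t x = norm x *\<^sub>R X s (x /\<^sub>R norm x)" using Y(4) by blast
      have "(x /\<^sub>R norm x) \<bullet> X s (x /\<^sub>R norm x) = 0"
        using tangent[of "x /\<^sub>R norm x"] False by (simp add: X_def g1_def g2_def inner_diff_right)
      then show ?thesis using False by (simp add: s)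
    qed simp
  next
    fix t :: real and y :: "real \<Rightarrow> complex \<times> complex"
    assume t: "t \<in> {0..1}" and dy: "(y has_vector_derivative Y t (y t)) (at t within {0..1})" and n: "norm (y t) = 1"
    have x: "y t \<in> S3" using n by simp
    have dy': "(y has_derivative (\<lambda>h. h *\<^sub>R X t (y t))) (at t within {0..1})"
      using dy Y(3)[OF t n] by (simp add: has_vector_derivative_def)
    have "((\<lambda>t. F t (y t)) has_derivative
        (\<lambda>h. p' (y t) (h *\<^sub>R X t (y t)) + (t *\<^sub>R q' (y t) (h *\<^sub>R X t (y t)) + h *\<^sub>R q (y t)))) (at t within {0..1})"
      unfolding F_def
      by (intro has_derivative_add has_derivative_scaleR has_derivative_ident
          has_derivative_compose[OF dy' p] has_derivative_compose[OF dy' q])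
    then have "((\<lambda>t. F t (y t)) has_vector_derivative (q (y t) + D t (y t) (X t (y t)))) (at t within {0..1})"
      unfolding has_vector_derivative_def
      by (rule has_derivative_eq_rhs)
        (use linear_scale[OF bounded_linear.linear[OF D]] has_derivative_bounded_linear[OF p] has_derivative_bounded_linear[OF q]
          in \<open>auto simp: fun_eq_iff D_def linear_scale[OF bounded_linear.linear] algebra_simps\<close>)
    moreover have "norm (q (y t) + D t (y t) (X t (y t))) \<le> B1 * (B2 + B3) * norm (F t (y t))"
    proof -
      have "norm (q (y t) + D t (y t) (X t (y t)))
          = N t (y t) * norm (complex_of_real (s1 t (y t)) + \<i> * complex_of_real (s2 t (y t)))"
        unfolding solves[OF t x] by (simp add: N_def)
      also have "\<dots> \<le> N t (y t) * (B2 + B3)"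
        using B2(2)[of "(t, y t)"] B3(2)[of "(t, y t)"] t x
        by (intro mult_left_mono norm_triangle_le add_mono) (auto simp: N_def norm_mult)
      also have "N t (y t) = norm (F t (y t)) * norm (F t (y t))"
        by (simp add: N_def dot_square_norm power2_eq_square)
      also have "\<dots> * (B2 + B3) \<le> (B1 * norm (F t (y t))) * (B2 + B3)"
        using B1(2)[of "(t, y t)"] B2 B3 t x by (intro mult_right_mono) auto
      finally show ?thesis by (simp add: algebra_simps)
    qed
    ultimately show "\<exists>d. ((\<lambda>t. F t (y t)) has_vector_derivative d) (at t within {0..1}) \<and>
        norm d \<le> B1 * (B2 + B3) * norm (F t (y t))"
      by blast
  qed
  then show ?thesis by (simp add: F_def)
qed

section \<open>Mixed polynomials and small spheres\<close>

definition mono_deg :: "nat \<times> nat \<times> nat \<times> nat \<Rightarrow> nat \<times> nat" where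
  "mono_deg = (\<lambda>(a, b, c, d). (a + b, c + d))"

definition mono_eval :: "nat \<times> nat \<times> nat \<times> nat \<Rightarrow> complex \<times> complex \<Rightarrow> complex" where
  "mono_eval = (\<lambda>(a, b, c, d) (u, v). u ^ a * cnj u ^ b * v ^ c * cnj v ^ d)"

definition mono_deriv :: "nat \<times> nat \<times> nat \<times> nat \<Rightarrow> complex \<times> complex \<Rightarrow> complex \<times> complex \<Rightarrow> complex" where
  "mono_deriv = (\<lambda>(a, b, c, d) (u, v) (x, y).
     (of_nat a * u ^ (a - 1) * x) * cnj u ^ b * v ^ c * cnj v ^ d +
     u ^ a * (of_nat b * cnj u ^ (b - 1) * cnj x) * v ^ c * cnj v ^ d +
     u ^ a * cnj u ^ b * (of_nat c * v ^ (c - 1) * y) * cnj v ^ d +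
     u ^ a * cnj u ^ b * v ^ c * (of_nat d * cnj v ^ (d - 1) * cnj y))"

text \<open>Coefficients live on a fixed index set and may vanish, so limits of coefficient
  sequences and restrictions to faces keep the same form.\<close>

definition ev :: "(nat \<times> nat \<times> nat \<times> nat) set \<Rightarrow> (nat \<times> nat \<times> nat \<times> nat \<Rightarrow> complex) \<Rightarrow> complex \<times> complex \<Rightarrow> complex" where
  "ev K c z = (\<Sum>m\<in>K. c m * mono_eval m z)"

definition dev :: "(nat \<times> nat \<times> nat \<times> nat) set \<Rightarrow> (nat \<times> nat \<times> nat \<times> nat \<Rightarrow> complex) \<Rightarrow>
    complex \<times> complex \<Rightarrow> complex \<times> complex \<Rightarrow> complex" where
  "dev K c z w = (\<Sum>m\<in>K. c m * mono_deriv m z w)"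

lemma has_derivative_mono_eval: "(mono_eval m has_derivative mono_deriv m z) (at z)"
proof -
  obtain a b c d where m: "m = (a, b, c, d)" by (cases m) auto
  have "((\<lambda>z. fst z ^ a * cnj (fst z) ^ b * snd z ^ c * cnj (snd z) ^ d) has_derivative mono_deriv m z) (at z)"
    by (rule has_derivative_eq_rhs, (rule derivative_intros has_derivative_cnj)+)
      (auto simp: m mono_deriv_def fun_eq_iff algebra_simps split_beta)
  then show ?thesis by (simp add: m mono_eval_def split_beta')
qed

lemma has_derivative_ev: "(ev K c has_derivative dev K c z) (at z)"
proof -
  have "((\<lambda>z. \<Sum>m\<in>K. c m * mono_eval m z) has_derivative (\<lambda>w. \<Sum>m\<in>K. c m * mono_deriv m z w)) (at z)"
    by (intro has_derivative_sum has_derivative_mult_right has_derivative_mono_eval)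
  then show ?thesis by (simp add: ev_def[abs_def] dev_def[abs_def])
qed

lemma bounded_linear_dev: "bounded_linear (dev K c z)"
  using has_derivative_bounded_linear[OF has_derivative_ev] .

lemma linear_dev: "linear (dev K c z)"
  using bounded_linear.linear[OF bounded_linear_dev] .

lemma power_deriv_scale:
  fixes u x s :: complex
  shows "of_nat a * (s * u) ^ (a - 1) * (s * x) = s ^ a * (of_nat a * u ^ (a - 1) * x)"
  by (cases a) (auto simp: power_mult_distrib)

lemma mono_eval_scale:
  "mono_eval m (of_real \<alpha> * u, of_real \<beta> * v) = of_real (\<alpha> ^ fst (mono_deg m) * \<beta> ^ snd (mono_deg m)) * mono_eval m (u, v)"
  by (auto simp: mono_eval_def mono_deg_def power_mult_distrib power_add split: prod.split)

lemma mono_deriv_scale: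
  "mono_deriv m (of_real \<alpha> * u, of_real \<beta> * v) (of_real \<alpha> * x, of_real \<beta> * y) =
     of_real (\<alpha> ^ fst (mono_deg m) * \<beta> ^ snd (mono_deg m)) * mono_deriv m (u, v) (x, y)"
proof -
  obtain a b c d where m: "m = (a, b, c, d)" by (cases m) auto
  show ?thesis
    unfolding m mono_deriv_def prod.case complex_cnj_mult complex_cnj_complex_of_real power_deriv_scale
    by (simp add: mono_deg_def power_mult_distrib power_add algebra_simps)
qed

text \<open>The real weights scale \<open>u\<close> together with \<open>cnj u\<close>, and
  \<open>v\<close> together with \<open>cnj v\<close>, so only the total degrees
  \<open>mono_deg\<close> enter. This is why the weighted radial field works for mixed
  monomials.\<close>

lemma mono_deriv_euler:
  "mono_deriv m (u, v) (of_nat p1 * u, of_nat p2 * v) =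
     of_nat (p1 * fst (mono_deg m) + p2 * snd (mono_deg m)) * mono_eval m (u, v)"
proof -
  have *: "of_nat n * w ^ (n - 1) * (of_nat p * w) = of_nat (p * n) * w ^ n" for n p and w :: complex
    by (cases n) (simp_all add: algebra_simps)
  obtain a b c d where m: "m = (a, b, c, d)" by (cases m) auto
  show ?thesis
    unfolding m mono_deriv_def prod.case complex_cnj_mult complex_cnj_of_nat *
    by (simp add: mono_deg_def mono_eval_def algebra_simps)
qed

lemma tendsto_mono_eval [tendsto_intros]:
  assumes "(z \<longlongrightarrow> z0) F"
  shows "((\<lambda>k. mono_eval m (z k)) \<longlongrightarrow> mono_eval m z0) F"
  using assms unfolding mono_eval_def split_beta by (intro tendsto_intros)

lemma tendsto_mono_deriv [tendsto_intros]:
  assumes "(z \<longlongrightarrow> z0) F"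
  shows "((\<lambda>k. mono_deriv m (z k) w) \<longlongrightarrow> mono_deriv m z0 w) F"
  using assms unfolding mono_deriv_def split_beta by (intro tendsto_intros)

lemma ev_add: "ev K (\<lambda>m. c m + s *\<^sub>R e m) z = ev K c z + s *\<^sub>R ev K e z"
  by (simp add: ev_def algebra_simps sum.distrib scaleR_sum_right)

lemma dev_add: "dev K (\<lambda>m. c m + s *\<^sub>R e m) z w = dev K c z w + s *\<^sub>R dev K e z w"
  by (simp add: dev_def algebra_simps sum.distrib scaleR_sum_right)

lemma lipschitz_fun_power:
  fixes f :: "'a::metric_space \<Rightarrow> complex"
  shows "compact A \<Longrightarrow> lipschitz_fun A f \<Longrightarrow> lipschitz_fun A (\<lambda>x. f x ^ n)"
  by (induction n) (auto intro: lipschitz_fun_const lipschitz_fun_mult)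

lemma lipschitz_fun_polynomial:
  fixes f :: "complex \<times> complex \<Rightarrow> complex \<times> complex"
  assumes A: "compact A" and w: "lipschitz_fun A w"
  shows "lipschitz_fun A (ev K c)" "lipschitz_fun A (\<lambda>z. dev K c z (w z))"
proof -
  have id: "lipschitz_fun A (\<lambda>x. x)"
    unfolding lipschitz_fun_def by (rule exI, rule lipschitz_on_id)
  note L = lipschitz_fun_sum lipschitz_fun_const lipschitz_fun_add lipschitz_fun_mult[OF A] lipschitz_fun_power[OF A]
    lipschitz_fun_linear[OF bounded_linear_cnj] lipschitz_fun_linear[OF bounded_linear_fst]
    lipschitz_fun_linear[OF bounded_linear_snd] id w
  show "lipschitz_fun A (ev K c)"
    unfolding ev_def[abs_def] mono_eval_def split_beta by (intro L)
  show "lipschitz_fun A (\<lambda>z. dev K c z (w z))"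
    unfolding dev_def[abs_def] mono_deriv_def split_beta by (intro L)
qed

text \<open>Surjectivity on the hyperplane orthogonal to \<open>z\<close> says two things at once:
  \<open>z\<close> is a regular point, and for \<open>z \<noteq> 0\<close> the zero set crosses the
  round sphere through \<open>z\<close> transversely.\<close>

definition transverse_at :: "(nat \<times> nat \<times> nat \<times> nat) set \<Rightarrow> (nat \<times> nat \<times> nat \<times> nat \<Rightarrow> complex) \<Rightarrow> complex \<times> complex \<Rightarrow> bool" where
  "transverse_at K c z \<longleftrightarrow> (ev K c z = 0 \<longrightarrow> (\<forall>y. \<exists>w. z \<bullet> w = 0 \<and> dev K c z w = y))"

lemma isotopic_slices:
  assumes \<epsilon>: "\<epsilon> > 0"
    and trans: "\<And>t z. t \<in> {0..1} \<Longrightarrow> norm z = \<epsilon> \<Longrightarrow> transverse_at K (\<lambda>m. c m + t *\<^sub>R e m) z"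
  shows "isotopic {x \<in> S3. ev K c (\<epsilon> *\<^sub>R x) = 0} {x \<in> S3. ev K (\<lambda>m. c m + e m) (\<epsilon> *\<^sub>R x) = 0}"
proof -
  \<comment> \<open>Absorbing the powers of the radius into the coefficients turns the sphere of
    radius \<open>\<epsilon>\<close> into the unit sphere.\<close>
  define r where "r = (\<lambda>(c::_ \<Rightarrow> complex) m. c m * of_real (\<epsilon> ^ fst (mono_deg m) * \<epsilon> ^ snd (mono_deg m)))"
  have ev: "ev K (r c) x = ev K c (\<epsilon> *\<^sub>R x)" for c x
    using mono_eval_scale[of _ \<epsilon> "fst x" \<epsilon> "snd x"]
    by (cases x) (auto simp: ev_def r_def scaleR_conv_of_real mult.assoc)
  have dev: "dev K (r c) x w = dev K c (\<epsilon> *\<^sub>R x) (\<epsilon> *\<^sub>R w)" for c x w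
    using mono_deriv_scale[of _ \<epsilon> "fst x" \<epsilon> "snd x" "fst w" "snd w"]
    by (cases x, cases w) (auto simp: dev_def r_def scaleR_conv_of_real mult.assoc)
  have id: "lipschitz_fun S3 (\<lambda>x. x)"
    unfolding lipschitz_fun_def by (rule exI, rule lipschitz_on_id)
  have "isotopic {x \<in> S3. ev K (r c) x = 0} {x \<in> S3. ev K (r c) x + ev K (r e) x = 0}"
  proof (rule isotopic_of_transverse_family[OF has_derivative_ev has_derivative_ev])
    fix t :: real and x :: "complex \<times> complex" and y :: complex
    assume t: "t \<in> {0..1}" and x: "x \<in> S3" and 0: "ev K (r c) x + t *\<^sub>R ev K (r e) x = 0"
    have "transverse_at K (\<lambda>m. c m + t *\<^sub>R e m) (\<epsilon> *\<^sub>R x)"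
      using trans[OF t] x \<epsilon> by simp
    moreover have "ev K (\<lambda>m. c m + t *\<^sub>R e m) (\<epsilon> *\<^sub>R x) = 0"
      using 0 by (simp add: ev_add ev)
    ultimately obtain w where w: "(\<epsilon> *\<^sub>R x) \<bullet> w = 0" "dev K (\<lambda>m. c m + t *\<^sub>R e m) (\<epsilon> *\<^sub>R x) w = y"
      unfolding transverse_at_def by blast
    then show "\<exists>w. x \<bullet> w = 0 \<and> dev K (r c) x w + t *\<^sub>R dev K (r e) x w = y"
      using \<epsilon> by (intro exI[of _ "w /\<^sub>R \<epsilon>"]) (auto simp: dev dev_add)
  qed (auto intro!: lipschitz_fun_polynomial id lipschitz_fun_const)
  moreover have "ev K (\<lambda>m. c m + e m) z = ev K c z + ev K e z" for z
    using ev_add[of K c 1 e z] by simp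
  ultimately show ?thesis by (simp add: ev)
qed

section \<open>Transversality to small spheres\<close>

text \<open>A right inverse \<open>R\<close> of \<open>A\<close> reduces the claim to invertibility
  of \<open>B k \<circ> R\<close>, which tends to the identity; in finite dimension convergence on
  the basis already controls the operator norm.\<close>

lemma eventually_surj:
  fixes A :: "'a::euclidean_space \<Rightarrow> 'b::euclidean_space"
  assumes A: "linear A" "surj A" and B: "\<And>k. linear (B k)" and lim: "\<And>w. ((\<lambda>k. B k w) \<longlongrightarrow> A w) F"
  shows "\<forall>\<^sub>F k in F. surj (B k)"
proof -
  obtain R where R: "linear R" "A \<circ> R = id" using linear_surjective_right_inverse[OF A] by blast
  have AR: "A (R b) = b" for b using R(2) by (metis comp_apply id_apply)
  have "((\<lambda>k. \<Sum>b\<in>Basis. norm (B k (R b) - b)) \<longlongrightarrow> (\<Sum>b\<in>Basis. norm (A (R b) - b))) F"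
    by (intro tendsto_intros lim)
  then have "\<forall>\<^sub>F k in F. (\<Sum>b\<in>Basis. norm (B k (R b) - b)) < 1"
    by (rule order_tendstoD) (simp add: AR)
  then show ?thesis
  proof eventually_elim
    case (elim k)
    have lin: "linear (\<lambda>y. B k (R y))" using linear_compose[OF R(1) B] by (simp add: o_def)
    have close: "norm (B k (R y) - y) \<le> norm y * (\<Sum>b\<in>Basis. norm (B k (R b) - b))" for y
    proof -
      have "B k (R y) - y = B k (R (\<Sum>b\<in>Basis. (y \<bullet> b) *\<^sub>R b)) - (\<Sum>b\<in>Basis. (y \<bullet> b) *\<^sub>R b)"
        by (simp add: euclidean_representation)
      also have "\<dots> = (\<Sum>b\<in>Basis. (y \<bullet> b) *\<^sub>R (B k (R b) - b))"
        by (simp add: linear_sum[OF lin] linear_scale[OF lin] scaleR_diff_right sum_subtractf)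
      also have "norm \<dots> \<le> (\<Sum>b\<in>Basis. norm y * norm (B k (R b) - b))"
        by (rule sum_norm_le) (auto intro!: mult_right_mono Basis_le_norm)
      finally show ?thesis by (simp add: sum_distrib_left)
    qed
    have "inj (\<lambda>y. B k (R y))"
      unfolding linear_injective_0[OF lin]
    proof (intro allI impI)
      fix y assume "B k (R y) = 0"
      then have "norm y \<le> norm y * (\<Sum>b\<in>Basis. norm (B k (R b) - b))" using close[of y] by simp
      then show "y = 0" using elim by (metis mult_less_cancel_left2 norm_le_zero_iff not_le)
    qed
    then have "surj (\<lambda>y. B k (R y))" by (intro linear_injective_imp_surjective[OF lin _ refl])
    then show ?case by (metis surjI surj_def)
  qed
qed

definition part :: "(nat \<times> nat) set \<Rightarrow> (nat \<times> nat \<times> nat \<times> nat \<Rightarrow> complex) \<Rightarrow> nat \<times> nat \<times> nat \<times> nat \<Rightarrow> complex" where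
  "part S c = (\<lambda>m. if mono_deg m \<in> S then c m else 0)"

definition wt :: "nat \<times> nat \<Rightarrow> nat \<times> nat \<Rightarrow> nat" where
  "wt p t = fst p * fst t + snd p * snd t"

lemma dev_part_euler:
  "dev K (part {t. wt p t = d} c) z (of_nat (fst p) * fst z, of_nat (snd p) * snd z) =
     of_nat d * ev K (part {t. wt p t = d} c) z"
proof -
  have "part {t. wt p t = d} c m * mono_deriv m z (of_nat (fst p) * fst z, of_nat (snd p) * snd z) =
     of_nat d * (part {t. wt p t = d} c m * mono_eval m z)" for m
    using mono_deriv_euler[of m "fst z" "snd z" "fst p" "snd p"]
    by (auto simp: part_def wt_def algebra_simps)
  then show ?thesis by (simp only: dev_def ev_def sum_distrib_left)
qed

text \<open>The points \<open>z k\<close> are written in rescaled coordinates \<open>a k\<close>, \<open>b k\<close> in which the functions converge.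
  In these coordinates the normal vector of the round sphere through \<open>z k\<close> converges, up to a positive
  factor, to \<open>(s a0, (1 - s) b0)\<close>.\<close>

lemma chart_limit:
  fixes \<alpha> \<beta> \<sigma> :: "nat \<Rightarrow> real" and a b :: "nat \<Rightarrow> complex" and c :: "nat \<Rightarrow> nat \<times> nat \<times> nat \<times> nat \<Rightarrow> complex"
  assumes K: "finite K"
    and coef: "\<And>m. m \<in> K \<Longrightarrow> (\<lambda>k. c k m * of_real (\<alpha> k ^ fst (mono_deg m) * \<beta> k ^ snd (mono_deg m) / \<sigma> k)) \<longlonglongrightarrow> e m"
    and pos: "\<And>k. \<alpha> k > 0" "\<And>k. \<beta> k > 0" "\<And>k. \<sigma> k > 0"
    and bound: "\<And>k. norm (a k) \<le> R" "\<And>k. norm (b k) \<le> R"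
    and z: "\<And>k. z k = (of_real (\<alpha> k) * a k, of_real (\<beta> k) * b k)"
    and bad: "\<And>k. \<not> transverse_at K (c k) (z k)"
  obtains r a0 b0 s where "strict_mono r" "(a \<circ> r) \<longlonglongrightarrow> a0" "(b \<circ> r) \<longlonglongrightarrow> b0"
    "(\<lambda>k. (\<alpha> (r k))\<^sup>2 / ((\<alpha> (r k))\<^sup>2 + (\<beta> (r k))\<^sup>2)) \<longlonglongrightarrow> s" "0 \<le> s" "s \<le> 1"
    "ev K e (a0, b0) = 0"
    "\<And>E. surj (dev K e (a0, b0)) \<Longrightarrow> dev K e (a0, b0) E = 0 \<Longrightarrow> E \<bullet> (s *\<^sub>R a0, (1 - s) *\<^sub>R b0) = 0"
proof -
  \<comment> \<open>In the rescaled coordinates the normal of the sphere at \<open>z k\<close>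
    becomes \<open>(\<alpha>\<^sup>2 a, \<beta>\<^sup>2 b)\<close>. Division by
    \<open>\<alpha>\<^sup>2 + \<beta>\<^sup>2\<close> keeps it bounded, so that a subsequence
    converges.\<close>
  define s' where "s' = (\<lambda>k. (\<alpha> k)\<^sup>2 / ((\<alpha> k)\<^sup>2 + (\<beta> k)\<^sup>2))"
  have s': "0 \<le> s' k" "s' k \<le> 1" for k
  proof -
    have "(\<alpha> k)\<^sup>2 + (\<beta> k)\<^sup>2 > 0" using pos[of k] by (intro add_pos_pos zero_less_power)
    then show "0 \<le> s' k" "s' k \<le> 1" by (simp_all add: s'_def)
  qed
  have "compact (cball (0::complex) R \<times> cball (0::complex) R \<times> {0..1::real})"
    by (intro compact_Times) auto
  moreover have "\<forall>k. (a k, b k, s' k) \<in> cball 0 R \<times> cball 0 R \<times> {0..1}"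
    using bound s' by auto
  ultimately obtain l r where l: "l \<in> cball (0::complex) R \<times> cball (0::complex) R \<times> {0..1}" "strict_mono r"
      "((\<lambda>k. (a k, b k, s' k)) \<circ> r) \<longlonglongrightarrow> l"
    unfolding compact_def by meson
  obtain a0 b0 s where abs: "l = (a0, b0, s)" by (cases l) auto
  have la: "(\<lambda>k. a (r k)) \<longlonglongrightarrow> a0" using tendsto_fst[OF l(3)] by (simp add: abs o_def)
  have lb: "(\<lambda>k. b (r k)) \<longlonglongrightarrow> b0" using tendsto_fst[OF tendsto_snd[OF l(3)]] by (simp add: abs o_def)
  have ls: "(\<lambda>k. s' (r k)) \<longlonglongrightarrow> s" using tendsto_snd[OF tendsto_snd[OF l(3)]] by (simp add: abs o_def)
  define c' where "c' = (\<lambda>k m. c k m * of_real (\<alpha> k ^ fst (mono_deg m) * \<beta> k ^ snd (mono_deg m) / \<sigma> k))"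
  have lc: "(\<lambda>k. c' (r k) m) \<longlonglongrightarrow> e m" if "m \<in> K" for m
    using LIMSEQ_subseq_LIMSEQ[OF coef[OF that] l(2)] by (simp add: c'_def o_def)
  have lz: "(\<lambda>k. (a (r k), b (r k))) \<longlonglongrightarrow> (a0, b0)" by (intro tendsto_intros la lb)
  have ev': "ev K (c' k) (a k, b k) = ev K (c k) (z k) / of_real (\<sigma> k)" for k
    unfolding ev_def z mono_eval_scale c'_def sum_divide_distrib by (simp add: field_simps)
  have dev': "dev K (c' k) (a k, b k) (x, y) = dev K (c k) (z k) (of_real (\<alpha> k) * x, of_real (\<beta> k) * y) / of_real (\<sigma> k)" for k x y
    unfolding dev_def z mono_deriv_scale c'_def sum_divide_distrib by (simp add: field_simps)
  have zero: "ev K (c' k) (a k, b k) = 0" for k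
    using bad[of k] by (simp add: ev' transverse_at_def)
  have ldev: "(\<lambda>k. dev K (c' (r k)) (a (r k), b (r k)) w) \<longlonglongrightarrow> dev K e (a0, b0) w" for w
    unfolding dev_def by (intro tendsto_intros lc lz)
  have "(\<lambda>k. ev K (c' (r k)) (a (r k), b (r k))) \<longlonglongrightarrow> ev K e (a0, b0)"
    unfolding ev_def by (intro tendsto_intros lc lz)
  then have ev0: "ev K e (a0, b0) = 0" by (simp add: zero LIMSEQ_const_iff)
  have "E \<bullet> (s *\<^sub>R a0, (1 - s) *\<^sub>R b0) = 0" if surj: "surj (dev K e (a0, b0))" and E: "dev K e (a0, b0) E = 0" for E
  proof (rule ccontr)
    define n where "n = (s *\<^sub>R a0, (1 - s) *\<^sub>R b0)"
    define N where "N = (\<lambda>k. (s' k *\<^sub>R a k, (1 - s' k) *\<^sub>R b k))"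
    assume "E \<bullet> (s *\<^sub>R a0, (1 - s) *\<^sub>R b0) \<noteq> 0"
    \<comment> \<open>If \<open>E\<close> is not orthogonal to the limit normal \<open>n\<close>,
      the derivative and the normal component together map onto
      \<open>complex \<times> real\<close>, and so they do eventually along the sequence. A preimage
      of \<open>(y / \<sigma>, 0)\<close> is then the tangent vector whose absence made the point
      bad.\<close>
    then have En: "E \<bullet> n \<noteq> 0" by (simp add: n_def)
    have "\<forall>\<^sub>F k in sequentially. surj (\<lambda>w. (dev K (c' (r k)) (a (r k), b (r k)) w, w \<bullet> N (r k)))"
    proof (rule eventually_surj)
      show "linear (\<lambda>w. (dev K e (a0, b0) w, w \<bullet> n))"
        "linear (\<lambda>w. (dev K (c' (r k)) (a (r k), b (r k)) w, w \<bullet> N (r k)))" for k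
        by (auto simp: linear_iff linear_add[OF linear_dev] linear_scale[OF linear_dev] inner_add_left)
      show "surj (\<lambda>w. (dev K e (a0, b0) w, w \<bullet> n))"
      proof (rule surjI)
        fix y :: "complex \<times> real"
        define w0 where "w0 = inv (dev K e (a0, b0)) (fst y)"
        have w0: "dev K e (a0, b0) w0 = fst y" unfolding w0_def by (rule surj_f_inv_f[OF surj])
        define w where "w = w0 + ((snd y - w0 \<bullet> n) / (E \<bullet> n)) *\<^sub>R E"
        show "(dev K e (a0, b0) (inv (dev K e (a0, b0)) (fst y) + ((snd y - inv (dev K e (a0, b0)) (fst y) \<bullet> n) / (E \<bullet> n)) *\<^sub>R E),
           (inv (dev K e (a0, b0)) (fst y) + ((snd y - inv (dev K e (a0, b0)) (fst y) \<bullet> n) / (E \<bullet> n)) *\<^sub>R E) \<bullet> n) = y"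
          unfolding w0_def[symmetric]
          using En by (cases y) (simp add: linear_add[OF linear_dev] linear_scale[OF linear_dev] w0 E inner_add_left)
      qed
      show "(\<lambda>k. (dev K (c' (r k)) (a (r k), b (r k)) w, w \<bullet> N (r k))) \<longlonglongrightarrow> (dev K e (a0, b0) w, w \<bullet> n)" for w
        unfolding N_def n_def by (intro tendsto_intros ldev ls la lb)
    qed
    then obtain k where k: "surj (\<lambda>w. (dev K (c' (r k)) (a (r k), b (r k)) w, w \<bullet> N (r k)))"
      using eventually_happens' sequentially_bot by blast
    define j where "j = r k"
    have "\<exists>w. z j \<bullet> w = 0 \<and> dev K (c j) (z j) w = y" for y
    proof -
      obtain w where "(dev K (c' j) (a j, b j) w, w \<bullet> N j) = (y / of_real (\<sigma> j), 0)"
        using k unfolding surj_def j_def by metis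
      then have w: "dev K (c' j) (a j, b j) w = y / of_real (\<sigma> j)" "w \<bullet> N j = 0" by auto
      obtain x1 x2 where x: "w = (x1, x2)" by (cases w)
      let ?w = "(of_real (\<alpha> j) * x1, of_real (\<beta> j) * x2)"
      have "dev K (c j) (z j) ?w = y"
        using w(1) pos(3)[of j] unfolding x dev' by simp
      moreover have "z j \<bullet> ?w = ((\<alpha> j)\<^sup>2 + (\<beta> j)\<^sup>2) * (w \<bullet> N j)"
      proof -
        have ne: "(\<alpha> j)\<^sup>2 + (\<beta> j)\<^sup>2 > 0" using pos[of j] by (simp add: add_pos_pos)
        have s1: "((\<alpha> j)\<^sup>2 + (\<beta> j)\<^sup>2) * s' j = (\<alpha> j)\<^sup>2"
          using ne by (simp add: s'_def)
        have s2: "((\<alpha> j)\<^sup>2 + (\<beta> j)\<^sup>2) * (1 - s' j) = (\<beta> j)\<^sup>2"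
          unfolding right_diff_distrib s1 by simp
        note s1 s2
        moreover have "((\<alpha> j)\<^sup>2 + (\<beta> j)\<^sup>2) * (w \<bullet> N j) =
            (((\<alpha> j)\<^sup>2 + (\<beta> j)\<^sup>2) * s' j) * (x1 \<bullet> a j) + (((\<alpha> j)\<^sup>2 + (\<beta> j)\<^sup>2) * (1 - s' j)) * (x2 \<bullet> b j)"
          by (simp add: x N_def algebra_simps)
        ultimately show ?thesis
          by (simp only: z inner_Pair) (simp add: inner_complex_def power2_eq_square algebra_simps)
      qed
      ultimately show ?thesis using w(2) by (intro exI[of _ ?w]) simp
    qed
    then show False using bad[of j] by (simp add: transverse_at_def)
  qed
  then show thesis
    using that[of r a0 b0 s] l la lb ls ev0 by (auto simp: abs o_def s'_def)
qed

section \<open>Sequences of points where transversality fails\<close>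

definition regular_on :: "(nat \<times> nat \<times> nat \<times> nat) set \<Rightarrow> (nat \<times> nat \<times> nat \<times> nat \<Rightarrow> complex) \<Rightarrow> (complex \<times> complex) set \<Rightarrow> bool" where
  "regular_on K c A \<longleftrightarrow> (\<forall>z\<in>A. ev K c z = 0 \<longrightarrow> surj (dev K c z))"

text \<open>Where the part on the axis vanishes, regularity has to come from the derivative with respect to
  \<open>u\<close>, and the monomials that contribute to it lie in the column 1; hence the point \<open>(1, n - m)\<close>.\<close>

definition left_end_regular :: "(nat \<times> nat) set \<Rightarrow> (nat \<times> nat \<times> nat \<times> nat) set \<Rightarrow> (nat \<times> nat \<times> nat \<times> nat \<Rightarrow> complex) \<Rightarrow> bool" where
  "left_end_regular T K c \<longleftrightarrow> (\<forall>n. (0, n) \<in> T \<longrightarrow> (\<forall>n'. (0, n') \<in> T \<longrightarrow> n \<le> n') \<longrightarrow>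
     (\<exists>z\<in>torus. ev K (part {(0, n)} c) z = 0) \<longrightarrow>
     (\<exists>m\<ge>1. m \<le> n \<and> (1, n - m) \<in> T \<and> (\<forall>t\<in>T. n \<le> wt (m, 1) t) \<and>
        regular_on K (part {t. wt (m, 1) t = n} c) {z. snd z \<noteq> 0}))"

lemma ev_part_axis: "ev K (part {(0, n)} c) (u, v) = ev K (part {(0, n)} c) (u', v)"
  unfolding ev_def by (rule sum.cong) (auto simp: part_def mono_eval_def mono_deg_def split: prod.split)

lemma norm_limit_1:
  fixes b :: "nat \<Rightarrow> complex"
  assumes "(b \<circ> r) \<longlonglongrightarrow> b0" "\<And>k. norm (b k) = 1"
  shows "norm b0 = 1"
  using tendsto_norm[OF assms(1)] assms(2) by (simp add: o_def LIMSEQ_const_iff)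

text \<open>Two blow-ups are made. Scaling by \<open>norm (v k) ^ n\<close> leaves only the axis
  vertex, so its polynomial has a zero and \<open>left_end_regular\<close> supplies a weight
  \<open>(m, 1)\<close>. In the chart of that weight the limit lies on the axis, where regularity is
  available and Euler's field is not orthogonal to the normal.\<close>

lemma no_bad_sequence_left_end:
  fixes u v a :: "nat \<Rightarrow> complex" and c :: "nat \<Rightarrow> nat \<times> nat \<times> nat \<times> nat \<Rightarrow> complex" and \<alpha> :: "nat \<Rightarrow> real"
  assumes K: "finite K" "mono_deg ` K \<subseteq> T"
    and coef: "\<And>m. m \<in> K \<Longrightarrow> (\<lambda>k. c k m) \<longlonglongrightarrow> e m"
    and reg: "left_end_regular T K e"
    and n: "(0, n) \<in> T" "\<And>n'. (0, n') \<in> T \<Longrightarrow> n \<le> n'"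
    and v: "\<And>k. v k \<noteq> 0" "\<And>k. norm (v k) < 1" "v \<longlonglongrightarrow> 0"
    and u: "\<And>k. \<alpha> k > 0" "\<And>k. u k = of_real (\<alpha> k) * a k" "\<And>k. norm (a k) \<le> 1"
    and ratio: "\<And>t. t \<in> T \<Longrightarrow> t \<noteq> (0, n) \<Longrightarrow> (\<lambda>k. \<alpha> k ^ fst t * norm (v k) ^ snd t / norm (v k) ^ n) \<longlonglongrightarrow> 0"
    and bad: "\<And>k. \<not> transverse_at K (c k) (u k, v k)"
  shows False
proof -
  define b where "b = (\<lambda>k. v k / of_real (norm (v k)))"
  have b: "norm (b k) = 1" "v k = of_real (norm (v k)) * b k" for k
    using v(1)[of k] by (auto simp: b_def norm_divide)
  have coef1: "(\<lambda>k. c k m * of_real (\<alpha> k ^ fst (mono_deg m) * norm (v k) ^ snd (mono_deg m) / norm (v k) ^ n)) \<longlonglongrightarrow> part {(0, n)} e m"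
    if m: "m \<in> K" for m
  proof (cases "mono_deg m = (0, n)")
    case True
    then show ?thesis using coef[OF m] v(1) by (simp add: part_def)
  next
    case False
    have "(\<lambda>k. c k m * of_real (\<alpha> k ^ fst (mono_deg m) * norm (v k) ^ snd (mono_deg m) / norm (v k) ^ n)) \<longlonglongrightarrow> e m * of_real 0"
      by (intro tendsto_mult coef[OF m] tendsto_of_real ratio[OF _ False]) (use K m in auto)
    then show ?thesis using False by (simp add: part_def)
  qed
  have z1: "(u k, v k) = (of_real (\<alpha> k) * a k, of_real (norm (v k)) * b k)" for k
    using u(2) b(2) by metis
  obtain r1 a1 b1 s1 where 1: "strict_mono r1" "(b \<circ> r1) \<longlonglongrightarrow> b1" "ev K (part {(0, n)} e) (a1, b1) = 0"
    by (rule chart_limit[where c = c and a = a and b = b and \<alpha> = \<alpha> and \<beta> = "\<lambda>k. norm (v k)" and \<sigma> = "\<lambda>k. norm (v k) ^ n"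
          and R = 1 and z = "\<lambda>k. (u k, v k)", OF K(1) coef1]) (use u v(1) z1 b(1) bad in auto)
  have "norm b1 = 1" using norm_limit_1[OF 1(2) b(1)] .
  then have "(1, b1) \<in> torus" "ev K (part {(0, n)} e) (1, b1) = 0"
    using 1(3) ev_part_axis[of K n e a1 b1 1] by (auto simp: torus_def)
  then obtain m where m: "m \<ge> 1" "m \<le> n" "(1, n - m) \<in> T" "\<And>t. t \<in> T \<Longrightarrow> n \<le> wt (m, 1) t"
      "regular_on K (part {t. wt (m, 1) t = n} e) {z. snd z \<noteq> 0}"
    using reg n unfolding left_end_regular_def by blast
  define \<gamma> where "\<gamma> = (\<lambda>k. norm (v k) ^ m)"
  define a' where "a' = (\<lambda>k. u k / of_real (\<gamma> k))"
  have \<gamma>: "\<gamma> k > 0" for k using v(1) by (simp add: \<gamma>_def)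
  \<comment> \<open>The ratio hypothesis for the exponent \<open>(1, n - m)\<close> says that
    \<open>\<alpha> k\<close>, and hence \<open>u k\<close>, is negligible against
    \<open>norm (v k) ^ m\<close>; this puts the limit on the axis.\<close>
  have a'_le: "norm (a' k) \<le> \<alpha> k ^ 1 * norm (v k) ^ (n - m) / norm (v k) ^ n" for k
  proof -
    have "norm (a' k) = \<alpha> k * norm (a k) / \<gamma> k"
      using u(1)[of k] \<gamma>[of k] by (simp add: a'_def u(2) norm_mult norm_divide)
    also have "\<dots> \<le> \<alpha> k * 1 / \<gamma> k"
      using u(1)[of k] u(3)[of k] \<gamma>[of k] by (intro divide_right_mono mult_left_mono) auto
    also have "\<dots> = \<alpha> k ^ 1 * norm (v k) ^ (n - m) / norm (v k) ^ n"
      using v(1)[of k] m(2) by (simp add: \<gamma>_def power_diff)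
    finally show ?thesis .
  qed
  have "(\<lambda>k. \<alpha> k ^ 1 * norm (v k) ^ (n - m) / norm (v k) ^ n) \<longlonglongrightarrow> 0"
    using ratio[OF m(3)] by simp
  then have la': "a' \<longlonglongrightarrow> 0"
    by (rule Lim_null_comparison[rotated]) (use a'_le in auto)
  then obtain R where R: "\<And>k. norm (a' k) \<le> R"
    using convergent_imp_bounded[OF la'] by (auto simp: bounded_iff)
  have coef2: "(\<lambda>k. c k i * of_real (\<gamma> k ^ fst (mono_deg i) * norm (v k) ^ snd (mono_deg i) / norm (v k) ^ n))
      \<longlonglongrightarrow> part {t. wt (m, 1) t = n} e i" if i: "i \<in> K" for i
  proof -
    have ge: "wt (m, 1) (mono_deg i) \<ge> n" using K i by (intro m(4)) auto
    have "\<gamma> k ^ fst (mono_deg i) * norm (v k) ^ snd (mono_deg i) / norm (v k) ^ n = norm (v k) ^ (wt (m, 1) (mono_deg i) - n)" for k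
      using v(1)[of k] ge by (simp add: \<gamma>_def power_diff wt_def power_add power_mult)
    moreover have "(\<lambda>k. norm (v k) ^ (wt (m, 1) (mono_deg i) - n)) \<longlonglongrightarrow> norm (0::complex) ^ (wt (m, 1) (mono_deg i) - n)"
      by (intro tendsto_intros v(3))
    ultimately have "(\<lambda>k. c k i * of_real (\<gamma> k ^ fst (mono_deg i) * norm (v k) ^ snd (mono_deg i) / norm (v k) ^ n))
        \<longlonglongrightarrow> e i * of_real (norm (0::complex) ^ (wt (m, 1) (mono_deg i) - n))"
      by (simp only:) (intro tendsto_mult coef[OF i] tendsto_of_real)
    moreover have "e i * of_real (norm (0::complex) ^ (wt (m, 1) (mono_deg i) - n)) = part {t. wt (m, 1) t = n} e i"
      using ge by (auto simp: part_def)
    ultimately show ?thesis by simp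
  qed
  have z2: "(u k, v k) = (of_real (\<gamma> k) * a' k, of_real (norm (v k)) * b k)" for k
    using b(2)[of k] \<gamma>[of k] by (simp add: a'_def)
  have pos2: "norm (v k) > 0" "norm (v k) ^ n > 0" "norm (a' k) \<le> max R 1" "norm (b k) \<le> max R 1" for k
    using v(1)[of k] R[of k] b(1)[of k] by auto
  obtain r a0 b0 s where 2: "strict_mono r" "(a' \<circ> r) \<longlonglongrightarrow> a0" "(b \<circ> r) \<longlonglongrightarrow> b0"
    "(\<lambda>k. (\<gamma> (r k))\<^sup>2 / ((\<gamma> (r k))\<^sup>2 + (norm (v (r k)))\<^sup>2)) \<longlonglongrightarrow> s" "0 \<le> s" "s \<le> 1"
    "ev K (part {t. wt (m, 1) t = n} e) (a0, b0) = 0"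
    "\<And>E. surj (dev K (part {t. wt (m, 1) t = n} e) (a0, b0)) \<Longrightarrow> dev K (part {t. wt (m, 1) t = n} e) (a0, b0) E = 0 \<Longrightarrow>
       E \<bullet> (s *\<^sub>R a0, (1 - s) *\<^sub>R b0) = 0"
    by (rule chart_limit[where c = c and a = a' and b = b and \<alpha> = \<gamma> and \<beta> = "\<lambda>k. norm (v k)" and \<sigma> = "\<lambda>k. norm (v k) ^ n"
          and R = "max R 1" and z = "\<lambda>k. (u k, v k)", OF K(1) coef2 \<gamma> pos2 z2 bad])
      (assumption, rule that)
  have "(a' \<circ> r) \<longlonglongrightarrow> 0" using LIMSEQ_subseq_LIMSEQ[OF la' 2(1)] .
  then have a0: "a0 = 0" using 2(2) LIMSEQ_unique by blast
  have b0: "norm b0 = 1" using norm_limit_1[OF 2(3) b(1)] .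
  have surj: "surj (dev K (part {t. wt (m, 1) t = n} e) (a0, b0))"
  proof -
    have "(a0, b0) \<in> {z. snd z \<noteq> 0}" using b0 by auto
    then show ?thesis using m(5) 2(7) unfolding regular_on_def by blast
  qed
  \<comment> \<open>Since \<open>m \<ge> 1\<close>, the first coordinate is scaled at least as
    strongly as the second, so the limit normal keeps at least half of its \<open>b0\<close> part.
    As \<open>a0 = 0\<close>, Euler's field has inner product \<open>1 - s > 0\<close> with
    it.\<close>
  have "s \<le> 1/2"
  proof (rule LIMSEQ_le_const2[OF 2(4)], intro exI allI impI)
    fix k
    have "\<gamma> (r k) \<le> norm (v (r k))"
      unfolding \<gamma>_def using power_decreasing[of 1 m "norm (v (r k))"] m(1) v(2)[of "r k"] by simp
    then have "(\<gamma> (r k))\<^sup>2 \<le> (norm (v (r k)))\<^sup>2" using \<gamma>[of "r k"] by (intro power_mono) auto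
    moreover have "(norm (v (r k)))\<^sup>2 > 0" using v(1) by simp
    ultimately show "(\<gamma> (r k))\<^sup>2 / ((\<gamma> (r k))\<^sup>2 + (norm (v (r k)))\<^sup>2) \<le> 1/2"
      by (simp add: divide_simps add_nonneg_pos)
  qed
  moreover have "(of_nat m * a0, b0) \<bullet> (s *\<^sub>R a0, (1 - s) *\<^sub>R b0) = 0"
    by (rule 2(8)[OF surj]) (use dev_part_euler[of K "(m, 1)" n e "(a0, b0)"] 2(7) in simp)
  ultimately show False using b0 by (simp add: a0 dot_square_norm)
qed

text \<open>In logarithmic coordinates, comparability of the monomials \<open>s\<close> and
  \<open>q\<close> confines \<open>(L1 k, L2 k)\<close> to a strip of bounded width around a ray,
  whose direction is the weight orthogonal to \<open>q - s\<close>. All monomials off the edge of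
  this weight then become negligible.\<close>

lemma no_bad_sequence_edge:
  fixes u v :: "nat \<Rightarrow> complex" and c :: "nat \<Rightarrow> nat \<times> nat \<times> nat \<times> nat \<Rightarrow> complex"
  assumes K: "finite K" "mono_deg ` K \<subseteq> T"
    and coef: "\<And>m. m \<in> K \<Longrightarrow> (\<lambda>k. c k m) \<longlonglongrightarrow> e m"
    and reg: "\<And>p d. fst p > 0 \<Longrightarrow> snd p > 0 \<Longrightarrow> (\<And>t. t \<in> T \<Longrightarrow> d \<le> wt p t) \<Longrightarrow> wt p s = d \<Longrightarrow> wt p q = d \<Longrightarrow>
       regular_on K (part {t. wt p t = d} e) torus"
    and sq: "s \<in> T" "q \<in> T" "s \<noteq> q"
    and uv: "\<And>k. u k \<noteq> 0" "\<And>k. v k \<noteq> 0" "u \<longlonglongrightarrow> 0" "v \<longlonglongrightarrow> 0"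
    and max: "\<And>k t. t \<in> T \<Longrightarrow> norm (u k) ^ fst t * norm (v k) ^ snd t \<le> norm (u k) ^ fst s * norm (v k) ^ snd s"
    and \<eta>: "\<eta> > 0" "\<And>k. \<eta> * (norm (u k) ^ fst s * norm (v k) ^ snd s) \<le> norm (u k) ^ fst q * norm (v k) ^ snd q"
    and bad: "\<And>k. \<not> transverse_at K (c k) (u k, v k)"
  shows False
proof -
  define L1 where "L1 = (\<lambda>k. - ln (norm (u k)))"
  define L2 where "L2 = (\<lambda>k. - ln (norm (v k)))"
  have top: "filterlim L1 at_top sequentially" "filterlim L2 at_top sequentially"
  proof -
    have "filterlim (\<lambda>k. - ln (norm (w k))) at_top sequentially" if "\<And>k. w k \<noteq> 0" "w \<longlonglongrightarrow> 0" for w :: "nat \<Rightarrow> complex"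
    proof -
      have "filterlim (\<lambda>k. norm (w k)) (at_right 0) sequentially"
        using tendsto_norm_zero[OF that(2)] that(1) by (auto simp: filterlim_at)
      then have "filterlim (\<lambda>k. ln (norm (w k))) at_bot sequentially"
        by (rule filterlim_compose[OF ln_at_0])
      then show ?thesis by (simp add: filterlim_uminus_at_top)
    qed
    then show "filterlim L1 at_top sequentially" "filterlim L2 at_top sequentially"
      using uv by (auto simp: L1_def L2_def)
  qed
  have large: "\<exists>k. L1 k > B \<and> L2 k > B" for B
    using eventually_conj[OF filterlim_at_top_dense[THEN iffD1, OF top(1), rule_format, of B]
        filterlim_at_top_dense[THEN iffD1, OF top(2), rule_format, of B]]
    by (rule eventually_happens'[OF sequentially_bot])
  have log: "ln (norm (u k) ^ i * norm (v k) ^ j) = - (real i * L1 k + real j * L2 k)" for i j k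
    using uv(1)[of k] uv(2)[of k] by (simp add: ln_mult ln_realpow L1_def L2_def)
  have low: "0 \<le> (real (fst t) - real (fst s)) * L1 k + (real (snd t) - real (snd s)) * L2 k" if "t \<in> T" for t k
  proof -
    have "ln (norm (u k) ^ fst t * norm (v k) ^ snd t) \<le> ln (norm (u k) ^ fst s * norm (v k) ^ snd s)"
      by (rule ln_mono) (use max[OF that, of k] uv(1,2)[of k] in auto)
    then show ?thesis unfolding log by (simp add: algebra_simps)
  qed
  define H where "H = \<bar>ln \<eta>\<bar>"
  have high: "(real (fst q) - real (fst s)) * L1 k + (real (snd q) - real (snd s)) * L2 k \<le> H" for k
  proof -
    have "ln (\<eta> * (norm (u k) ^ fst s * norm (v k) ^ snd s)) \<le> ln (norm (u k) ^ fst q * norm (v k) ^ snd q)"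
      by (rule ln_mono) (use \<eta>(2)[of k] \<eta>(1) uv(1,2)[of k] in auto)
    moreover have "ln (\<eta> * (norm (u k) ^ fst s * norm (v k) ^ snd s)) = ln \<eta> + ln (norm (u k) ^ fst s * norm (v k) ^ snd s)"
      using \<eta>(1) uv(1,2)[of k] by (intro ln_mult_pos) auto
    ultimately show ?thesis unfolding log H_def by (simp add: algebra_simps)
  qed
  have H0: "H \<ge> 0" by (simp add: H_def)
  \<comment> \<open>The weight is read off from \<open>q - s\<close> by exchanging the coordinate
    differences. If one exponent dominated the other in both coordinates, the two monomials could
    not stay comparable while \<open>L1\<close> and \<open>L2\<close> grow.\<close>
  have "\<exists>p1 p2. p1 > 0 \<and> p2 > 0 \<and> wt (p1, p2) s = wt (p1, p2) q \<and> (\<forall>k. \<bar>real p2 * L1 k - real p1 * L2 k\<bar> \<le> H)"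
  proof -
    obtain k where k: "L1 k > H" "L2 k > H" using large by blast
    consider "fst s \<le> fst q" "snd s \<le> snd q" | "fst q \<le> fst s" "snd q \<le> snd s" |
      "fst s < fst q" "snd q < snd s" | "fst q < fst s" "snd s < snd q" by linarith
    then show ?thesis
    proof cases
      case 1
      then have "fst s < fst q \<or> snd s < snd q" using sq(3) by (auto simp: prod_eq_iff)
      moreover have "(real (fst q) - real (fst s)) * L1 k \<ge> 0" "(real (snd q) - real (snd s)) * L2 k \<ge> 0"
        using 1 k H0 by auto
      moreover have "(real (fst q) - real (fst s)) * L1 k \<ge> 1 * L1 k" if "fst s < fst q"
        using that k H0 by (intro mult_right_mono) auto
      moreover have "(real (snd q) - real (snd s)) * L2 k \<ge> 1 * L2 k" if "snd s < snd q"
        using that k H0 by (intro mult_right_mono) auto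
      ultimately have False using high[of k] k by linarith
      then show ?thesis ..
    next
      case 2
      then have "fst q < fst s \<or> snd q < snd s" using sq(3) by (auto simp: prod_eq_iff)
      moreover have "(real (fst s) - real (fst q)) * L1 k \<ge> 0" "(real (snd s) - real (snd q)) * L2 k \<ge> 0"
        using 2 k H0 by auto
      moreover have "(real (fst s) - real (fst q)) * L1 k \<ge> 1 * L1 k" if "fst q < fst s"
        using that k H0 by (intro mult_right_mono) auto
      moreover have "(real (snd s) - real (snd q)) * L2 k \<ge> 1 * L2 k" if "snd q < snd s"
        using that k H0 by (intro mult_right_mono) auto
      moreover have "(real (fst s) - real (fst q)) * L1 k + (real (snd s) - real (snd q)) * L2 k \<le> 0"
        using low[OF sq(2), of k] by (simp add: algebra_simps)
      ultimately have False using k H0 by linarith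
      then show ?thesis ..
    next
      case 3
      define e1 e2 where "e1 = fst q - fst s" and "e2 = snd s - snd q"
      have e: "fst q = fst s + e1" "snd s = snd q + e2" "e1 > 0" "e2 > 0" using 3 by (auto simp: e1_def e2_def)
      have "\<bar>real e1 * L1 k - real e2 * L2 k\<bar> \<le> H" for k
        using low[OF sq(2), of k] high[of k] e by (simp add: algebra_simps)
      then show ?thesis using e by (intro exI[of _ e2] exI[of _ e1]) (auto simp: wt_def algebra_simps)
    next
      case 4
      define e1 e2 where "e1 = fst s - fst q" and "e2 = snd q - snd s"
      have e: "fst s = fst q + e1" "snd q = snd s + e2" "e1 > 0" "e2 > 0" using 4 by (auto simp: e1_def e2_def)
      have "\<bar>real e1 * L1 k - real e2 * L2 k\<bar> \<le> H" for k
        using low[OF sq(2), of k] high[of k] e by (simp add: algebra_simps)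
      then show ?thesis using e by (intro exI[of _ e2] exI[of _ e1]) (auto simp: wt_def algebra_simps)
    qed
  qed
  then obtain p1 p2 where p: "p1 > 0" "p2 > 0" "wt (p1, p2) s = wt (p1, p2) q"
    and \<theta>: "\<And>k. \<bar>real p2 * L1 k - real p1 * L2 k\<bar> \<le> H" by blast
  define d where "d = wt (p1, p2) s"
  \<comment> \<open>An exponent of smaller weight would gain on \<open>s\<close> at the rate of
    \<open>L2 k\<close>, whereas the deviation from the ray costs at most the constant
    \<open>\<bar>D\<bar> * H\<close>; this contradicts the maximality of the monomial
    \<open>s\<close>.\<close>
  have min: "d \<le> wt (p1, p2) t" if t: "t \<in> T" for t
  proof (rule ccontr)
    assume "\<not> d \<le> wt (p1, p2) t"
    then have less: "real (wt (p1, p2) t) + 1 \<le> real d" by linarith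
    define D where "D = real (fst t) - real (fst s)"
    obtain k where k: "L2 k > \<bar>D\<bar> * H" "L2 k > 0" using large[of "max (\<bar>D\<bar> * H) 0"] by auto
    have "0 \<le> real p2 * (D * L1 k + (real (snd t) - real (snd s)) * L2 k)"
      using low[OF t, of k] by (simp add: D_def)
    also have "\<dots> = D * (real p2 * L1 k - real p1 * L2 k) + (real (wt (p1, p2) t) - real d) * L2 k"
      by (simp add: D_def d_def wt_def algebra_simps)
    also have "\<dots> \<le> \<bar>D\<bar> * H + (-1) * L2 k"
    proof (rule add_mono)
      show "D * (real p2 * L1 k - real p1 * L2 k) \<le> \<bar>D\<bar> * H"
        using \<theta>[of k] by (metis abs_ge_self abs_ge_zero abs_mult mult_left_mono order_trans)
      show "(real (wt (p1, p2) t) - real d) * L2 k \<le> (-1) * L2 k"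
        using less k by (intro mult_right_mono) auto
    qed
    finally show False using k by simp
  qed
  \<comment> \<open>With \<open>\<sigma>\<close> below, these are the real powers of
    \<open>norm (v k)\<close> with exponents \<open>p1 / p2\<close> and \<open>d / p2\<close>. The
    scale is set by \<open>v\<close>, and the width of the strip bounds \<open>norm (a k)\<close>
    from above and from below, so the limit lies in the torus.\<close>
  define \<alpha> where "\<alpha> = (\<lambda>k. exp (- (L2 k / real p2) * real p1))"
  define \<sigma> where "\<sigma> = (\<lambda>k. exp (- (L2 k / real p2) * real d))"
  define a where "a = (\<lambda>k. u k / of_real (\<alpha> k))"
  define b where "b = (\<lambda>k. v k / of_real (norm (v k)))"
  have b: "norm (b k) = 1" "v k = of_real (norm (v k)) * b k" for k
    using uv(2)[of k] by (auto simp: b_def norm_divide)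
  have \<beta>: "norm (v k) = exp (- (L2 k / real p2) * real p2)" for k
    using uv(2)[of k] p by (simp add: L2_def)
  have na: "norm (a k) = exp (- ((real p2 * L1 k - real p1 * L2 k) / real p2))" for k
  proof -
    have "norm (u k) = exp (- L1 k)" using uv(1)[of k] by (simp add: L1_def)
    then have "norm (a k) = exp (- L1 k) / exp (- (L2 k / real p2) * real p1)"
      by (simp add: a_def norm_divide \<alpha>_def)
    also have "\<dots> = exp (- L1 k - (- (L2 k / real p2) * real p1))" by (simp only: exp_diff)
    also have "- L1 k - (- (L2 k / real p2) * real p1) = - ((real p2 * L1 k - real p1 * L2 k) / real p2)"
      using p by (simp add: field_simps)
    finally show ?thesis .
  qed
  have A: "\<bar>(real p2 * L1 k - real p1 * L2 k) / real p2\<bar> \<le> H" for k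
  proof -
    have "\<bar>(real p2 * L1 k - real p1 * L2 k) / real p2\<bar> = \<bar>real p2 * L1 k - real p1 * L2 k\<bar> / real p2" by simp
    also have "\<dots> \<le> \<bar>real p2 * L1 k - real p1 * L2 k\<bar> / 1" using p by (intro divide_left_mono) auto
    finally show ?thesis using \<theta>[of k] by simp
  qed
  have abound: "norm (a k) \<le> exp H" "exp (- H) \<le> norm (a k)" for k
    unfolding na exp_le_cancel_iff using A[of k] by linarith+
  let ?e = "part {t. wt (p1, p2) t = d} e"
  have coef1: "(\<lambda>k. c k m * of_real (\<alpha> k ^ fst (mono_deg m) * norm (v k) ^ snd (mono_deg m) / \<sigma> k)) \<longlonglongrightarrow> ?e m"
    if m: "m \<in> K" for m
  proof -
    define w where "w = wt (p1, p2) (mono_deg m)"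
    have w: "d \<le> w" unfolding w_def using K m by (intro min) auto
    have eq: "\<alpha> k ^ fst (mono_deg m) * norm (v k) ^ snd (mono_deg m) / \<sigma> k = exp (- ((real w - real d) / real p2 * L2 k))" for k
      unfolding \<alpha>_def \<beta> \<sigma>_def exp_of_nat_mult[symmetric] exp_add[symmetric] exp_diff[symmetric]
      using p by (simp add: w_def wt_def field_simps)
    have "(\<lambda>k. exp (- ((real w - real d) / real p2 * L2 k))) \<longlonglongrightarrow> (if w = d then 1 else 0)"
    proof (cases "w = d")
      case False
      then have "(real w - real d) / real p2 > 0" using w p by simp
      then have "filterlim (\<lambda>k. (real w - real d) / real p2 * L2 k) at_top sequentially"
        by (rule filterlim_tendsto_pos_mult_at_top[OF tendsto_const _ top(2)])
      then have "filterlim (\<lambda>k. - ((real w - real d) / real p2 * L2 k)) at_bot sequentially"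
        by (simp add: filterlim_uminus_at_bot)
      then show ?thesis using False filterlim_compose[OF exp_at_bot] by simp
    qed simp
    from tendsto_mult[OF coef[OF m] tendsto_of_real[OF this]] show ?thesis
      unfolding eq by (cases "w = d") (auto simp: part_def w_def)
  qed
  have z: "(u k, v k) = (of_real (\<alpha> k) * a k, of_real (norm (v k)) * b k)" for k
    using b(2)[of k] by (simp add: a_def \<alpha>_def)
  have pos: "\<alpha> k > 0" "norm (v k) > 0" "\<sigma> k > 0" "norm (b k) \<le> exp H" for k
    using uv(2) H0 b(1) by (auto simp: \<alpha>_def \<sigma>_def)
  obtain r a0 b0 \<tau> where L: "strict_mono r" "(a \<circ> r) \<longlonglongrightarrow> a0" "(b \<circ> r) \<longlonglongrightarrow> b0" "0 \<le> \<tau>" "\<tau> \<le> 1"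
    "ev K ?e (a0, b0) = 0"
    "\<And>E. surj (dev K ?e (a0, b0)) \<Longrightarrow> dev K ?e (a0, b0) E = 0 \<Longrightarrow> E \<bullet> (\<tau> *\<^sub>R a0, (1 - \<tau>) *\<^sub>R b0) = 0"
    by (rule chart_limit[where c = c and a = a and b = b and \<alpha> = \<alpha> and \<beta> = "\<lambda>k. norm (v k)" and \<sigma> = \<sigma>
          and R = "exp H" and z = "\<lambda>k. (u k, v k)", OF K(1) coef1 pos(1) pos(2) pos(3) abound(1) pos(4) z bad])
      (assumption, rule that)
  have b0: "norm b0 = 1" using norm_limit_1[OF L(3) b(1)] .
  have "exp (- H) \<le> norm a0"
    by (rule LIMSEQ_le_const[OF tendsto_norm[OF L(2)]]) (use abound(2) in auto)
  then have a0: "norm a0 > 0" by (meson exp_gt_zero less_le_trans)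
  have "(a0, b0) \<in> torus" using a0 b0 by (auto simp: torus_def)
  moreover have "regular_on K ?e torus"
  proof (rule reg)
    show "wt (p1, p2) s = d" "wt (p1, p2) q = d" using p(3) unfolding d_def by auto
  qed (use p min in auto)
  ultimately have "surj (dev K ?e (a0, b0))" using L(6) unfolding regular_on_def by blast
  then have "(of_nat p1 * a0, of_nat p2 * b0) \<bullet> (\<tau> *\<^sub>R a0, (1 - \<tau>) *\<^sub>R b0) = 0"
    by (rule L(7)) (use dev_part_euler[of K "(p1, p2)" d e "(a0, b0)"] L(6) in simp)
  moreover have "(of_nat p1 * a0, of_nat p2 * b0) \<bullet> (\<tau> *\<^sub>R a0, (1 - \<tau>) *\<^sub>R b0) =
      \<tau> * (real p1 * (a0 \<bullet> a0)) + (1 - \<tau>) * (real p2 * (b0 \<bullet> b0))"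
    by (simp add: inner_complex_def algebra_simps)
  moreover have "\<tau> * (real p1 * (a0 \<bullet> a0)) + (1 - \<tau>) * (real p2 * (b0 \<bullet> b0)) > 0"
  proof (cases "\<tau> = 0")
    case True
    then show ?thesis using p b0 by (simp add: dot_square_norm)
  next
    case False
    then have "\<tau> * (real p1 * (a0 \<bullet> a0)) > 0" using L(4) p a0 by (intro mult_pos_pos) auto
    moreover have "(1 - \<tau>) * (real p2 * (b0 \<bullet> b0)) \<ge> 0" using L(5) by simp
    ultimately show ?thesis by linarith
  qed
  ultimately show False by simp
qed

section \<open>The symmetry that exchanges the two variables\<close>

definition swap_mono :: "nat \<times> nat \<times> nat \<times> nat \<Rightarrow> nat \<times> nat \<times> nat \<times> nat" where
  "swap_mono = (\<lambda>(a, b, c, d). (c, d, a, b))"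

lemma swap_mono_swap_mono [simp]: "swap_mono (swap_mono m) = m"
  by (auto simp: swap_mono_def split: prod.split)

lemma inj_swap_mono: "inj_on swap_mono K"
  by (metis inj_onI swap_mono_swap_mono)

lemma mono_deg_swap [simp]: "mono_deg (swap_mono m) = prod.swap (mono_deg m)"
  by (auto simp: swap_mono_def mono_deg_def split: prod.split)

lemma mono_eval_swap: "mono_eval (swap_mono m) (prod.swap z) = mono_eval m z"
  by (cases z) (auto simp: swap_mono_def mono_eval_def split: prod.split)

lemma mono_deriv_swap: "mono_deriv (swap_mono m) (prod.swap z) (prod.swap w) = mono_deriv m z w"
  by (cases z, cases w) (auto simp: swap_mono_def mono_deriv_def algebra_simps split: prod.split)

lemma ev_swap: "ev (swap_mono ` K) (c \<circ> swap_mono) (prod.swap z) = ev K c z"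
  by (simp add: ev_def sum.reindex[OF inj_swap_mono] mono_eval_swap)

lemma dev_swap: "dev (swap_mono ` K) (c \<circ> swap_mono) (prod.swap z) (prod.swap w) = dev K c z w"
  by (simp add: dev_def sum.reindex[OF inj_swap_mono] mono_deriv_swap)

lemma part_swap: "part S (c \<circ> swap_mono) = part (prod.swap ` S) c \<circ> swap_mono"
  by (auto simp: part_def fun_eq_iff image_iff prod_eq_iff split: prod.split)

lemma transverse_at_swap:
  "transverse_at (swap_mono ` K) (c \<circ> swap_mono) (prod.swap z) \<longleftrightarrow> transverse_at K c z"
proof -
  have inner: "prod.swap z \<bullet> prod.swap w = z \<bullet> w" for w by (cases z, cases w) auto
  have "(\<exists>w. prod.swap z \<bullet> w = 0 \<and> dev (swap_mono ` K) (c \<circ> swap_mono) (prod.swap z) w = y) \<longleftrightarrow>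
     (\<exists>w. z \<bullet> w = 0 \<and> dev K c z w = y)" for y
    by (metis inner dev_swap swap_swap)
  then show ?thesis by (simp add: transverse_at_def ev_swap)
qed

text \<open>These are the vertices of the convex hull of \<open>T\<close> plus the positive
  quadrant. The weights are real because \<open>no_bad_sequence_torus\<close> reads them off from
  logarithms of coordinates.\<close>

definition vertex_of :: "(nat \<times> nat) set \<Rightarrow> nat \<times> nat \<Rightarrow> bool" where
  "vertex_of T s \<longleftrightarrow> s \<in> T \<and> (\<exists>x>0. \<exists>y>0. \<forall>t\<in>T - {s}.
     x * real (fst s) + y * real (snd s) < x * real (fst t) + y * real (snd t))"

text \<open>\<open>T\<close> may contain exponents at which \<open>c\<close> has no coefficient: it
  bounds the support of all perturbations under control, and edges and vertices are those of
  \<open>T\<close>. Zeros are forbidden at vertices off the axes, whereas the last two clauses allow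
  them at the ends on the axes.\<close>

definition admissible :: "(nat \<times> nat) set \<Rightarrow> (nat \<times> nat \<times> nat \<times> nat) set \<Rightarrow> (nat \<times> nat \<times> nat \<times> nat \<Rightarrow> complex) \<Rightarrow> bool" where
  "admissible T K c \<longleftrightarrow>
    (\<forall>p s q. fst p > 0 \<longrightarrow> snd p > 0 \<longrightarrow> s \<in> T \<longrightarrow> q \<in> T \<longrightarrow> s \<noteq> q \<longrightarrow> wt p s = wt p q \<longrightarrow>
       (\<forall>t\<in>T. wt p s \<le> wt p t) \<longrightarrow> regular_on K (part {t. wt p t = wt p s} c) torus) \<and>
    (\<forall>s. vertex_of T s \<longrightarrow> fst s > 0 \<longrightarrow> snd s > 0 \<longrightarrow> (\<forall>z\<in>torus. ev K (part {s} c) z \<noteq> 0)) \<and>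
    left_end_regular T K c \<and>
    left_end_regular (prod.swap ` T) (swap_mono ` K) (c \<circ> swap_mono)"

lemma vertex_of_swap: "vertex_of (prod.swap ` T) (prod.swap s) \<longleftrightarrow> vertex_of T s"
proof -
  have "vertex_of (prod.swap ` T) (prod.swap s)" if "vertex_of T s" for T s
  proof -
    obtain x y :: real where xy: "x > 0" "y > 0" "\<And>t. t \<in> T - {s} \<Longrightarrow>
       x * real (fst s) + y * real (snd s) < x * real (fst t) + y * real (snd t)"
      using \<open>vertex_of T s\<close> unfolding vertex_of_def by blast
    show ?thesis
      unfolding vertex_of_def
    proof (intro conjI exI ballI)
      show "prod.swap s \<in> prod.swap ` T" using \<open>vertex_of T s\<close> by (simp add: vertex_of_def)
      fix t assume "t \<in> prod.swap ` T - {prod.swap s}"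
      then obtain t' where "t = prod.swap t'" "t' \<in> T - {s}" by auto
      then show "y * real (fst (prod.swap s)) + x * real (snd (prod.swap s)) < y * real (fst t) + x * real (snd t)"
        using xy(3)[of t'] by (simp add: add.commute)
    qed (use xy in auto)
  qed
  from this[of T s] this[of "prod.swap ` T" "prod.swap s"] show ?thesis
    by (auto simp: image_image)
qed

lemma vertex_on_axis_minimal:
  assumes "vertex_of T (0, n)" "(0, n') \<in> T"
  shows "n \<le> n'"
proof (rule ccontr)
  assume "\<not> n \<le> n'"
  then have n': "(0, n') \<in> T - {(0, n)}" "n' < n" using assms(2) by auto
  obtain x y :: real where y: "x > 0" "y > 0" and xy: "\<forall>t\<in>T - {(0, n)}.
       x * real (fst (0 :: nat, n)) + y * real (snd (0 :: nat, n)) < x * real (fst t) + y * real (snd t)"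
    using assms(1) unfolding vertex_of_def by blast
  show False using bspec[OF xy n'(1)] y(2) n'(2) by simp
qed

lemma no_bad_sequence_vertex_on_axis:
  fixes u v :: "nat \<Rightarrow> complex" and c :: "nat \<Rightarrow> nat \<times> nat \<times> nat \<times> nat \<Rightarrow> complex"
  assumes K: "finite K" "mono_deg ` K \<subseteq> T"
    and coef: "\<And>m. m \<in> K \<Longrightarrow> (\<lambda>k. c k m) \<longlonglongrightarrow> e m"
    and reg: "left_end_regular T K e"
    and s: "vertex_of T s" "fst s = 0"
    and uv: "\<And>k. u k \<noteq> 0" "\<And>k. v k \<noteq> 0" "\<And>k. norm (v k) < 1" "v \<longlonglongrightarrow> 0"
    and ratio: "\<And>t. t \<in> T \<Longrightarrow> t \<noteq> s \<Longrightarrow>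
       (\<lambda>k. (norm (u k) ^ fst t * norm (v k) ^ snd t) / (norm (u k) ^ fst s * norm (v k) ^ snd s)) \<longlonglongrightarrow> 0"
    and bad: "\<And>k. \<not> transverse_at K (c k) (u k, v k)"
  shows False
proof -
  obtain n where n: "s = (0, n)" using s(2) by (cases s) auto
  show False
  proof (rule no_bad_sequence_left_end[OF K coef reg _ _ uv(2,3,4), of n "\<lambda>k. norm (u k)" u "\<lambda>k. u k / of_real (norm (u k))"])
    show "(0, n) \<in> T" using s n by (simp add: vertex_of_def)
    show "n \<le> n'" if "(0, n') \<in> T" for n' using vertex_on_axis_minimal s(1) n that by blast
    show "(\<lambda>k. norm (u k) ^ fst t * norm (v k) ^ snd t / norm (v k) ^ n) \<longlonglongrightarrow> 0" if "t \<in> T" "t \<noteq> (0, n)" for t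
      using ratio[of t] that by (simp add: n)
  qed (use uv bad in \<open>auto simp: norm_divide\<close>)
qed

text \<open>After passing to a subsequence one exponent \<open>s\<close> gives the largest monomial
  throughout. Either a second monomial stays comparable along a further subsequence, which is the
  edge case, or all others become negligible, and then \<open>s\<close> must be a vertex.\<close>

lemma no_bad_sequence_torus:
  fixes u v :: "nat \<Rightarrow> complex" and c :: "nat \<Rightarrow> nat \<times> nat \<times> nat \<times> nat \<Rightarrow> complex"
  assumes K: "finite K" "mono_deg ` K \<subseteq> T" and T: "finite T" "T \<noteq> {}"
    and coef: "\<And>m. m \<in> K \<Longrightarrow> (\<lambda>k. c k m) \<longlonglongrightarrow> e m"
    and adm: "admissible T K e"
    and uv: "\<And>k. u k \<noteq> 0" "\<And>k. v k \<noteq> 0" "\<And>k. norm (u k) < 1" "\<And>k. norm (v k) < 1" "u \<longlonglongrightarrow> 0" "v \<longlonglongrightarrow> 0"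
    and bad: "\<And>k. \<not> transverse_at K (c k) (u k, v k)"
  shows False
proof -
  define M where "M = (\<lambda>k t. norm (u k) ^ fst t * norm (v k) ^ snd t)"
  have M: "M k t > 0" for k t using uv(1,2) by (simp add: M_def)
  have "\<exists>s\<in>T. \<forall>t\<in>T. M k t \<le> M k s" for k
  proof -
    have "Max (M k ` T) \<in> M k ` T" using T by (intro Max_in) auto
    then obtain s where "s \<in> T" "M k s = Max (M k ` T)" by auto
    then show ?thesis using T by (intro bexI[of _ s]) auto
  qed
  then obtain f where f: "\<And>k. f k \<in> T" "\<And>k t. t \<in> T \<Longrightarrow> M k t \<le> M k (f k)" by metis
  have "finite (f ` UNIV)" using f(1) by (intro finite_subset[OF _ T(1)]) auto
  then obtain k0 where "infinite {k. f k = f k0}" using pigeonhole_infinite[of UNIV f] by auto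
  then obtain r1 where r1: "strict_mono (r1 :: nat \<Rightarrow> nat)" "\<And>k. f (r1 k) = f k0"
    using infinite_enumerate by blast
  define s where "s = f k0"
  have s: "s \<in> T" "\<And>k t. t \<in> T \<Longrightarrow> M (r1 k) t \<le> M (r1 k) s"
    using f r1(2) unfolding s_def by metis+
  show False
  proof (cases "\<forall>t\<in>T. t \<noteq> s \<longrightarrow> (\<lambda>k. M (r1 k) t / M (r1 k) s) \<longlonglongrightarrow> 0")
    case False
    then obtain q where q: "q \<in> T" "q \<noteq> s" "\<not> (\<lambda>k. M (r1 k) q / M (r1 k) s) \<longlonglongrightarrow> 0" by blast
    then obtain \<eta> where \<eta>: "\<eta> > 0" "\<not> (\<forall>\<^sub>F k in sequentially. dist (M (r1 k) q / M (r1 k) s) 0 < \<eta>)"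
      unfolding tendsto_iff by blast
    then have "infinite {k. \<not> dist (M (r1 k) q / M (r1 k) s) 0 < \<eta>}"
      by (simp add: cofinite_eq_sequentially[symmetric] eventually_cofinite)
    then obtain r2 where r2: "strict_mono (r2 :: nat \<Rightarrow> nat)" "\<And>k. \<not> dist (M (r1 (r2 k)) q / M (r1 (r2 k)) s) 0 < \<eta>"
      using infinite_enumerate by blast
    define r where "r = r1 \<circ> r2"
    have r: "strict_mono r" unfolding r_def using r1(1) r2(1) by (rule strict_mono_o)
    have ge: "\<eta> * M (r k) s \<le> M (r k) q" for k
    proof -
      have "M (r k) q / M (r k) s \<ge> \<eta>"
        using r2(2)[of k] M[of "r k" q] M[of "r k" s] by (simp add: r_def dist_real_def)
      then show ?thesis using M[of "r k" s] by (simp add: field_simps)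
    qed
    show False
    proof (rule no_bad_sequence_edge[OF K, of "c \<circ> r" e s q "u \<circ> r" "v \<circ> r" \<eta>])
      show "(\<lambda>k. (c \<circ> r) k m) \<longlonglongrightarrow> e m" if "m \<in> K" for m
        using LIMSEQ_subseq_LIMSEQ[OF coef[OF that] r] by (simp add: o_def)
      show "regular_on K (part {t. wt p t = d} e) torus"
        if "fst p > 0" "snd p > 0" "\<And>t. t \<in> T \<Longrightarrow> d \<le> wt p t" "wt p s = d" "wt p q = d" for p d
        using adm that s(1) q(1,2) unfolding admissible_def by metis
      show "(u \<circ> r) \<longlonglongrightarrow> 0" "(v \<circ> r) \<longlonglongrightarrow> 0"
        using LIMSEQ_subseq_LIMSEQ[OF uv(5) r] LIMSEQ_subseq_LIMSEQ[OF uv(6) r] by auto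
      show "norm ((u \<circ> r) k) ^ fst t * norm ((v \<circ> r) k) ^ snd t \<le> norm ((u \<circ> r) k) ^ fst s * norm ((v \<circ> r) k) ^ snd s"
        if "t \<in> T" for k t
        using s(2)[OF that, of "r2 k"] by (simp add: M_def r_def)
      show "\<eta> * (norm ((u \<circ> r) k) ^ fst s * norm ((v \<circ> r) k) ^ snd s) \<le> norm ((u \<circ> r) k) ^ fst q * norm ((v \<circ> r) k) ^ snd q" for k
        using ge[of k] by (simp add: M_def)
      show "\<not> transverse_at K ((c \<circ> r) k) ((u \<circ> r) k, (v \<circ> r) k)" for k
        using bad[of "r k"] by simp
    qed (use s q uv \<eta> in auto)
  next
    case True
    have lim: "(\<lambda>k. u (r1 k)) \<longlonglongrightarrow> 0" "(\<lambda>k. v (r1 k)) \<longlonglongrightarrow> 0"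
      using LIMSEQ_subseq_LIMSEQ[OF uv(5) r1(1)] LIMSEQ_subseq_LIMSEQ[OF uv(6) r1(1)] by (auto simp: o_def)
    have coef1: "(\<lambda>k. c (r1 k) m) \<longlonglongrightarrow> e m" if "m \<in> K" for m
      using LIMSEQ_subseq_LIMSEQ[OF coef[OF that] r1(1)] by (simp add: o_def)
    have ratio: "(\<lambda>k. (norm (u (r1 k)) ^ fst t * norm (v (r1 k)) ^ snd t) / (norm (u (r1 k)) ^ fst s * norm (v (r1 k)) ^ snd s)) \<longlonglongrightarrow> 0"
      if "t \<in> T" "t \<noteq> s" for t
      using True that by (simp add: M_def)
    have "\<forall>\<^sub>F k in sequentially. \<forall>t\<in>T - {s}. M (r1 k) t / M (r1 k) s < 1"
      using True T(1) by (intro eventually_ball_finite) (auto intro: order_tendstoD)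
    then obtain k where k: "\<And>t. t \<in> T - {s} \<Longrightarrow> M (r1 k) t / M (r1 k) s < 1"
      using eventually_happens'[OF sequentially_bot] by blast
    have vertex: "vertex_of T s"
      unfolding vertex_of_def
    proof (intro conjI exI ballI)
      \<comment> \<open>The logarithmic size of a single late point of the sequence is a weight
        whose unique minimiser is \<open>s\<close>.\<close>
      let ?x = "- ln (norm (u (r1 k)))" and ?y = "- ln (norm (v (r1 k)))"
      show "s \<in> T" by (fact s(1))
      show "?x > 0" "?y > 0" using uv by (auto simp: ln_less_zero_iff)
      fix t assume "t \<in> T - {s}"
      then have "M (r1 k) t < M (r1 k) s" using k M[of "r1 k" s] by (simp add: field_simps)
      then have "ln (M (r1 k) t) < ln (M (r1 k) s)" using M by simp
      then show "?x * real (fst s) + ?y * real (snd s) < ?x * real (fst t) + ?y * real (snd t)"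
        using uv(1,2) by (simp add: M_def ln_mult ln_realpow algebra_simps)
    qed
    consider "fst s > 0" "snd s > 0" | "fst s = 0" | "snd s = 0" by auto
    then show False
    proof cases
      case 1
      \<comment> \<open>Off the axes, division by the absolute values suffices: the limit has both
        coordinates on the unit circle and is a zero of the vertex polynomial, which has
        none.\<close>
      define a where "a = (\<lambda>k. u (r1 k) / of_real (norm (u (r1 k))))"
      define b where "b = (\<lambda>k. v (r1 k) / of_real (norm (v (r1 k))))"
      have n1: "norm (a k) = 1" "norm (b k) = 1" for k using uv(1,2) by (auto simp: a_def b_def norm_divide)
      have coef2: "(\<lambda>k. c (r1 k) m * of_real (norm (u (r1 k)) ^ fst (mono_deg m) * norm (v (r1 k)) ^ snd (mono_deg m) / M (r1 k) s)) \<longlonglongrightarrow> part {s} e m"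
        if m: "m \<in> K" for m
      proof (cases "mono_deg m = s")
        case True
        then show ?thesis using coef1[OF m] uv(1,2) by (simp add: part_def M_def)
      next
        case False
        have "(\<lambda>k. c (r1 k) m * of_real (norm (u (r1 k)) ^ fst (mono_deg m) * norm (v (r1 k)) ^ snd (mono_deg m) / M (r1 k) s)) \<longlonglongrightarrow> e m * of_real 0"
          unfolding M_def by (intro tendsto_mult coef1[OF m] tendsto_of_real ratio[OF _ False]) (use K m in auto)
        then show ?thesis using False by (simp add: part_def)
      qed
      have facts: "norm (u (r1 k)) > 0" "norm (v (r1 k)) > 0" "M (r1 k) s > 0" "norm (a k) \<le> 1" "norm (b k) \<le> 1"
        "(u (r1 k), v (r1 k)) = (of_real (norm (u (r1 k))) * a k, of_real (norm (v (r1 k))) * b k)"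
        "\<not> transverse_at K (c (r1 k)) (u (r1 k), v (r1 k))" for k
        using uv(1,2) M n1 bad by (auto simp: a_def b_def)
      obtain r a0 b0 where L: "(a \<circ> r) \<longlonglongrightarrow> a0" "(b \<circ> r) \<longlonglongrightarrow> b0" "ev K (part {s} e) (a0, b0) = 0"
        by (rule chart_limit[where c = "\<lambda>k. c (r1 k)" and a = a and b = b and \<alpha> = "\<lambda>k. norm (u (r1 k))"
              and \<beta> = "\<lambda>k. norm (v (r1 k))" and \<sigma> = "\<lambda>k. M (r1 k) s"
              and R = 1 and z = "\<lambda>k. (u (r1 k), v (r1 k))", OF K(1) coef2 facts]) (assumption, rule that)
      have "norm a0 = 1" "norm b0 = 1" using norm_limit_1[OF L(1) n1(1)] norm_limit_1[OF L(2) n1(2)] by auto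
      then have "(a0, b0) \<in> torus" by (auto simp: torus_def)
      then show False using adm vertex 1 L(3) unfolding admissible_def by blast
    next
      case 2
      show False
        by (rule no_bad_sequence_vertex_on_axis[OF K coef1 _ vertex 2 _ _ _ lim(2) ratio])
          (use uv bad adm in \<open>auto simp: admissible_def\<close>)
    next
      case 3
      show False
      proof (rule no_bad_sequence_vertex_on_axis[where K = "swap_mono ` K" and T = "prod.swap ` T" and s = "prod.swap s"
            and c = "\<lambda>k. c (r1 k) \<circ> swap_mono" and e = "e \<circ> swap_mono" and v = "\<lambda>k. u (r1 k)" and u = "\<lambda>k. v (r1 k)"])
        show "finite (swap_mono ` K)" using K by simp
        show "mono_deg ` swap_mono ` K \<subseteq> prod.swap ` T" using K(2) by auto
        show "(\<lambda>k. (c (r1 k) \<circ> swap_mono) m) \<longlonglongrightarrow> (e \<circ> swap_mono) m" if "m \<in> swap_mono ` K" for m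
          using that coef1 by auto
        show "left_end_regular (prod.swap ` T) (swap_mono ` K) (e \<circ> swap_mono)" using adm by (simp add: admissible_def)
        show "vertex_of (prod.swap ` T) (prod.swap s)" using vertex by (simp add: vertex_of_swap)
        show "\<not> transverse_at (swap_mono ` K) (c (r1 k) \<circ> swap_mono) (v (r1 k), u (r1 k))" for k
          using bad[of "r1 k"] transverse_at_swap[of K "c (r1 k)" "(u (r1 k), v (r1 k))"] by simp
        show "(\<lambda>k. norm (v (r1 k)) ^ fst t * norm (u (r1 k)) ^ snd t / (norm (v (r1 k)) ^ fst (prod.swap s) * norm (u (r1 k)) ^ snd (prod.swap s))) \<longlonglongrightarrow> 0"
          if t: "t \<in> prod.swap ` T" "t \<noteq> prod.swap s" for t
        proof -
          obtain t' where t': "t' \<in> T" "t = prod.swap t'" using t(1) by auto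
          then have "t' \<noteq> s" using t(2) by auto
          from ratio[OF t'(1) this] show ?thesis by (simp add: t'(2) mult.commute)
        qed
      qed (use uv lim 3 in auto)
    qed
  qed
qed

lemma no_bad_sequence_axis:
  fixes v :: "nat \<Rightarrow> complex" and c :: "nat \<Rightarrow> nat \<times> nat \<times> nat \<times> nat \<Rightarrow> complex"
  assumes K: "finite K" "mono_deg ` K \<subseteq> T"
    and coef: "\<And>m. m \<in> K \<Longrightarrow> (\<lambda>k. c k m) \<longlonglongrightarrow> e m"
    and reg: "left_end_regular T K e" and T: "(0, n0) \<in> T"
    and v: "\<And>k. v k \<noteq> 0" "\<And>k. norm (v k) < 1" "v \<longlonglongrightarrow> 0"
    and bad: "\<And>k. \<not> transverse_at K (c k) (0, v k)"
  shows False
proof -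
  define n where "n = (LEAST n. (0, n) \<in> T)"
  have n: "(0, n) \<in> T" "\<And>n'. (0, n') \<in> T \<Longrightarrow> n \<le> n'"
    unfolding n_def using T by (auto intro: LeastI Least_le)
  show False
  \<comment> \<open>The first coordinate is zero, so its scale is free;
    \<open>norm (v k) ^ (n + 1)\<close> is small enough to make every monomial containing
    \<open>u\<close> negligible against \<open>norm (v k) ^ n\<close>.\<close>
  proof (rule no_bad_sequence_left_end[OF K coef reg n v, of "\<lambda>k. norm (v k) ^ (n + 1)" "\<lambda>k. 0" "\<lambda>k. 0"])
    fix t assume t: "t \<in> T" "t \<noteq> (0, n)"
    have gt: "(n + 1) * fst t + snd t > n"
    proof (cases "fst t")
      case 0
      then have "n < snd t" using n(2)[of "snd t"] t by (cases t) (auto simp: le_less)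
      then show ?thesis by simp
    qed auto
    have eq: "(norm (v k) ^ (n + 1)) ^ fst t * norm (v k) ^ snd t / norm (v k) ^ n = norm (v k) ^ ((n + 1) * fst t + snd t - n)" for k
      using v(1)[of k] gt by (simp only: power_mult[symmetric] power_add[symmetric] power_diff less_imp_le zero_less_norm_iff norm_eq_zero not_False_eq_True)
    have "(\<lambda>k. norm (v k) ^ ((n + 1) * fst t + snd t - n)) \<longlonglongrightarrow> norm (0::complex) ^ ((n + 1) * fst t + snd t - n)"
      by (intro tendsto_intros v(3))
    moreover have "norm (0::complex) ^ ((n + 1) * fst t + snd t - n) = 0"
      using gt by (simp add: power_0_left)
    ultimately show "(\<lambda>k. (norm (v k) ^ (n + 1)) ^ fst t * norm (v k) ^ snd t / norm (v k) ^ n) \<longlonglongrightarrow> 0"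
      unfolding eq by (simp only:)
  qed (use v bad in auto)
qed

text \<open>A sequence of counterexamples tends to the origin while its coefficients tend to
  \<open>e\<close>, and infinitely many of its points lie in the torus or on one of the axes. The
  alternative \<open>A \<subseteq> torus\<close> serves edge polynomials, whose exponents need not
  reach the axes.\<close>

theorem uniform_transversality:
  assumes K: "finite K" "mono_deg ` K \<subseteq> T" and T: "finite T" "T \<noteq> {}"
    and adm: "admissible T K e"
    and A: "A \<subseteq> torus \<or> 0 \<notin> A \<and> (\<exists>n. (0, n) \<in> T) \<and> (\<exists>n. (n, 0) \<in> T)"
  shows "\<exists>\<delta>>0. \<forall>c z. (\<forall>m\<in>K. norm (c m - e m) \<le> \<delta>) \<longrightarrow> z \<in> A \<longrightarrow> norm z \<le> \<delta> \<longrightarrow> transverse_at K c z"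
proof (rule ccontr)
  assume "\<not> ?thesis"
  \<comment> \<open>The shift by 2 makes all coordinates smaller than 1 in absolute value, so that
    logarithms are negative and powers decrease.\<close>
  then have "\<exists>c z. (\<forall>m\<in>K. norm (c m - e m) \<le> 1 / real (k + 2)) \<and> z \<in> A \<and> norm z \<le> 1 / real (k + 2) \<and> \<not> transverse_at K c z" for k :: nat
    by (metis divide_pos_pos of_nat_0_less_iff add_pos_pos zero_less_numeral zero_less_one add_gr_0)
  then obtain c z where cz: "\<And>k m. m \<in> K \<Longrightarrow> norm (c k m - e m) \<le> 1 / real (k + 2)"
    "\<And>k. z k \<in> A" "\<And>k. norm (z k) \<le> 1 / real (k + 2)" "\<And>k. \<not> transverse_at K (c k) (z k)"
    by metis
  have null: "(\<lambda>k. 1 / real (k + 2)) \<longlonglongrightarrow> 0" using LIMSEQ_ignore_initial_segment[OF lim_1_over_n, of 2] .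
  have coef: "(\<lambda>k. c k m) \<longlonglongrightarrow> e m" if "m \<in> K" for m
  proof -
    have "(\<lambda>k. c k m - e m) \<longlonglongrightarrow> 0" by (rule Lim_null_comparison[OF _ null]) (use cz(1)[OF that] in auto)
    then show ?thesis by (simp add: LIM_zero_iff)
  qed
  have "z \<longlonglongrightarrow> 0" by (rule Lim_null_comparison[OF _ null]) (use cz(3) in auto)
  then have lim: "(\<lambda>k. fst (z k)) \<longlonglongrightarrow> 0" "(\<lambda>k. snd (z k)) \<longlonglongrightarrow> 0"
    by (auto dest: tendsto_fst tendsto_snd)
  have small: "norm (fst (z k)) < 1" "norm (snd (z k)) < 1" for k
  proof -
    have "norm (z k) < 1" using cz(3)[of k] by (rule le_less_trans) simp
    then show "norm (fst (z k)) < 1" "norm (snd (z k)) < 1"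
      using norm_fst_le[of "fst (z k)" "snd (z k)"] norm_snd_le[of "snd (z k)" "fst (z k)"] by auto
  qed
  have sub: "False" if inf: "infinite {k. P (z k)}" and P: "\<And>r::nat \<Rightarrow> nat. (\<And>m. m \<in> K \<Longrightarrow> (\<lambda>k. c (r k) m) \<longlonglongrightarrow> e m) \<Longrightarrow>
      (\<lambda>k. fst (z (r k))) \<longlonglongrightarrow> 0 \<Longrightarrow> (\<lambda>k. snd (z (r k))) \<longlonglongrightarrow> 0 \<Longrightarrow> (\<And>k. P (z (r k))) \<Longrightarrow> False" for P
  proof -
    obtain r where r: "strict_mono (r :: nat \<Rightarrow> nat)" "\<And>k. r k \<in> {k. P (z k)}"
      using infinite_enumerate[OF inf] by auto
    show False
    proof (rule P[of r])
      show "(\<lambda>k. c (r k) m) \<longlonglongrightarrow> e m" if "m \<in> K" for m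
        using LIMSEQ_subseq_LIMSEQ[OF coef[OF that] r(1)] by (simp add: o_def)
      show "(\<lambda>k. fst (z (r k))) \<longlonglongrightarrow> 0" "(\<lambda>k. snd (z (r k))) \<longlonglongrightarrow> 0"
        using LIMSEQ_subseq_LIMSEQ[OF lim(1) r(1)] LIMSEQ_subseq_LIMSEQ[OF lim(2) r(1)] by (auto simp: o_def)
      show "P (z (r k))" for k using r(2) by simp
    qed
  qed
  let ?T = "{k. fst (z k) \<noteq> 0 \<and> snd (z k) \<noteq> 0}" and ?U = "{k. fst (z k) = 0}" and ?V = "{k. snd (z k) = 0}"
  have "infinite (UNIV :: nat set)" by simp
  also have "(UNIV :: nat set) = ?T \<union> ?U \<union> ?V" by auto
  finally have "infinite ?T \<or> infinite ?U \<or> infinite ?V" by (simp only: finite_Un de_Morgan_conj disj_assoc)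
  then consider "infinite ?T" | "infinite ?U" | "infinite ?V" by blast
  then show False
  proof cases
    case 1
    then show False
    proof (rule sub)
      fix r :: "nat \<Rightarrow> nat"
      assume r: "\<And>m. m \<in> K \<Longrightarrow> (\<lambda>k. c (r k) m) \<longlonglongrightarrow> e m" "(\<lambda>k. fst (z (r k))) \<longlonglongrightarrow> 0" "(\<lambda>k. snd (z (r k))) \<longlonglongrightarrow> 0"
        "\<And>k. fst (z (r k)) \<noteq> 0 \<and> snd (z (r k)) \<noteq> 0"
      show False
        by (rule no_bad_sequence_torus[OF K T r(1) adm _ _ _ _ r(2,3)]) (use r(4) small cz(4) in auto)
    qed
  next
    case 2
    then show False
    proof (rule sub)
      fix r :: "nat \<Rightarrow> nat"
      assume r: "\<And>m. m \<in> K \<Longrightarrow> (\<lambda>k. c (r k) m) \<longlonglongrightarrow> e m" "(\<lambda>k. fst (z (r k))) \<longlonglongrightarrow> 0" "(\<lambda>k. snd (z (r k))) \<longlonglongrightarrow> 0"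
        "\<And>k. fst (z (r k)) = 0"
      have z: "z k = (0, snd (z k))" if "fst (z k) = 0" for k using that by (metis prod.collapse)
      have "z (r 0) \<notin> torus" using r(4)[of 0] by (auto simp: torus_def split_beta)
      then have A': "0 \<notin> A" "\<exists>n. (0, n) \<in> T" using A cz(2) by auto
      then obtain n0 where n0: "(0, n0) \<in> T" by blast
      show False
      proof (rule no_bad_sequence_axis[OF K r(1) _ n0, where v = "\<lambda>k. snd (z (r k))"])
        show "snd (z (r k)) \<noteq> 0" for k
          using A'(1) cz(2)[of "r k"] r(4)[of k] by (metis prod_eqI fst_zero snd_zero)
        show "\<not> transverse_at K (c (r k)) (0, snd (z (r k)))" for k
          using cz(4)[of "r k"] z[OF r(4)[of k]] by simp
      qed (use r small adm in \<open>auto simp: admissible_def\<close>)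
    qed
  next
    case 3
    then show False
    proof (rule sub)
      fix r :: "nat \<Rightarrow> nat"
      assume r: "\<And>m. m \<in> K \<Longrightarrow> (\<lambda>k. c (r k) m) \<longlonglongrightarrow> e m" "(\<lambda>k. fst (z (r k))) \<longlonglongrightarrow> 0" "(\<lambda>k. snd (z (r k))) \<longlonglongrightarrow> 0"
        "\<And>k. snd (z (r k)) = 0"
      have "z (r 0) \<notin> torus" using r(4)[of 0] by (auto simp: torus_def split_beta)
      then have A': "0 \<notin> A" "\<exists>n. (n, 0) \<in> T" using A cz(2) by auto
      then obtain n0 where n0: "(n0, 0) \<in> T" by blast
      show False
      proof (rule no_bad_sequence_axis[where K = "swap_mono ` K" and T = "prod.swap ` T" and ?n0.0 = n0
            and c = "\<lambda>k. c (r k) \<circ> swap_mono" and e = "e \<circ> swap_mono" and v = "\<lambda>k. fst (z (r k))"])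
        show "fst (z (r k)) \<noteq> 0" for k
          using A'(1) cz(2)[of "r k"] r(4)[of k] by (metis prod_eqI fst_zero snd_zero)
        show "\<not> transverse_at (swap_mono ` K) (c (r k) \<circ> swap_mono) (0, fst (z (r k)))" for k
        proof -
          have "prod.swap (z (r k)) = (0, fst (z (r k)))" using r(4)[of k] by (metis prod.swap_def)
          then show ?thesis using cz(4)[of "r k"] transverse_at_swap by metis
        qed
        show "(0, n0) \<in> prod.swap ` T" using n0 by force
        show "(\<lambda>k. (c (r k) \<circ> swap_mono) m) \<longlonglongrightarrow> (e \<circ> swap_mono) m" if "m \<in> swap_mono ` K" for m
          using that r(1) by auto
      qed (use K r small adm in \<open>auto simp: admissible_def\<close>)
    qed
  qed
qed

section \<open>Links up to isotopy\<close>

lemma isotopic_homeomorphism: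
  assumes "isotopic K K'"
  obtains h h' where "homeomorphism S3 S3 h h'" "h ` K = K'"
proof -
  obtain h where h: "homotopic_with_canon (\<lambda>g. \<exists>g'. homeomorphism S3 S3 g g') S3 S3 id h" "h ` K = K'"
    using assms unfolding isotopic_def by blast
  then show ?thesis using that homotopic_with_imp_property[OF h(1)] by blast
qed

lemma isotopic_trans:
  assumes "isotopic K1 K2" "isotopic K2 K3"
  shows "isotopic K1 K3"
proof -
  let ?P = "\<lambda>g. \<exists>g'. homeomorphism S3 S3 g g'"
  obtain h1 where h1: "homotopic_with_canon ?P S3 S3 id h1" "h1 ` K1 = K2"
    using assms(1) unfolding isotopic_def by blast
  obtain h2 where h2: "homotopic_with_canon ?P S3 S3 id h2" "h2 ` K2 = K3"
    using assms(2) unfolding isotopic_def by blast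
  obtain g1 where g1: "homeomorphism S3 S3 h1 g1" using homotopic_with_imp_property[OF h1(1)] by blast
  have "homotopic_with_canon ?P S3 S3 (id \<circ> h1) (h2 \<circ> h1)"
  proof (rule homotopic_with_compose_continuous_map_right[OF h2(1)])
    show "continuous_map (top_of_set S3) (top_of_set S3) h1"
      using h1(1) homotopic_with_imp_continuous_maps by blast
    show "\<exists>g'. homeomorphism S3 S3 (j \<circ> h1) g'" if "\<exists>g'. homeomorphism S3 S3 j g'" for j
      using that homeomorphism_compose[OF g1] by blast
  qed
  then have "homotopic_with_canon ?P S3 S3 id (h2 \<circ> h1)"
    using homotopic_with_trans[OF h1(1)] by simp
  moreover have "(h2 \<circ> h1) ` K1 = K3" using h1(2) h2(2) by (metis image_comp)
  ultimately show ?thesis unfolding isotopic_def by blast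
qed

text \<open>Local flatness and the decomposition into circles are both transported by the
  homeomorphism at the end of the isotopy; charts are composed with its inverse.\<close>

lemma is_link_isotopic:
  assumes link: "is_link K" and iso: "isotopic K K'"
  shows "is_link K'"
proof -
  obtain h h' where h: "homeomorphism S3 S3 h h'" "h ` K = K'" using isotopic_homeomorphism[OF iso] .
  have KS: "K \<subseteq> S3" using link by (simp add: is_link_def)
  have inj: "inj_on h S3" by (rule inj_on_inverseI[of S3 h' h]) (rule homeomorphism_apply1[OF h(1)])
  have sub: "homeomorphism A (h ` A) h h'" if "A \<subseteq> S3" for A
    by (rule homeomorphism_of_subsets[OF h(1) that order_refl refl])
  have "locally_flat K'"
    unfolding locally_flat_def
  proof
    fix x' assume "x' \<in> K'"
    then obtain x where x: "x \<in> K" "x' = h x" using h(2) by auto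
    obtain U \<phi> \<psi> where U: "openin (top_of_set S3) U" "x \<in> U" "homeomorphism U (UNIV :: (real \<times> real \<times> real) set) \<phi> \<psi>"
      "\<phi> ` (U \<inter> K) = {(t, 0, 0) | t. True}"
      using link x(1) unfolding is_link_def locally_flat_def by meson
    have US: "U \<subseteq> S3" using U(1) openin_imp_subset by blast
    show "\<exists>U \<phi> \<psi>. openin (top_of_set S3) U \<and> x' \<in> U \<and> homeomorphism U (UNIV :: (real \<times> real \<times> real) set) \<phi> \<psi> \<and>
      \<phi> ` (U \<inter> K') = {(t, 0, 0) | t. True}"
    proof (intro exI conjI)
      show "openin (top_of_set S3) (h ` U)" using homeomorphism_imp_open_map[OF h(1) U(1)] .
      show "x' \<in> h ` U" using x U by auto
      have "homeomorphism (h ` U) U h' h" using sub[OF US] by (rule homeomorphism_symD)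
      then show "homeomorphism (h ` U) UNIV (\<phi> \<circ> h') (h \<circ> \<psi>)" using U(3) by (rule homeomorphism_compose)
      have "h ` U \<inter> K' = h ` (U \<inter> K)"
        using inj_on_image_Int[OF inj US KS] h(2) by simp
      moreover have "h' ` h ` (U \<inter> K) = U \<inter> K"
        by (rule homeomorphism_image2[OF sub]) (use KS in blast)
      ultimately show "(\<phi> \<circ> h') ` (h ` U \<inter> K') = {(t, 0, 0) | t. True}"
        using U(4) by (metis image_comp)
    qed
  qed
  moreover obtain \<C> where C: "finite \<C>" "pairwise disjnt \<C>" "\<And>C. C \<in> \<C> \<Longrightarrow> C homeomorphic (sphere 0 1 :: complex set)" "K = \<Union> \<C>"
    using link unfolding is_link_def by blast
  have CS: "C \<subseteq> S3" if "C \<in> \<C>" for C using that C(4) KS by blast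
  have "pairwise disjnt ((`) h ` \<C>)"
  proof (rule pairwiseI)
    fix A B assume "A \<in> (`) h ` \<C>" "B \<in> (`) h ` \<C>" "A \<noteq> B"
    then obtain A' B' where AB: "A' \<in> \<C>" "B' \<in> \<C>" "A = h ` A'" "B = h ` B'" "A' \<noteq> B'" by auto
    then have "A' \<inter> B' = {}" using C(2) by (auto simp: pairwise_def disjnt_def)
    then show "disjnt A B"
      using inj_on_image_Int[OF inj CS[OF AB(1)] CS[OF AB(2)]] AB by (simp add: disjnt_def)
  qed
  moreover have "h ` C homeomorphic (sphere 0 1 :: complex set)" if "C \<in> \<C>" for C
  proof (rule homeomorphic_trans[OF _ C(3)[OF that]])
    show "h ` C homeomorphic C"
      using homeomorphism_symD[OF sub[OF CS[OF that]]] unfolding homeomorphic_def by blast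
  qed
  moreover have "K' = \<Union> ((`) h ` \<C>)" using h(2) C(4) by blast
  moreover have "K' \<subseteq> S3" using image_mono[OF KS, of h] homeomorphism_image1[OF h(1)] h(2) by simp
  ultimately show ?thesis
    unfolding is_link_def using C(1) by (intro conjI exI[of _ "(`) h ` \<C>"]) auto
qed

section \<open>Vertices and edges of the Newton polyhedron\<close>

definition upward_hull :: "(real \<times> real) set \<Rightarrow> (real \<times> real) set" where
  "upward_hull A = convex hull {x + y | x y. x \<in> A \<and> 0 \<le> fst y \<and> 0 \<le> snd y}"

lemma newton_polyhedron_upward_hull: "newton_polyhedron f = upward_hull (supp f)"
  by (simp add: newton_polyhedron_def upward_hull_def)

lemma convex_upward_hull: "convex (upward_hull A)"
  by (simp add: upward_hull_def)

lemma subset_upward_hull: "A \<subseteq> upward_hull A"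
  unfolding upward_hull_def by (rule subset_trans[OF _ hull_subset]) (force intro: exI[of _ "0::real \<times> real"])

lemma upward_hull_ge:
  assumes "0 \<le> fst a" "0 \<le> snd a" "\<And>x. x \<in> A \<Longrightarrow> \<beta> \<le> a \<bullet> x" "z \<in> upward_hull A"
  shows "\<beta> \<le> a \<bullet> z"
proof -
  have "upward_hull A \<subseteq> {z. a \<bullet> z \<ge> \<beta>}"
    unfolding upward_hull_def
  proof (rule hull_minimal)
    show "{x + y | x y. x \<in> A \<and> 0 \<le> fst y \<and> 0 \<le> snd y} \<subseteq> {z. a \<bullet> z \<ge> \<beta>}"
    proof
      fix w assume "w \<in> {x + y | x y. x \<in> A \<and> 0 \<le> fst y \<and> 0 \<le> snd y}"
      then obtain x y where w: "w = x + y" and "x \<in> A" and y: "0 \<le> fst y" "0 \<le> snd y" by blast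
      have "0 \<le> a \<bullet> y" using assms(1,2) y by (cases a, cases y) simp
      then show "w \<in> {z. a \<bullet> z \<ge> \<beta>}" using assms(3)[OF \<open>x \<in> A\<close>] by (simp add: w inner_add_right)
    qed
  qed (rule convex_halfspace_ge)
  then show ?thesis using assms(4) by blast
qed

text \<open>The hull of a sum is the sum of the hulls, and the quadrant is convex. This form yields
  closedness, as a compact set plus a closed one, and stability under adding nonnegative
  vectors.\<close>

lemma upward_hull_set_plus: "upward_hull A = convex hull A + {y. 0 \<le> fst y \<and> 0 \<le> snd y}"
proof -
  have "{x + y | x y. x \<in> A \<and> 0 \<le> fst y \<and> 0 \<le> snd y} = A + {y. 0 \<le> fst y \<and> 0 \<le> snd y}"
    unfolding set_plus_def by blast
  moreover have "convex {y :: real \<times> real. 0 \<le> fst y \<and> 0 \<le> snd y}"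
    by (auto simp: convex_def)
  ultimately show ?thesis
    unfolding upward_hull_def by (simp add: convex_hull_set_plus hull_same)
qed

lemma closed_upward_hull:
  assumes "finite A"
  shows "closed (upward_hull A)"
proof -
  have "{y :: real \<times> real. 0 \<le> fst y \<and> 0 \<le> snd y} = {0..} \<times> {0..}" by auto
  then have "closed {y :: real \<times> real. 0 \<le> fst y \<and> 0 \<le> snd y}" by (simp add: closed_Times)
  from compact_closed_sums[OF finite_imp_compact_convex_hull[OF assms] this]
  have "closed (\<Union>x\<in>convex hull A. \<Union>y\<in>{y :: real \<times> real. 0 \<le> fst y \<and> 0 \<le> snd y}. {x + y})" .
  moreover have "(\<Union>x\<in>convex hull A. \<Union>y\<in>{y :: real \<times> real. 0 \<le> fst y \<and> 0 \<le> snd y}. {x + y}) = upward_hull A"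
    unfolding upward_hull_set_plus set_plus_def by blast
  ultimately show ?thesis by simp
qed

lemma upward_hull_add:
  assumes "x \<in> upward_hull A" "0 \<le> fst y" "0 \<le> snd y"
  shows "x + y \<in> upward_hull A"
proof -
  obtain h q where hq: "h \<in> convex hull A" "0 \<le> fst q" "0 \<le> snd q" "x = h + q"
    using assms(1) unfolding upward_hull_set_plus set_plus_def by blast
  have "h + (q + y) \<in> upward_hull A"
    unfolding upward_hull_set_plus by (rule set_plus_intro) (use hq assms in auto)
  then show ?thesis by (simp add: hq add.assoc)
qed

text \<open>A point \<open>x + y\<close> with \<open>y \<noteq> 0\<close> is the midpoint of
  \<open>x\<close> and \<open>x + 2 *\<^sub>R y\<close>, which both belong to the hull, so it is not
  extreme.\<close>

lemma extreme_point_upward_hull: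
  assumes "v extreme_point_of upward_hull A"
  shows "v \<in> A"
proof -
  obtain x y where xy: "v = x + y" "x \<in> A" "0 \<le> fst y" "0 \<le> snd y"
    using extreme_point_of_convex_hull[of v] assms unfolding upward_hull_def by blast
  have x: "x \<in> upward_hull A" using subset_upward_hull xy by blast
  have z: "x + 2 *\<^sub>R y \<in> upward_hull A" by (rule upward_hull_add[OF x]) (use xy in auto)
  show ?thesis
  proof (cases "y = 0")
    case False
    have "v = midpoint x (x + 2 *\<^sub>R y)" by (simp add: midpoint_def xy(1) scaleR_right_distrib scaleR_2[symmetric])
    moreover have "x \<noteq> x + 2 *\<^sub>R y" using False by simp
    ultimately have "v \<in> open_segment x (x + 2 *\<^sub>R y)" by (metis midpoint_in_open_segment)
    then show ?thesis using assms x z by (auto simp: extreme_point_of_def)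
  qed (use xy in auto)
qed

text \<open>Strictly positive weights bound both coordinates on the level set, so the face is
  compact and Krein-Milman recovers it from its extreme points, which lie in
  \<open>A\<close>.\<close>

lemma weight_face:
  assumes A: "finite A" and quadrant: "\<And>x. x \<in> A \<Longrightarrow> 0 \<le> fst x \<and> 0 \<le> snd x"
    and a: "0 < fst a" "0 < snd a" and \<beta>: "\<And>x. x \<in> A \<Longrightarrow> \<beta> \<le> a \<bullet> x"
  defines "F \<equiv> upward_hull A \<inter> {z. a \<bullet> z = \<beta>}"
  shows "F face_of upward_hull A" "compact F" "F = convex hull {x \<in> A. a \<bullet> x = \<beta>}"
proof -
  have ge: "\<beta> \<le> a \<bullet> z" if "z \<in> upward_hull A" for z
    by (rule upward_hull_ge[OF _ _ \<beta> that]) (use a in auto)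
  show face: "F face_of upward_hull A"
    unfolding F_def by (rule face_of_Int_supporting_hyperplane_ge[OF convex_upward_hull ge])
  have pos: "0 \<le> fst z" "0 \<le> snd z" if "z \<in> upward_hull A" for z
    using upward_hull_ge[of "(1, 0)" A 0 z] upward_hull_ge[of "(0, 1)" A 0 z] quadrant that
    by (cases z; force)+
  have "bounded F"
    unfolding bounded_iff
  proof (intro exI ballI)
    fix z assume z: "z \<in> F"
    then have p: "0 \<le> fst z" "0 \<le> snd z" and eq: "fst a * fst z + snd a * snd z = \<beta>"
      using pos by (auto simp: F_def inner_prod_def)
    have "fst a * fst z \<le> \<beta>" "snd a * snd z \<le> \<beta>"
      using eq mult_nonneg_nonneg[of "fst a" "fst z"] mult_nonneg_nonneg[of "snd a" "snd z"] p a by linarith+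
    then have "fst z \<le> \<beta> / fst a" "snd z \<le> \<beta> / snd a"
      using a by (simp_all add: field_simps)
    then show "norm z \<le> \<beta> / fst a + \<beta> / snd a"
      using norm_Pair_le[of "fst z" "snd z"] p by simp
  qed
  moreover have "closed F"
    unfolding F_def by (intro closed_Int closed_upward_hull A closed_hyperplane)
  ultimately show compact: "compact F" by (simp add: compact_eq_bounded_closed)
  have "convex F" using face by (rule face_of_imp_convex)
  then have KM: "F = convex hull {x. x extreme_point_of F}" by (rule Krein_Milman_Minkowski[OF compact])
  show "F = convex hull {x \<in> A. a \<bullet> x = \<beta>}"
  proof
    have "{x. x extreme_point_of F} \<subseteq> {x \<in> A. a \<bullet> x = \<beta>}"
    proof
      fix x assume "x \<in> {x. x extreme_point_of F}"
      then have "x extreme_point_of upward_hull A" "x \<in> F"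
        using extreme_point_of_face[OF face] by auto
      then show "x \<in> {x \<in> A. a \<bullet> x = \<beta>}" using extreme_point_upward_hull by (auto simp: F_def)
    qed
    then show "F \<subseteq> convex hull {x \<in> A. a \<bullet> x = \<beta>}" by (subst KM) (rule hull_mono)
    show "convex hull {x \<in> A. a \<bullet> x = \<beta>} \<subseteq> F"
      by (rule hull_minimal) (use subset_upward_hull \<open>convex F\<close> in \<open>auto simp: F_def\<close>)
  qed
qed

lemma upward_hull_not_compact:
  assumes "x \<in> upward_hull A"
  shows "\<not> compact (upward_hull A)"
proof
  assume "compact (upward_hull A)"
  then obtain B where B: "\<And>z. z \<in> upward_hull A \<Longrightarrow> norm z \<le> B"
    using compact_imp_bounded bounded_iff by metis
  have "x + (\<bar>B\<bar> + norm x + 1, 0) \<in> upward_hull A" by (rule upward_hull_add[OF assms]) auto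
  then have "norm (x + (\<bar>B\<bar> + norm x + 1, 0)) \<le> B" by (rule B)
  moreover have "norm (\<bar>B\<bar> + norm x + 1, 0::real) = \<bar>B\<bar> + norm x + 1" by (simp add: norm_Pair)
  ultimately show False
    using norm_triangle_ineq4[of "x + (\<bar>B\<bar> + norm x + 1, 0)" x] by simp
qed

text \<open>The vertex is separated from the hull of the remaining points. Since that hull is
  unbounded upwards, the normal has nonnegative entries, and a small tilt makes them
  positive.\<close>

lemma vertex_weight:
  assumes A: "finite A" and quadrant: "\<And>x. x \<in> A \<Longrightarrow> 0 \<le> fst x \<and> 0 \<le> snd x"
    and v: "v extreme_point_of upward_hull A"
  obtains a where "0 < fst a" "0 < snd a" "\<And>x. x \<in> A - {v} \<Longrightarrow> a \<bullet> v < a \<bullet> x"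
proof (cases "A - {v} = {}")
  case True
  then show ?thesis using that[of "(1, 1)"] by auto
next
  case False
  let ?C = "upward_hull (A - {v})"
  have "?C \<subseteq> upward_hull A" unfolding upward_hull_def by (rule hull_mono) auto
  moreover have "v \<notin> ?C"
  proof
    assume "v \<in> ?C"
    then have "v extreme_point_of ?C" using v \<open>?C \<subseteq> upward_hull A\<close> by (auto simp: extreme_point_of_def)
    then show False using extreme_point_upward_hull by blast
  qed
  ultimately obtain a b where ab: "a \<bullet> v < b" "\<And>x. x \<in> ?C \<Longrightarrow> b < a \<bullet> x"
    using separating_hyperplane_closed_point[OF convex_upward_hull closed_upward_hull[OF finite_Diff[OF A]]] by blast
  obtain t where t: "t \<in> ?C" using False subset_upward_hull[of "A - {v}"] by blast
  have nonneg: "0 \<le> a \<bullet> y" if y: "0 \<le> fst y" "0 \<le> snd y" for y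
  proof (rule ccontr)
    assume neg: "\<not> 0 \<le> a \<bullet> y"
    define n where "n = (\<bar>b\<bar> + \<bar>a \<bullet> t\<bar>) / - (a \<bullet> y)"
    have n: "n \<ge> 0" using neg by (simp add: n_def divide_nonneg_neg)
    have "b < a \<bullet> (t + n *\<^sub>R y)" by (intro ab upward_hull_add[OF t]) (use y n in auto)
    also have "\<dots> = a \<bullet> t + n * (a \<bullet> y)" by (simp add: inner_add_right)
    also have "n * (a \<bullet> y) = - (\<bar>b\<bar> + \<bar>a \<bullet> t\<bar>)" using neg by (simp add: n_def)
    finally show False by linarith
  qed
  have a0: "0 \<le> fst a" "0 \<le> snd a" using nonneg[of "(1, 0)"] nonneg[of "(0, 1)"] by (auto simp: inner_prod_def)
  \<comment> \<open>The tilt by \<open>\<eta>\<close> uses up at most the gap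
    \<open>b - a \<bullet> v\<close>; the added 1 keeps the denominator positive when
    \<open>v = 0\<close>.\<close>
  define \<eta> where "\<eta> = (b - a \<bullet> v) / (\<bar>fst v\<bar> + \<bar>snd v\<bar> + 1)"
  have \<eta>: "\<eta> > 0" "\<eta> * (fst v + snd v) \<le> b - a \<bullet> v"
  proof -
    show "\<eta> > 0" using ab(1) by (simp add: \<eta>_def divide_pos_pos)
    then have "\<eta> * (fst v + snd v) \<le> \<eta> * (\<bar>fst v\<bar> + \<bar>snd v\<bar> + 1)" by (intro mult_left_mono) auto
    also have "\<dots> = b - a \<bullet> v" by (simp add: \<eta>_def)
    finally show "\<eta> * (fst v + snd v) \<le> b - a \<bullet> v" .
  qed
  show ?thesis
  proof (rule that[of "a + (\<eta>, \<eta>)"])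
    fix x assume x: "x \<in> A - {v}"
    have "b < a \<bullet> x" by (rule ab(2)[OF subsetD[OF subset_upward_hull x]])
    moreover have "0 \<le> \<eta> * (fst x + snd x)" using quadrant[of x] x \<eta> by auto
    ultimately show "(a + (\<eta>, \<eta>)) \<bullet> v < (a + (\<eta>, \<eta>)) \<bullet> x"
      using \<eta>(2) by (simp add: inner_add_left inner_prod_def algebra_simps)
  qed (use a0 \<eta> in auto)
qed

text \<open>A compact face of an unbounded set is proper, so the midpoint of two extreme points of
  \<open>\<Delta>\<close> lies on the relative boundary of the hull; a supporting line there has to
  contain the edge.\<close>

lemma compact_edge_weight:
  assumes A: "finite A" and quadrant: "\<And>x. x \<in> A \<Longrightarrow> 0 \<le> fst x \<and> 0 \<le> snd x"
    and face: "\<Delta> face_of upward_hull A" "compact \<Delta>" "aff_dim \<Delta> = 1"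
  obtains a p q where "0 < fst a" "0 < snd a" "p \<in> A" "q \<in> A" "p \<noteq> q" "a \<bullet> p = a \<bullet> q"
    "\<And>x. x \<in> A \<Longrightarrow> a \<bullet> p \<le> a \<bullet> x" "\<Delta> = upward_hull A \<inter> {z. a \<bullet> z = a \<bullet> p}"
proof -
  have conv: "convex \<Delta>" using face(1) by (rule face_of_imp_convex)
  have KM: "\<Delta> = convex hull {x. x extreme_point_of \<Delta>}" by (rule Krein_Milman_Minkowski[OF face(2) conv])
  have E: "x extreme_point_of upward_hull A \<and> x \<in> \<Delta> \<and> x \<in> A" if "x extreme_point_of \<Delta>" for x
    using that extreme_point_of_face[OF face(1)] extreme_point_upward_hull by blast
  have "\<exists>p q. p extreme_point_of \<Delta> \<and> q extreme_point_of \<Delta> \<and> p \<noteq> q"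
  proof (rule ccontr)
    assume "\<not> ?thesis"
    then have "\<exists>c. {x. x extreme_point_of \<Delta>} \<subseteq> {c}" by blast
    then obtain c where "{x. x extreme_point_of \<Delta>} \<subseteq> {c}" by blast
    then have "\<Delta> \<subseteq> {c}" by (subst KM) (metis hull_mono convex_hull_singleton)
    then have "aff_dim \<Delta> \<le> aff_dim {c}" by (rule aff_dim_subset)
    then show False using face(3) by simp
  qed
  then obtain p q where pq: "p extreme_point_of \<Delta>" "q extreme_point_of \<Delta>" "p \<noteq> q" by blast
  let ?S = "upward_hull A"
  have S: "p \<in> ?S" "q \<in> ?S" "p \<in> \<Delta>" "q \<in> \<Delta>" "p \<in> A" "q \<in> A"
    using E pq subset_upward_hull by blast+
  define m where "m = midpoint p q"
  have m: "m \<in> \<Delta>" "m \<in> ?S"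
  proof -
    show "m \<in> \<Delta>" using closed_segment_subset[OF S(3,4) conv] midpoint_in_closed_segment[of p q] unfolding m_def by blast
    then show "m \<in> ?S" using face_of_imp_subset[OF face(1)] by blast
  qed
  have "\<Delta> \<noteq> ?S" using face(2) upward_hull_not_compact[OF S(1)] by auto
  then have "m \<notin> rel_interior ?S" using face_of_disjoint_rel_interior[OF face(1)] m by blast
  then obtain a where a: "a \<noteq> 0" "\<And>y. y \<in> ?S \<Longrightarrow> a \<bullet> m \<le> a \<bullet> y"
    using supporting_hyperplane_rel_boundary[OF convex_upward_hull m(2)] closure_subset by (metis subsetD)
  have nonneg: "0 \<le> a \<bullet> y" if "0 \<le> fst y" "0 \<le> snd y" for y
    using a(2)[OF upward_hull_add[OF m(2) that]] by (simp add: inner_add_right)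
  have a0: "0 \<le> fst a" "0 \<le> snd a" using nonneg[of "(1, 0)"] nonneg[of "(0, 1)"] by (auto simp: inner_prod_def)
  have "a \<bullet> m = (a \<bullet> p + a \<bullet> q) / 2" by (simp add: m_def midpoint_def inner_add_right)
  then have eq: "a \<bullet> p = a \<bullet> m" "a \<bullet> q = a \<bullet> m" using a(2)[OF S(1)] a(2)[OF S(2)] by auto
  \<comment> \<open>If one extreme point dominated another point of the hull, it could be moved
    further away from that point within the hull and would not be extreme. So \<open>p\<close> and
    \<open>q\<close> are incomparable, and the normal of a line through both has no zero
    entry.\<close>
  have not_above: False if "p' extreme_point_of \<Delta>" "q' \<in> ?S" "p' \<noteq> q'" "fst q' \<le> fst p'" "snd q' \<le> snd p'" for p' q'
  proof -
    have p': "p' \<in> ?S" "p' extreme_point_of ?S" using E[OF that(1)] subset_upward_hull by blast+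
    have "p' + (p' - q') \<in> ?S" by (rule upward_hull_add[OF p'(1)]) (use that in auto)
    moreover have "p' = midpoint q' (p' + (p' - q'))" by (simp add: midpoint_def scaleR_2[symmetric] flip: scaleR_right_distrib)
    moreover have "q' \<noteq> p' + (p' - q')"
    proof
      assume "q' = p' + (p' - q')"
      then have "2 *\<^sub>R q' = 2 *\<^sub>R p'" by (simp add: scaleR_2 algebra_simps)
      then show False using that(3) by simp
    qed
    ultimately have "p' \<in> open_segment q' (p' + (p' - q'))" by (metis midpoint_in_open_segment)
    then show False using p'(2) that(2) \<open>p' + (p' - q') \<in> ?S\<close> by (auto simp: extreme_point_of_def)
  qed
  have incomparable: "\<not> (fst q \<le> fst p \<and> snd q \<le> snd p)" "\<not> (fst p \<le> fst q \<and> snd p \<le> snd q)"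
    using not_above[OF pq(1) S(2)] not_above[OF pq(2) S(1)] pq(3) by auto
  have lin: "fst a * fst p + snd a * snd p = fst a * fst q + snd a * snd q"
    using eq by (simp add: inner_prod_def)
  have pos: "0 < fst a" "0 < snd a"
  proof -
    have "fst a \<noteq> 0"
    proof
      assume "fst a = 0"
      moreover from this have "snd a \<noteq> 0" using a(1) by (auto simp: prod_eq_iff)
      ultimately have "snd p = snd q" using lin by simp
      then show False using incomparable by auto
    qed
    moreover have "snd a \<noteq> 0"
    proof
      assume "snd a = 0"
      moreover from this have "fst a \<noteq> 0" using a(1) by (auto simp: prod_eq_iff)
      ultimately have "fst p = fst q" using lin by simp
      then show False using incomparable by auto
    qed
    ultimately show "0 < fst a" "0 < snd a" using a0 by auto
  qed
  have min: "a \<bullet> p \<le> a \<bullet> x" if "x \<in> A" for x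
    using a(2)[of x] eq(1) subsetD[OF subset_upward_hull that] by simp
  let ?F = "?S \<inter> {z. a \<bullet> z = a \<bullet> p}"
  have "affine hull {p, q} = affine hull \<Delta>"
  proof (rule affine_dim_equal)
    show "affine hull {p, q} \<subseteq> affine hull \<Delta>" using S by (intro hull_mono) auto
    show "aff_dim (affine hull {p, q}) = aff_dim (affine hull \<Delta>)" using face(3) pq(3) by (simp add: aff_dim_2)
  qed auto
  moreover have "affine hull {p, q} \<subseteq> {z. a \<bullet> z = a \<bullet> p}"
    by (rule hull_minimal) (use eq in \<open>auto simp: affine_hyperplane\<close>)
  ultimately have "\<Delta> \<subseteq> {z. a \<bullet> z = a \<bullet> p}" using hull_subset[of \<Delta> affine] by blast
  then have sub: "\<Delta> \<subseteq> ?F" using face_of_imp_subset[OF face(1)] by blast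
  \<comment> \<open>A proper face has strictly smaller dimension, but \<open>?F\<close> lies on a
    line and \<open>\<Delta>\<close> already has dimension 1.\<close>
  have "\<Delta> = ?F"
  proof (rule ccontr)
    assume "\<Delta> \<noteq> ?F"
    moreover have "\<Delta> face_of ?F" by (rule face_of_subset[OF face(1) sub]) auto
    moreover have "convex ?F" by (intro convex_Int convex_upward_hull convex_hyperplane)
    ultimately have "aff_dim \<Delta> < aff_dim ?F" using face_of_aff_dim_lt by blast
    also have "\<dots> \<le> aff_dim {z. a \<bullet> z = a \<bullet> p}" by (rule aff_dim_subset) auto
    also have "\<dots> = 1" using aff_dim_hyperplane[OF a(1), of "a \<bullet> p"] by simp
    finally show False using face(3) by simp
  qed
  then show ?thesis using that[OF pos S(5,6) pq(3) _ min] eq by simp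
qed

section \<open>Lattice exponents in place of real faces\<close>

definition emb :: "nat \<times> nat \<Rightarrow> real \<times> real" where
  "emb t = (real (fst t), real (snd t))"

definition exponents :: "mixed_function \<Rightarrow> (nat \<times> nat) set" where
  "exponents f = mono_deg ` Poly_Mapping.keys f"

definition minset :: "(nat \<times> nat) set \<Rightarrow> nat \<times> nat \<Rightarrow> (nat \<times> nat) set" where
  "minset T p = {t \<in> T. \<forall>t'\<in>T. wt p t \<le> wt p t'}"

text \<open>The weight may be any multiple of the primitive one, since weights built from
  differences of exponents are not normalised; \<open>is_edge_coprime\<close> passes to the
  primitive weight.\<close>

definition is_edge :: "(nat \<times> nat) set \<Rightarrow> nat \<times> nat \<Rightarrow> bool" where
  "is_edge T p \<longleftrightarrow> 0 < fst p \<and> 0 < snd p \<and> (\<exists>s q. s \<in> minset T p \<and> q \<in> minset T p \<and> s \<noteq> q)"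

lemma emb_eq_iff [simp]: "emb s = emb t \<longleftrightarrow> s = t"
  by (auto simp: emb_def prod_eq_iff)

lemma lattice_point_emb: "lattice_point m = emb (mono_deg m)"
  by (cases m) (auto simp: lattice_point_def emb_def mono_deg_def)

lemma supp_emb: "supp f = emb ` exponents f"
  by (auto simp: supp_def exponents_def lattice_point_emb image_image)

lemma finite_exponents [simp]: "finite (exponents f)"
  by (simp add: exponents_def)

lemma finite_supp: "finite (supp f)" and supp_quadrant: "x \<in> supp f \<Longrightarrow> 0 \<le> fst x \<and> 0 \<le> snd x"
  by (auto simp: supp_emb emb_def)

lemma weight_emb: "weight p (emb t) = real (wt p t)"
  by (simp add: weight_def emb_def wt_def)

lemma inner_emb: "a \<bullet> emb t = fst a * real (fst t) + snd a * real (snd t)"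
  by (cases a) (simp add: emb_def)

lemma weight_inner: "weight p z = (real (fst p), real (snd p)) \<bullet> z"
  by (cases z) (simp add: weight_def)

lemma vertex_of_iff_inner:
  "vertex_of T s \<longleftrightarrow> s \<in> T \<and> (\<exists>a. 0 < fst a \<and> 0 < snd a \<and> (\<forall>t\<in>T - {s}. a \<bullet> emb s < a \<bullet> emb t))"
proof -
  have "(\<exists>a::real \<times> real. 0 < fst a \<and> 0 < snd a \<and> (\<forall>t\<in>T - {s}. a \<bullet> emb s < a \<bullet> emb t)) \<longleftrightarrow>
    (\<exists>x>0. \<exists>y>0. \<forall>t\<in>T - {s}. x * real (fst s) + y * real (snd s) < x * real (fst t) + y * real (snd t))"
    unfolding inner_emb split_paired_Ex by auto
  then show ?thesis unfolding vertex_of_def by blast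
qed

lemma newton_vertex_imp_compact_face:
  assumes "vertex_of (exponents f) s"
  shows "{emb s} \<in> compact_faces 0 f"
proof -
  obtain a :: "real \<times> real" where s: "s \<in> exponents f" and a: "0 < fst a" "0 < snd a" "\<And>t. t \<in> exponents f - {s} \<Longrightarrow> a \<bullet> emb s < a \<bullet> emb t"
    using assms unfolding vertex_of_iff_inner by blast
  have min: "a \<bullet> emb s \<le> a \<bullet> x" if "x \<in> supp f" for x
    using that a(3) by (auto simp: supp_emb) (metis less_imp_le order_refl DiffI singletonD)
  note W = weight_face[OF finite_supp[of f] supp_quadrant[of _ f] a(1,2) min]
  have "{x \<in> supp f. a \<bullet> x = a \<bullet> emb s} = {emb s}"
    using s a(3) by (auto simp: supp_emb) (metis less_irrefl DiffI singletonD)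
  then have "upward_hull (supp f) \<inter> {z. a \<bullet> z = a \<bullet> emb s} = {emb s}"
    using W(3) by simp
  then show ?thesis using W(1) by (simp add: compact_faces_def newton_polyhedron_upward_hull)
qed

lemma compact_face_imp_newton_vertex:
  assumes "\<Delta> \<in> compact_faces 0 f"
  obtains s where "vertex_of (exponents f) s" "\<Delta> = {emb s}"
proof -
  obtain v where v: "\<Delta> = {v}" "{v} face_of upward_hull (supp f)"
    using assms by (auto simp: compact_faces_def aff_dim_eq_0 newton_polyhedron_upward_hull)
  then have ext: "v extreme_point_of upward_hull (supp f)" by (simp add: face_of_singleton)
  then obtain s where s: "v = emb s" "s \<in> exponents f"
    using extreme_point_upward_hull[OF ext] unfolding supp_emb by blast
  obtain a where a: "0 < fst a" "0 < snd a" "\<And>x. x \<in> supp f - {v} \<Longrightarrow> a \<bullet> v < a \<bullet> x"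
    using vertex_weight[OF finite_supp[of f] supp_quadrant[of _ f] ext] by metis
  have "vertex_of (exponents f) s"
    unfolding vertex_of_iff_inner
  proof (intro conjI exI ballI)
    show "a \<bullet> emb s < a \<bullet> emb t" if "t \<in> exponents f - {s}" for t
      using a(3)[of "emb t"] that s by (auto simp: supp_emb)
  qed (use s a in auto)
  then show ?thesis using that v s by blast
qed

lemma edge_imp_compact_face:
  assumes "is_edge (exponents f) p"
  obtains \<Delta> where "\<Delta> \<in> compact_faces 1 f" "\<And>t. t \<in> exponents f \<Longrightarrow> emb t \<in> \<Delta> \<longleftrightarrow> t \<in> minset (exponents f) p"
proof -
  obtain s q where p: "0 < fst p" "0 < snd p" and sq: "s \<in> minset (exponents f) p" "q \<in> minset (exponents f) p" "s \<noteq> q"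
    using assms by (auto simp: is_edge_def)
  define a where "a = (real (fst p), real (snd p))"
  have a: "0 < fst a" "0 < snd a" using p by (auto simp: a_def)
  have a_emb: "a \<bullet> emb t = real (wt p t)" for t
    using weight_emb weight_inner unfolding a_def by metis
  have min: "a \<bullet> emb s \<le> a \<bullet> x" if "x \<in> supp f" for x
    using that sq(1) by (auto simp: supp_emb minset_def a_emb)
  note W = weight_face[OF finite_supp[of f] supp_quadrant[of _ f] a min]
  define \<Delta> where "\<Delta> = upward_hull (supp f) \<inter> {z. a \<bullet> z = a \<bullet> emb s}"
  have mem: "emb t \<in> \<Delta> \<longleftrightarrow> t \<in> minset (exponents f) p" if "t \<in> exponents f" for t
  proof -
    have "emb t \<in> upward_hull (supp f)" using that subset_upward_hull[of "supp f"] by (auto simp: supp_emb)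
    then have "emb t \<in> \<Delta> \<longleftrightarrow> wt p t = wt p s" by (simp add: \<Delta>_def a_emb)
    also have "\<dots> \<longleftrightarrow> t \<in> minset (exponents f) p"
      using sq(1) that by (fastforce simp: minset_def)
    finally show ?thesis .
  qed
  have "aff_dim \<Delta> = 1"
  proof (rule antisym)
    have "a \<noteq> 0" using a(1) by auto
    have "aff_dim \<Delta> \<le> aff_dim {z. a \<bullet> z = a \<bullet> emb s}" by (rule aff_dim_subset) (auto simp: \<Delta>_def)
    then show "aff_dim \<Delta> \<le> 1" using aff_dim_hyperplane[OF \<open>a \<noteq> 0\<close>] by simp
    have "aff_dim {emb s, emb q} \<le> aff_dim \<Delta>"
      by (rule aff_dim_subset) (use mem sq in \<open>auto simp: minset_def\<close>)
    then show "1 \<le> aff_dim \<Delta>" using sq(3) by simp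
  qed
  then have "\<Delta> \<in> compact_faces 1 f"
    using W(1,2) by (simp add: compact_faces_def newton_polyhedron_upward_hull \<Delta>_def)
  then show ?thesis using that mem by blast
qed

text \<open>The real normal vector of a compact edge is proportional to an integral one, formed from
  the coordinate differences of two exponents on the edge and divided by their gcd. The last clause
  concerns all real points of the edge, not only its exponents.\<close>

lemma compact_face_imp_edge:
  assumes "\<Delta> \<in> compact_faces 1 f"
  obtains p where "is_edge (exponents f) p" "coprime (fst p) (snd p)"
    "\<And>t. t \<in> exponents f \<Longrightarrow> emb t \<in> \<Delta> \<longleftrightarrow> t \<in> minset (exponents f) p"
    "\<And>z t. z \<in> \<Delta> \<Longrightarrow> t \<in> exponents f \<Longrightarrow> weight p z \<le> weight p (emb t)"
proof -
  have \<Delta>: "\<Delta> face_of upward_hull (supp f)" "compact \<Delta>" "aff_dim \<Delta> = 1"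
    using assms by (auto simp: compact_faces_def newton_polyhedron_upward_hull)
  obtain a x y where a: "0 < fst a" "0 < snd a" and xy: "x \<in> supp f" "y \<in> supp f" "x \<noteq> y" "a \<bullet> x = a \<bullet> y"
    "\<And>z. z \<in> supp f \<Longrightarrow> a \<bullet> x \<le> a \<bullet> z" and eq: "\<Delta> = upward_hull (supp f) \<inter> {z. a \<bullet> z = a \<bullet> x}"
    by (rule compact_edge_weight[OF finite_supp[of f] supp_quadrant[of _ f] \<Delta>]) (assumption, rule that)
  obtain s t where st: "x = emb s" "y = emb t" "s \<in> exponents f" "t \<in> exponents f" "s \<noteq> t"
    using xy(1,2,3) by (auto simp: supp_emb)
  have lin: "fst a * real (fst s) + snd a * real (snd s) = fst a * real (fst t) + snd a * real (snd t)"
    using xy(4) by (simp add: st inner_emb)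
  have "\<exists>P. 0 < fst P \<and> 0 < snd P \<and> fst a * real (snd P) = snd a * real (fst P)"
  proof -
    have *: "\<exists>P. 0 < fst P \<and> 0 < snd P \<and> fst a * real (snd P) = snd a * real (fst P)"
      if lt: "fst s < fst t" and lin: "fst a * real (fst s) + snd a * real (snd s) = fst a * real (fst t) + snd a * real (snd t)"
      for s t :: "nat \<times> nat"
    proof -
      have "fst a * real (fst s) < fst a * real (fst t)" using lt a by simp
      then have "snd a * real (snd t) < snd a * real (snd s)" using lin by linarith
      then have lt2: "snd t < snd s" using a by simp
      have "fst a * real (fst t - fst s) = snd a * real (snd s - snd t)"
        using lin lt lt2 by (simp add: of_nat_diff right_diff_distrib)
      then show ?thesis using lt lt2 by (intro exI[of _ "(snd s - snd t, fst t - fst s)"]) auto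
    qed
    have "fst s \<noteq> fst t"
    proof
      assume "fst s = fst t"
      then have "snd s = snd t" using lin a by simp
      then show False using st(5) \<open>fst s = fst t\<close> by (simp add: prod_eq_iff)
    qed
    then show ?thesis using *[of s t] *[of t s] lin by (cases "fst s < fst t") auto
  qed
  then obtain P where P: "0 < fst P" "0 < snd P" "fst a * real (snd P) = snd a * real (fst P)" by blast
  define g where "g = gcd (fst P) (snd P)"
  obtain p1 p2 where p12: "fst P = p1 * g" "snd P = p2 * g" "coprime p1 p2"
    using gcd_coprime_exists[of "fst P" "snd P"] P unfolding g_def by auto
  have g: "g > 0" "fst P = p1 * g" "snd P = p2 * g" using p12 P by (auto intro: gr0I)
  have pos: "p1 > 0" "p2 > 0" using g P by (metis mult_0 gr0I)+
  have "real g * (fst a * real p2) = real g * (snd a * real p1)" using P(3) unfolding g(2,3) by (simp add: algebra_simps)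
  then have ap: "fst a * real p2 = snd a * real p1" using g(1) by simp
  define \<mu> where "\<mu> = fst a / real p1"
  have \<mu>: "\<mu> > 0" using a pos by (simp add: \<mu>_def)
  have a\<mu>: "fst a = \<mu> * real p1" "snd a = \<mu> * real p2"
    using ap pos by (auto simp: \<mu>_def field_simps)
  have aw: "a \<bullet> z = \<mu> * weight (p1, p2) z" for z
    by (cases a, cases z) (use a\<mu> in \<open>simp add: weight_def algebra_simps\<close>)
  have a_le: "a \<bullet> z \<le> a \<bullet> z' \<longleftrightarrow> weight (p1, p2) z \<le> weight (p1, p2) z'" for z z'
    using \<mu> by (simp add: aw)
  have min: "wt (p1, p2) s \<le> wt (p1, p2) u" if "u \<in> exponents f" for u
    using xy(5)[of "emb u"] that unfolding a_le st weight_emb by (simp add: supp_emb)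
  have minset: "u \<in> minset (exponents f) (p1, p2) \<longleftrightarrow> a \<bullet> emb u = a \<bullet> x" if "u \<in> exponents f" for u
  proof -
    have "a \<bullet> emb u = a \<bullet> x \<longleftrightarrow> wt (p1, p2) u = wt (p1, p2) s"
      using \<mu> by (simp add: aw st weight_emb)
    then show ?thesis using min st(3) that by (fastforce simp: minset_def)
  qed
  show ?thesis
  proof (rule that[of "(p1, p2)"])
    show "is_edge (exponents f) (p1, p2)"
      unfolding is_edge_def
    proof (intro conjI exI)
      show "s \<in> minset (exponents f) (p1, p2)" "t \<in> minset (exponents f) (p1, p2)" "s \<noteq> t"
        using minset[OF st(3)] minset[OF st(4)] st(5) xy(4) by (simp_all add: st)
    qed (use pos in simp_all)
    show "coprime (fst (p1, p2)) (snd (p1, p2))" using p12 by simp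
    show "emb u \<in> \<Delta> \<longleftrightarrow> u \<in> minset (exponents f) (p1, p2)" if "u \<in> exponents f" for u
    proof -
      have "emb u \<in> upward_hull (supp f)" using that subset_upward_hull[of "supp f"] by (auto simp: supp_emb)
      then show ?thesis using minset[OF that] by (simp add: eq)
    qed
    show "weight (p1, p2) z \<le> weight (p1, p2) (emb u)" if "z \<in> \<Delta>" "u \<in> exponents f" for z u
      using that xy(5)[of "emb u"] unfolding a_le[symmetric] by (simp add: eq supp_emb)
  qed
qed

section \<open>Face polynomials and edge weights\<close>

lemma lookup_restrict_terms:
  "Poly_Mapping.lookup (restrict_terms X f) m = (if lattice_point m \<in> X then Poly_Mapping.lookup f m else 0)"
  unfolding restrict_terms_def by (auto simp: mapp.rep_eq when_def in_keys_iff)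

lemma argmin_supp:
  assumes "t \<in> exponents f"
  shows "emb t \<in> {x. is_arg_min (weight p) (\<lambda>y. y \<in> supp f) x} \<longleftrightarrow> t \<in> minset (exponents f) p"
  using assms by (auto simp: is_arg_min_def supp_emb weight_emb minset_def not_less)

lemma restrict_terms_cong:
  assumes "\<And>t. t \<in> exponents f \<Longrightarrow> emb t \<in> X \<longleftrightarrow> emb t \<in> Y"
  shows "restrict_terms X f = restrict_terms Y f"
proof (rule poly_mapping_eqI)
  fix m
  show "Poly_Mapping.lookup (restrict_terms X f) m = Poly_Mapping.lookup (restrict_terms Y f) m"
  proof (cases "m \<in> Poly_Mapping.keys f")
    case True
    then show ?thesis using assms[of "mono_deg m"] by (simp add: lookup_restrict_terms lattice_point_emb exponents_def)
  qed (simp add: lookup_restrict_terms in_keys_iff)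
qed

text \<open>For the inclusion from left to right: equality of the two polynomials makes every
  exponent on \<open>\<Delta>\<close> minimal for \<open>p\<close>. There are at least two of them,
  so \<open>p\<close> itself defines an edge.\<close>

lemma edge_weights_eq: "edge_weights f = {p. is_edge (exponents f) p \<and> coprime (fst p) (snd p)}"
proof (intro set_eqI iffI)
  fix p assume "p \<in> {p. is_edge (exponents f) p \<and> coprime (fst p) (snd p)}"
  then have p: "is_edge (exponents f) p" "coprime (fst p) (snd p)" by auto
  obtain \<Delta> where \<Delta>: "\<Delta> \<in> compact_faces 1 f" "\<And>t. t \<in> exponents f \<Longrightarrow> emb t \<in> \<Delta> \<longleftrightarrow> t \<in> minset (exponents f) p"
    using edge_imp_compact_face[OF p(1)] by blast
  have "weight_part p f = restrict_terms \<Delta> f"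
    unfolding weight_part_def using argmin_supp \<Delta>(2) by (intro restrict_terms_cong) blast
  then show "p \<in> edge_weights f" using p \<Delta>(1) by (auto simp: edge_weights_def is_edge_def)
next
  fix p assume "p \<in> edge_weights f"
  then obtain \<Delta> where p: "0 < fst p" "0 < snd p" "coprime (fst p) (snd p)" and
    \<Delta>: "\<Delta> \<in> compact_faces 1 f" "weight_part p f = restrict_terms \<Delta> f"
    by (auto simp: edge_weights_def)
  obtain p' where p': "is_edge (exponents f) p'" "\<And>t. t \<in> exponents f \<Longrightarrow> emb t \<in> \<Delta> \<longleftrightarrow> t \<in> minset (exponents f) p'"
    using compact_face_imp_edge[OF \<Delta>(1)] by metis
  have sub: "t \<in> minset (exponents f) p" if t: "t \<in> minset (exponents f) p'" for t
  proof -
    have te: "t \<in> exponents f" using t by (simp add: minset_def)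
    then obtain m where m: "t = mono_deg m" "m \<in> Poly_Mapping.keys f" by (auto simp: exponents_def)
    have "Poly_Mapping.lookup (restrict_terms \<Delta> f) m \<noteq> 0"
      using p'(2)[OF te] t m by (auto simp: lookup_restrict_terms lattice_point_emb in_keys_iff)
    then have "emb t \<in> {x. is_arg_min (weight p) (\<lambda>y. y \<in> supp f) x}"
      unfolding \<Delta>(2)[symmetric] weight_part_def lookup_restrict_terms lattice_point_emb m(1)
      by (auto split: if_splits)
    then show ?thesis using argmin_supp[OF te] by blast
  qed
  show "p \<in> {p. is_edge (exponents f) p \<and> coprime (fst p) (snd p)}"
  proof -
    have "\<exists>s q. s \<in> minset (exponents f) p \<and> q \<in> minset (exponents f) p \<and> s \<noteq> q"
      using p'(1) sub unfolding is_edge_def by blast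
    then show ?thesis using p by (simp add: is_edge_def)
  qed
qed

lemma is_edge_coprime:
  assumes "is_edge T p"
  obtains p' where "is_edge T p'" "coprime (fst p') (snd p')" "minset T p' = minset T p"
proof -
  have p: "0 < fst p" "0 < snd p" using assms by (auto simp: is_edge_def)
  define g where "g = gcd (fst p) (snd p)"
  obtain p1 p2 where p12: "fst p = p1 * g" "snd p = p2 * g" "coprime p1 p2"
    using gcd_coprime_exists[of "fst p" "snd p"] p unfolding g_def by auto
  have g: "g > 0" using p by (simp add: g_def)
  have "wt p t = g * wt (p1, p2) t" for t by (simp add: wt_def p12 algebra_simps)
  then have "minset T (p1, p2) = minset T p" using g by (simp add: minset_def)
  moreover have "0 < p1" "0 < p2" using p p12 by (metis mult_0 gr0I)+
  ultimately show ?thesis using that[of "(p1, p2)"] assms p12 by (auto simp: is_edge_def)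
qed

lemma mixed_eval_ev:
  assumes "finite K" "Poly_Mapping.keys g \<subseteq> K"
  shows "mixed_eval g = ev K (Poly_Mapping.lookup g)"
proof
  fix z
  have "mixed_eval g z = (\<Sum>m\<in>Poly_Mapping.keys g. Poly_Mapping.lookup g m * mono_eval m z)"
    by (cases z) (auto simp: mixed_eval_def mono_eval_def mult.assoc intro!: sum.cong)
  also have "\<dots> = ev K (Poly_Mapping.lookup g) z"
    unfolding ev_def by (rule sum.mono_neutral_left[OF assms]) (auto simp: in_keys_iff)
  finally show "mixed_eval g z = ev K (Poly_Mapping.lookup g) z" .
qed

text \<open>The derivative is a real linear map into a plane, so rank below 2 means that it is not
  onto.\<close>

lemma critical_set_iff:
  assumes "finite K" "Poly_Mapping.keys g \<subseteq> K"
  shows "z \<in> critical_set g \<longleftrightarrow> \<not> surj (dev K (Poly_Mapping.lookup g) z)"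
proof -
  let ?D = "dev K (Poly_Mapping.lookup g) z"
  have "frechet_derivative (mixed_eval g) (at z) = ?D"
    unfolding mixed_eval_ev[OF assms] by (rule frechet_derivative_at[symmetric, OF has_derivative_ev])
  moreover have "dim (range ?D) < 2 \<longleftrightarrow> \<not> surj ?D"
  proof -
    have "dim (range ?D) \<le> 2" using dim_subset_UNIV[of "range ?D"] by simp
    then have "dim (range ?D) < 2 \<longleftrightarrow> dim (range ?D) \<noteq> 2" by linarith
    moreover have "dim (range ?D) = 2 \<longleftrightarrow> span (range ?D) = UNIV"
      using dim_eq_full[of "range ?D"] by simp
    moreover have "span (range ?D) = range ?D"
      using linear_subspace_image[OF linear_dev subspace_UNIV, of K "Poly_Mapping.lookup g" z] by (simp add: span_eq_iff)
    ultimately show ?thesis by simp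
  qed
  ultimately show ?thesis by (simp add: critical_set_def)
qed

lemma
  assumes K: "finite K" "Poly_Mapping.keys f \<subseteq> K" and X: "\<And>t. t \<in> exponents f \<Longrightarrow> emb t \<in> X \<longleftrightarrow> t \<in> M"
  shows mixed_eval_restrict: "mixed_eval (restrict_terms X f) = ev K (part M (Poly_Mapping.lookup f))"
    and regular_on_restrict: "zero_set (restrict_terms X f) \<inter> critical_set (restrict_terms X f) \<inter> A = {} \<longleftrightarrow>
      regular_on K (part M (Poly_Mapping.lookup f)) A"
proof -
  have l: "Poly_Mapping.lookup (restrict_terms X f) = part M (Poly_Mapping.lookup f)"
  proof
    fix m
    show "Poly_Mapping.lookup (restrict_terms X f) m = part M (Poly_Mapping.lookup f) m"
    proof (cases "m \<in> Poly_Mapping.keys f")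
      case True
      then show ?thesis using X[of "mono_deg m"] by (simp add: lookup_restrict_terms lattice_point_emb exponents_def part_def)
    qed (simp add: lookup_restrict_terms part_def in_keys_iff)
  qed
  have k: "Poly_Mapping.keys (restrict_terms X f) \<subseteq> K"
    using K(2) by (auto simp: in_keys_iff lookup_restrict_terms split: if_splits)
  show e: "mixed_eval (restrict_terms X f) = ev K (part M (Poly_Mapping.lookup f))"
    using mixed_eval_ev[OF K(1) k] by (simp add: l)
  show "zero_set (restrict_terms X f) \<inter> critical_set (restrict_terms X f) \<inter> A = {} \<longleftrightarrow>
      regular_on K (part M (Poly_Mapping.lookup f)) A"
    using critical_set_iff[OF K(1) k] unfolding l zero_set_def e regular_on_def by blast
qed

section \<open>The end vertices\<close>

text \<open>The lexicographic minimum is the end of the Newton boundary in the leftmost column. The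
  other end is treated as the left vertex of the swapped set.\<close>

definition left_vertex :: "(nat \<times> nat) set \<Rightarrow> nat \<times> nat \<Rightarrow> bool" where
  "left_vertex T l \<longleftrightarrow> l \<in> T \<and> (\<forall>t\<in>T. fst l < fst t \<or> fst l = fst t \<and> snd l \<le> snd t)"

lemma left_vertex_exists:
  assumes "finite T" "T \<noteq> {}"
  obtains l where "left_vertex T l"
proof -
  define i where "i = Min (fst ` T)"
  have i: "i \<in> fst ` T" "\<And>t. t \<in> T \<Longrightarrow> i \<le> fst t"
    using assms by (auto simp: i_def)
  define J where "J = snd ` {t \<in> T. fst t = i}"
  have J: "finite J" "J \<noteq> {}" using assms i(1) by (auto simp: J_def)
  define j where "j = Min J"
  have j: "j \<in> J" unfolding j_def by (rule Min_in[OF J])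
  have j_le: "j \<le> snd t" if "t \<in> T" "fst t = i" for t
    unfolding j_def by (rule Min_le[OF J(1)]) (use that in \<open>simp add: J_def\<close>)
  have "(i, j) \<in> T" using j by (auto simp: J_def)
  then have "left_vertex T (i, j)"
    unfolding left_vertex_def using i(2) j_le by (auto simp: le_less)
  then show ?thesis using that by blast
qed

lemma left_vertex_unique_column:
  assumes "left_vertex T l" "vertex_of T s" "\<And>t. t \<in> T \<Longrightarrow> fst s \<le> fst t"
  shows "s = l"
proof (rule ccontr)
  assume ne: "s \<noteq> l"
  obtain x y :: real where xy: "x > 0" "y > 0" "\<forall>t\<in>T - {s}. x * real (fst s) + y * real (snd s) < x * real (fst t) + y * real (snd t)"
    and s: "s \<in> T"
    using assms(2) unfolding vertex_of_def by blast
  have l: "l \<in> T - {s}" using assms(1) ne by (auto simp: left_vertex_def)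
  have "fst s = fst l" "snd l \<le> snd s"
    using assms(1) assms(3)[of l] s l by (fastforce simp: left_vertex_def)+
  then show False using bspec[OF xy(3) l] xy(2) by simp
qed

lemma left_vertex_imp_vertex:
  assumes "left_vertex T l"
  shows "vertex_of T l"
  unfolding vertex_of_def
proof (intro conjI exI ballI)
  show "l \<in> T" using assms by (simp add: left_vertex_def)
  \<comment> \<open>With this weight, one step to the right costs more than can be gained by
    descending from \<open>snd l\<close> to 0.\<close>
  show "0 < real (snd l) + 1" "0 < (1::real)" by auto
  fix t assume t: "t \<in> T - {l}"
  then have "fst l < fst t \<or> fst l = fst t \<and> snd l \<le> snd t" using assms by (auto simp: left_vertex_def)
  then show "(real (snd l) + 1) * real (fst l) + 1 * real (snd l) < (real (snd l) + 1) * real (fst t) + 1 * real (snd t)"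
  proof
    assume "fst l < fst t"
    then have "(real (snd l) + 1) * (real (fst l) + 1) \<le> (real (snd l) + 1) * real (fst t)"
      by (intro mult_left_mono) auto
    then show ?thesis by (simp add: algebra_simps)
  next
    assume "fst l = fst t \<and> snd l \<le> snd t"
    moreover from this have "snd l \<noteq> snd t" using t by (auto simp: prod_eq_iff)
    ultimately show ?thesis by simp
  qed
qed

text \<open>Among the exponents below \<open>l\<close>, one of steepest descent spans an edge
  together with \<open>l\<close>. The exponent \<open>t\<close> excludes the case in which the
  boundary is a single vertex.\<close>

lemma edge_through_left_vertex:
  assumes T: "finite T" and l: "left_vertex T l" and t: "t \<in> T" "snd t < snd l"
  obtains p where "is_edge T p" "l \<in> minset T p"
proof -
  define R where "R = {t \<in> T. snd t < snd l}"
  have R: "finite R" "R \<noteq> {}" using T t unfolding R_def by (simp, blast)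
  define slope where "slope = (\<lambda>t. (real (snd l) - real (snd t)) / (real (fst t) - real (fst l)))"
  have lt: "fst l < fst t" if "t \<in> R" for t
    using l that by (auto simp: left_vertex_def R_def)
  have "Max (slope ` R) \<in> slope ` R" using R by (intro Max_in) auto
  then obtain q where q: "q \<in> R" "slope q = Max (slope ` R)" by auto
  have max: "slope t \<le> slope q" if "t \<in> R" for t using R q that by simp
  define p where "p = (snd l - snd q, fst q - fst l)"
  have pos: "0 < fst p" "0 < snd p" using q(1) lt[OF q(1)] by (auto simp: p_def R_def)
  have min: "wt p l \<le> wt p t" if "t \<in> T" for t
  proof (cases "t \<in> R")
    case True
    have "(real (snd l) - real (snd t)) * (real (fst q) - real (fst l)) \<le> (real (snd l) - real (snd q)) * (real (fst t) - real (fst l))"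
      using max[OF True] lt[OF True] lt[OF q(1)] by (simp add: slope_def divide_simps)
    moreover have fp: "real (fst p) = real (snd l) - real (snd q)" "real (snd p) = real (fst q) - real (fst l)"
      using lt[OF q(1)] q(1) by (simp_all add: p_def R_def of_nat_diff)
    ultimately have "real (wt p l) \<le> real (wt p t)"
      unfolding wt_def of_nat_add of_nat_mult fp by (simp add: algebra_simps)
    then show ?thesis by simp
  next
    case False
    then have "fst l \<le> fst t" "snd l \<le> snd t" using l that by (auto simp: R_def left_vertex_def)
    then show ?thesis by (auto simp: wt_def intro!: add_mono)
  qed
  have "wt p q = wt p l"
  proof -
    obtain x y where "fst q = fst l + x" "snd l = snd q + y"
      using lt[OF q(1)] q(1) less_imp_add_positive by (metis (mono_tags, lifting) R_def mem_Collect_eq)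
    then show ?thesis by (simp add: p_def wt_def algebra_simps)
  qed
  then have "l \<in> minset T p" "q \<in> minset T p"
    using min l q(1) by (auto simp: minset_def R_def left_vertex_def)
  moreover have "l \<noteq> q" using q(1) by (auto simp: R_def)
  ultimately show ?thesis using that[of p] pos unfolding is_edge_def by blast
qed

lemma edge_lower_right:
  assumes "left_vertex T l" "is_edge T p"
  obtains B where "B \<in> minset T p" "fst l < fst B" "snd B < snd l"
proof -
  obtain A B where p: "0 < fst p" "0 < snd p" and AB: "A \<in> minset T p" "B \<in> minset T p" "A \<noteq> B"
    using assms(2) by (auto simp: is_edge_def)
  have eq: "wt p A = wt p B" using AB by (auto simp: minset_def intro: antisym)
  have "\<exists>B\<in>minset T p. fst l < fst B"
  proof -
    have "fst A \<noteq> fst B" using eq AB(3) p by (auto simp: wt_def prod_eq_iff)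
    moreover have "fst l \<le> fst A" "fst l \<le> fst B" using AB assms(1) by (auto simp: left_vertex_def minset_def less_imp_le)
    ultimately have "fst l < fst A \<or> fst l < fst B" by linarith
    then show ?thesis using AB by blast
  qed
  then obtain B where B: "B \<in> minset T p" "fst l < fst B" by blast
  have "wt p B \<le> wt p l" using B assms(1) by (auto simp: minset_def left_vertex_def)
  then have "fst p * fst B + snd p * snd B \<le> fst p * fst l + snd p * snd l" by (simp add: wt_def)
  moreover have "fst p * fst l < fst p * fst B" using p B by simp
  ultimately have "snd p * snd B < snd p * snd l" by linarith
  then have "snd B < snd l" by simp
  then show ?thesis using that B by blast
qed

text \<open>This is convexity: for a lower right point \<open>B\<close> of the other edge, the slope
  \<open>y / x\<close> of the segment from \<open>l\<close> to \<open>B\<close> lies between the two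
  weight ratios. If the ratios agree, \<open>l\<close> and \<open>B\<close> have the same weight, so
  \<open>l\<close> lies on the other edge as well.\<close>

lemma edge_at_left_vertex_maximal:
  assumes l: "left_vertex T l" and p: "is_edge T p" "l \<in> minset T p" and p': "is_edge T p'"
  shows "fst p' * snd p \<le> fst p * snd p'"
    and "fst p * snd p' \<le> fst p' * snd p \<Longrightarrow> l \<in> minset T p'"
proof -
  obtain B where B: "B \<in> minset T p'" "fst l < fst B" "snd B < snd l" using edge_lower_right[OF l p'] .
  have BT: "B \<in> T" "l \<in> T" using B(1) l by (auto simp: minset_def left_vertex_def)
  have pos: "0 < snd p" "0 < snd p'" using p(1) p' by (auto simp: is_edge_def)
  define x y where "x = fst B - fst l" and "y = snd l - snd B"
  have xy: "fst B = fst l + x" "snd l = snd B + y" "x > 0" using B by (auto simp: x_def y_def)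
  have 1: "fst p' * x \<le> snd p' * y"
    using B(1) BT(2) xy by (auto simp: minset_def wt_def algebra_simps)
  have 2: "snd p * y \<le> fst p * x"
    using p(2) BT(1) xy by (auto simp: minset_def wt_def algebra_simps)
  have "(fst p' * snd p) * x = snd p * (fst p' * x)" by simp
  also have "\<dots> \<le> snd p * (snd p' * y)" using 1 by (rule mult_le_mono2)
  also have "\<dots> = snd p' * (snd p * y)" by simp
  also have "\<dots> \<le> snd p' * (fst p * x)" using 2 by (rule mult_le_mono2)
  also have "\<dots> = (fst p * snd p') * x" by simp
  finally have "(fst p' * snd p) * x \<le> (fst p * snd p') * x" .
  then show "fst p' * snd p \<le> fst p * snd p'" using xy(3) by simp
  assume "fst p * snd p' \<le> fst p' * snd p"
  then have 3: "(fst p * snd p') * x \<le> (fst p' * snd p) * x" by (rule mult_le_mono1)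
  have "snd p * (snd p' * y) = snd p' * (snd p * y)" by simp
  also have "\<dots> \<le> snd p' * (fst p * x)" using 2 by (rule mult_le_mono2)
  also have "\<dots> = (fst p * snd p') * x" by simp
  also note 3
  also have "(fst p' * snd p) * x = snd p * (fst p' * x)" by simp
  finally have "snd p * (snd p' * y) \<le> snd p * (fst p' * x)" .
  then have "snd p' * y \<le> fst p' * x" using pos by simp
  then have "wt p' l \<le> wt p' B" using xy by (simp add: wt_def algebra_simps)
  then show "l \<in> minset T p'" using B(1) BT(2) by (auto simp: minset_def intro: order_trans)
qed

lemma minset_swap: "minset (prod.swap ` T) (prod.swap p) = prod.swap ` minset T p"
proof -
  have "wt (prod.swap p) (prod.swap t) = wt p t" for t by (simp add: wt_def)
  then show ?thesis by (auto simp: minset_def image_iff)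
qed

lemma is_edge_swap: "is_edge (prod.swap ` T) (prod.swap p) \<longleftrightarrow> is_edge T p"
proof -
  have "is_edge (prod.swap ` T) (prod.swap p)" if e: "is_edge T p" for T p
  proof -
    obtain s q where "0 < fst p" "0 < snd p" "s \<in> minset T p" "q \<in> minset T p" "s \<noteq> q"
      using e unfolding is_edge_def by blast
    note e = this
    show ?thesis
      unfolding is_edge_def minset_swap
    proof (intro conjI exI)
      show "prod.swap s \<in> prod.swap ` minset T p" "prod.swap q \<in> prod.swap ` minset T p"
        using e by (auto intro: imageI simp del: swap_simp)
      show "prod.swap s \<noteq> prod.swap q" using e(5) by (metis swap_swap)
    qed (use e in auto)
  qed
  from this[of T p] this[of "prod.swap ` T" "prod.swap p"] show ?thesis
    by (auto simp: image_image)
qed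

text \<open>The weight ratio is the steepness of the edge, which by convexity is largest at the left
  end. So the first condition of inner non-degeneracy concerns the edge that ends at the left
  vertex.\<close>

lemma first_weight_left_vertex:
  assumes l: "left_vertex (exponents f) l"
  shows "is_first_weight f P \<longleftrightarrow> is_edge (exponents f) P \<and> coprime (fst P) (snd P) \<and> l \<in> minset (exponents f) P"
proof -
  let ?L = "exponents f"
  have ratio: "weight_ratio P \<le> weight_ratio Q \<longleftrightarrow> fst P * snd Q \<le> fst Q * snd P" if "is_edge ?L P" "is_edge ?L Q" for P Q
  proof -
    have "0 < snd P" "0 < snd Q" using that by (auto simp: is_edge_def)
    then have "weight_ratio P \<le> weight_ratio Q \<longleftrightarrow> real (fst P) * real (snd Q) \<le> real (fst Q) * real (snd P)"
      by (simp add: weight_ratio_def divide_simps mult.commute)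
    then show ?thesis by (metis of_nat_le_iff of_nat_mult)
  qed
  have first: "is_first_weight f P \<longleftrightarrow> is_edge ?L P \<and> coprime (fst P) (snd P) \<and>
     (\<forall>Q. is_edge ?L Q \<longrightarrow> coprime (fst Q) (snd Q) \<longrightarrow> weight_ratio Q \<le> weight_ratio P)"
    unfolding is_first_weight_def is_arg_max_def edge_weights_eq by (auto simp: not_less)
  show ?thesis
  proof (cases "is_edge ?L P")
    case True
    obtain B where B: "B \<in> minset ?L P" "snd B < snd l" using edge_lower_right[OF l True] .
    then have "B \<in> ?L" by (simp add: minset_def)
    then obtain p0 where "is_edge ?L p0" "l \<in> minset ?L p0" using edge_through_left_vertex[OF finite_exponents l _ B(2)] by blast
    then obtain p where p: "is_edge ?L p" "coprime (fst p) (snd p)" "l \<in> minset ?L p" by (metis is_edge_coprime)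
    show ?thesis
    proof
      assume "is_first_weight f P"
      then have P: "coprime (fst P) (snd P)" "weight_ratio p \<le> weight_ratio P" using p unfolding first by blast+
      then show "is_edge ?L P \<and> coprime (fst P) (snd P) \<and> l \<in> minset ?L P"
        using True edge_at_left_vertex_maximal(2)[OF l p(1,3) True] ratio[OF p(1) True] by auto
    next
      assume "is_edge ?L P \<and> coprime (fst P) (snd P) \<and> l \<in> minset ?L P"
      then show "is_first_weight f P"
        unfolding first using edge_at_left_vertex_maximal(1)[OF l, of P] ratio by auto
    qed
  qed (use first in auto)
qed

text \<open>Exchanging the coordinates inverts the weight ratio, so the smallest ratio corresponds
  to the left end of the swapped set.\<close>

lemma last_weight_left_vertex:
  assumes l: "left_vertex (prod.swap ` exponents f) l"
  shows "is_last_weight f P \<longleftrightarrow>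
    is_edge (exponents f) P \<and> coprime (fst P) (snd P) \<and> l \<in> minset (prod.swap ` exponents f) (prod.swap P)"
proof -
  let ?L = "exponents f" and ?R = "prod.swap ` exponents f"
  have ratio: "weight_ratio Q \<le> weight_ratio P \<longleftrightarrow> fst Q * snd P \<le> fst P * snd Q" if "is_edge ?L P" "is_edge ?L Q" for P Q
  proof -
    have "0 < snd P" "0 < snd Q" using that by (auto simp: is_edge_def)
    then have "weight_ratio Q \<le> weight_ratio P \<longleftrightarrow> real (fst Q) * real (snd P) \<le> real (fst P) * real (snd Q)"
      by (simp add: weight_ratio_def divide_simps mult.commute)
    then show ?thesis by (metis of_nat_le_iff of_nat_mult)
  qed
  have last: "is_last_weight f P \<longleftrightarrow> is_edge ?L P \<and> coprime (fst P) (snd P) \<and>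
     (\<forall>Q. is_edge ?L Q \<longrightarrow> coprime (fst Q) (snd Q) \<longrightarrow> weight_ratio P \<le> weight_ratio Q)"
    unfolding is_last_weight_def is_arg_min_def edge_weights_eq by (auto simp: not_less)
  show ?thesis
  proof (cases "is_edge ?L P")
    case True
    then have TR: "is_edge ?R (prod.swap P)" by (simp add: is_edge_swap)
    obtain B where B: "B \<in> minset ?R (prod.swap P)" "snd B < snd l" using edge_lower_right[OF l TR] .
    then have "B \<in> ?R" by (simp add: minset_def)
    then obtain p0 where "is_edge ?R p0" "l \<in> minset ?R p0"
      using edge_through_left_vertex[OF _ l _ B(2)] finite_imageI[OF finite_exponents] by blast
    then obtain p where p: "is_edge ?R p" "coprime (fst p) (snd p)" "l \<in> minset ?R p" by (metis is_edge_coprime)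
    have p': "is_edge ?L (prod.swap p)" using p(1) is_edge_swap[of ?L "prod.swap p"] by simp
    show ?thesis
    proof
      assume "is_last_weight f P"
      then have P: "coprime (fst P) (snd P)" "weight_ratio P \<le> weight_ratio (prod.swap p)"
        using p' p(2) unfolding last by (auto simp: coprime_commute simp del: split_paired_All)
      then show "is_edge ?L P \<and> coprime (fst P) (snd P) \<and> l \<in> minset ?R (prod.swap P)"
        using True edge_at_left_vertex_maximal(2)[OF l p(1,3) TR] ratio[OF p' True] by (auto simp: mult.commute)
    next
      assume P: "is_edge ?L P \<and> coprime (fst P) (snd P) \<and> l \<in> minset ?R (prod.swap P)"
      have "weight_ratio P \<le> weight_ratio Q" if Q: "is_edge ?L Q" for Q
        using edge_at_left_vertex_maximal(1)[OF l TR _ is_edge_swap[THEN iffD2, OF Q]] P ratio[OF Q True]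
        by (auto simp: mult.commute)
      then show "is_last_weight f P" unfolding last using P by blast
    qed
  qed (use last in auto)
qed

section \<open>Values and derivatives on the axis \<open>u = 0\<close>\<close>

lemma mono_eval_column_0:
  "fst (mono_deg m) = 0 \<Longrightarrow> mono_eval m (u, v) = mono_eval m (u', v)"
  by (cases m) (auto simp: mono_deg_def mono_eval_def)

lemma mono_deriv_column_0:
  "fst (mono_deg m) = 0 \<Longrightarrow> mono_deriv m (u, v) (x, y) = mono_deriv m (u', v) (x', y)"
  by (cases m) (auto simp: mono_deg_def mono_deriv_def)

lemma mono_eval_axis: "fst (mono_deg m) > 0 \<Longrightarrow> mono_eval m (0, v) = 0"
  by (cases m) (auto simp: mono_deg_def mono_eval_def)

lemma mono_deriv_column_1:
  "fst (mono_deg m) = 1 \<Longrightarrow> mono_deriv m (0, v) (x, y) = mono_eval m (x, v)"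
  by (cases m) (auto simp: mono_deg_def mono_eval_def mono_deriv_def add_is_1)

lemma mono_deriv_column_2:
  assumes "fst (mono_deg m) \<ge> 2"
  shows "mono_deriv m (0, v) (x, y) = 0"
proof -
  obtain a b c d where m: "m = (a, b, c, d)" by (cases m) auto
  have "a + b \<ge> 2" using assms by (simp add: m mono_deg_def)
  then have "a = 0 \<and> b \<ge> 2 \<or> a = 1 \<and> b \<ge> 1 \<or> a \<ge> 2" by linarith
  then show ?thesis by (auto simp: m mono_deriv_def power_0_left)
qed

lemma ev_part_on_axis:
  "ev K (part M c) (0, v) = ev K (part {t \<in> M. fst t = 0} c) (u, v)"
  unfolding ev_def
proof (rule sum.cong[OF refl])
  fix m
  show "part M c m * mono_eval m (0, v) = part {t \<in> M. fst t = 0} c m * mono_eval m (u, v)"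
    using mono_eval_column_0[of m 0 v u] mono_eval_axis[of m v] by (auto simp: part_def)
qed

text \<open>Column 0 contributes the derivative in \<open>v\<close>, column 1 the derivative in
  \<open>u\<close>, and higher columns vanish to second order. The point \<open>u\<close> and the
  direction \<open>x'\<close> on the right are free because column 0 does not involve the first
  variable; this freedom allows evaluation in the torus.\<close>

lemma dev_part_on_axis:
  "dev K (part M c) (0, v) (x, y) =
     ev K (part {t \<in> M. fst t = 1} c) (x, v) + dev K (part {t \<in> M. fst t = 0} c) (u, v) (x', y)"
  unfolding ev_def dev_def sum.distrib[symmetric]
proof (rule sum.cong[OF refl])
  fix m
  consider "fst (mono_deg m) = 0" | "fst (mono_deg m) = 1" | "fst (mono_deg m) \<ge> 2" by linarith
  then show "part M c m * mono_deriv m (0, v) (x, y) = part {t \<in> M. fst t = 1} c m * mono_eval m (x, v) +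
      part {t \<in> M. fst t = 0} c m * mono_deriv m (u, v) (x', y)"
  proof cases
    case 1
    then show ?thesis using mono_deriv_column_0[OF 1, of 0 v x y u x'] by (simp add: part_def)
  next
    case 2
    then show ?thesis using mono_deriv_column_1[OF 2] by (simp add: part_def)
  next
    case 3
    then show ?thesis using mono_deriv_column_2[OF 3] by (simp add: part_def)
  qed
qed

lemma ev_column_1_0: "ev K (part {t \<in> M. fst t = 1} c) (0, v) = 0"
  unfolding ev_def by (rule sum.neutral) (auto simp: part_def mono_eval_axis)

lemma ev_part_zero_set: "ev K (part {} c) z = 0" and dev_part_zero_set: "dev K (part {} c) z w = 0"
  by (auto simp: ev_def dev_def part_def)

text \<open>On the axis both the value and the derivative in \<open>v\<close> come from the single
  exponent \<open>l\<close> in column 0, so regularity of its polynomial at \<open>(1, v)\<close>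
  yields regularity at \<open>(0, v)\<close>.\<close>

lemma regular_beyond_axis:
  assumes M: "{t \<in> M. fst t = 0} = {l}" and l: "regular_on K (part {l} c) torus" and reg: "regular_on K (part M c) torus"
  shows "regular_on K (part M c) {z. snd z \<noteq> 0}"
  unfolding regular_on_def
proof (intro ballI impI)
  fix z assume z: "z \<in> {z. snd z \<noteq> 0}" "ev K (part M c) z = 0"
  obtain u v where uv: "z = (u, v)" "v \<noteq> 0" using z(1) by (cases z) auto
  show "surj (dev K (part M c) z)"
  proof (cases "u = 0")
    case False
    then have "z \<in> torus" using uv by (simp add: torus_def)
    then show ?thesis using reg z(2) unfolding regular_on_def by blast
  next
    case True
    have "ev K (part {l} c) (1, v) = 0"
      using z(2) ev_part_on_axis[of K M c v 1] by (simp add: uv True M)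
    moreover have "(1, v) \<in> torus" using uv by (simp add: torus_def)
    ultimately have surj: "surj (dev K (part {l} c) (1, v))" using l unfolding regular_on_def by blast
    show ?thesis
      unfolding surj_def
    proof
      fix w
      obtain x' y where "w = dev K (part {l} c) (1, v) (x', y)" using surj unfolding surj_def by (metis prod.collapse)
      then have "w = dev K (part M c) (0, v) (0, y)"
        unfolding dev_part_on_axis[of K M c v 0 y 1 x'] by (simp add: M ev_column_1_0[simplified])
      then show "\<exists>p. w = dev K (part M c) z p" unfolding uv True by blast
    qed
  qed
qed

lemma minset_column:
  assumes "l \<in> minset T p" "0 < snd p"
  shows "{t \<in> minset T p. fst t = fst l} = {l}"
proof -
  have "t = l" if t: "t \<in> minset T p" "fst t = fst l" for t
  proof -
    have "wt p t = wt p l" using t assms(1) by (auto simp: minset_def intro: antisym)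
    then show ?thesis using t(2) assms(2) by (simp add: wt_def prod_eq_iff)
  qed
  then show ?thesis using assms(1) by auto
qed

lemma surj_dev_swap: "surj (dev (swap_mono ` K) (c \<circ> swap_mono) (prod.swap z)) \<longleftrightarrow> surj (dev K c z)"
proof -
  have "dev (swap_mono ` K) (c \<circ> swap_mono) (prod.swap z) = dev K c z \<circ> prod.swap"
    using dev_swap[of K c z "prod.swap w" for w] by (simp add: fun_eq_iff del: split_paired_All)
  moreover have "surj (g \<circ> prod.swap) \<longleftrightarrow> surj g" for g :: "complex \<times> complex \<Rightarrow> complex"
    unfolding surj_def comp_def by (metis swap_swap)
  ultimately show ?thesis by simp
qed

lemma regular_on_swap:
  "regular_on (swap_mono ` K) (c \<circ> swap_mono) (prod.swap ` A) \<longleftrightarrow> regular_on K c A"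
  unfolding regular_on_def ball_simps(9) ev_swap surj_dev_swap ..

lemma swap_torus: "prod.swap ` torus = torus"
proof (intro set_eqI iffI)
  fix z assume "z \<in> torus"
  then have "prod.swap z \<in> torus" by (auto simp: torus_def)
  then show "z \<in> prod.swap ` torus" by (metis image_eqI swap_swap)
qed (auto simp: torus_def)

lemma swap_upper: "prod.swap ` {z :: complex \<times> complex. fst z \<noteq> 0} = {z. snd z \<noteq> 0}"
proof (intro set_eqI iffI)
  fix z :: "complex \<times> complex" assume "z \<in> {z. snd z \<noteq> 0}"
  then have "prod.swap z \<in> {z. fst z \<noteq> 0}" by simp
  then show "z \<in> prod.swap ` {z. fst z \<noteq> 0}" by (metis image_eqI swap_swap)
qed auto

lemma part_swap_image: "part (prod.swap ` S) (c \<circ> swap_mono) = part S c \<circ> swap_mono"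
  by (simp add: part_swap image_image)

lemma compact_face_regular:
  assumes "finite K" "Poly_Mapping.keys f \<subseteq> K"
    and "\<And>t. t \<in> exponents f \<Longrightarrow> emb t \<in> \<Delta> \<longleftrightarrow> t \<in> M"
    and "zero_set (restrict_terms \<Delta> f) \<inter> critical_set (restrict_terms \<Delta> f) \<inter> A = {}"
  shows "regular_on K (part M (Poly_Mapping.lookup f)) A"
  using regular_on_restrict[OF assms(1-3)] assms(4) by blast

lemma mem_upper: "{(u, v). v \<noteq> 0} = {z :: complex \<times> complex. snd z \<noteq> 0}" "{(u, v). u \<noteq> 0} = {z :: complex \<times> complex. fst z \<noteq> 0}"
  by auto

lemma weight_part_regular:
  assumes "finite K" "Poly_Mapping.keys f \<subseteq> K"
  shows "zero_set (weight_part p f) \<inter> critical_set (weight_part p f) \<inter> A = {} \<longleftrightarrow>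
    regular_on K (part (minset (exponents f) p) (Poly_Mapping.lookup f)) A"
  unfolding weight_part_def by (rule regular_on_restrict[OF assms]) (rule argmin_supp)

text \<open>If no exponent lies on an axis, then all of them, and hence the whole polyhedron, have
  distance at least 1 from it.\<close>

lemma newton_boundary_exponent_0:
  assumes "x \<in> newton_boundary f"
  shows "snd x = 0 \<Longrightarrow> \<exists>a. (a, 0) \<in> exponents f" "fst x = 0 \<Longrightarrow> \<exists>b. (0, b) \<in> exponents f"
proof -
  have x: "x \<in> upward_hull (supp f)"
    using assms by (auto simp: newton_boundary_def compact_faces_def newton_polyhedron_upward_hull dest: face_of_imp_subset)
  show "\<exists>a. (a, 0) \<in> exponents f" if "snd x = 0"
  proof (rule ccontr)
    assume no: "\<not> ?thesis"
    have "1 \<le> (0, 1) \<bullet> z" if z: "z \<in> supp f" for z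
    proof -
      obtain t where t: "z = emb t" "t \<in> exponents f" using z unfolding supp_emb by blast
      then have "snd t \<noteq> 0" using no by (metis prod.collapse)
      then show ?thesis by (simp add: t inner_emb)
    qed
    then have "1 \<le> (0, 1) \<bullet> x" by (rule upward_hull_ge[OF _ _ _ x, rotated 2]) auto
    then show False using that by (cases x) simp
  qed
  show "\<exists>b. (0, b) \<in> exponents f" if "fst x = 0"
  proof (rule ccontr)
    assume no: "\<not> ?thesis"
    have "1 \<le> (1, 0) \<bullet> z" if z: "z \<in> supp f" for z
    proof -
      obtain t where t: "z = emb t" "t \<in> exponents f" using z unfolding supp_emb by blast
      then have "fst t \<noteq> 0" using no by (metis prod.collapse)
      then show ?thesis by (simp add: t inner_emb)
    qed
    then have "1 \<le> (1, 0) \<bullet> x" by (rule upward_hull_ge[OF _ _ _ x, rotated 2]) auto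
    then show False using that by (cases x) simp
  qed
qed

lemma exponent_0_iff: "(0, 0) \<in> exponents f \<longleftrightarrow> mixed_eval f 0 \<noteq> 0"
proof -
  have zero: "mono_eval m 0 = (if m = (0, 0, 0, 0) then 1 else 0)" for m
    by (cases m) (auto simp: mono_eval_def zero_prod_def)
  have "mixed_eval f 0 = (\<Sum>m\<in>Poly_Mapping.keys f. if m = (0, 0, 0, 0) then Poly_Mapping.lookup f m else 0)"
    unfolding mixed_eval_ev[OF finite_keys order_refl] ev_def zero by (rule sum.cong) auto
  also have "\<dots> = Poly_Mapping.lookup f (0, 0, 0, 0)"
    by (simp add: sum.delta in_keys_iff)
  finally have "mixed_eval f 0 = Poly_Mapping.lookup f (0, 0, 0, 0)" .
  moreover have "(0, 0) \<in> exponents f \<longleftrightarrow> (0, 0, 0, 0) \<in> Poly_Mapping.keys f"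
    by (force simp: exponents_def mono_deg_def)
  ultimately show ?thesis by (simp add: in_keys_iff)
qed

theorem convenient_newton_nondegenerate_imp_inner_nondegenerate:
  assumes f0: "mixed_eval f 0 = 0" and conv: "convenient f" and nd: "newton_nondegenerate f"
  shows "inner_nondegenerate f"
proof -
  let ?K = "Poly_Mapping.keys f" and ?c = "Poly_Mapping.lookup f" and ?L = "exponents f"
  have edge: "regular_on ?K (part (minset ?L p) ?c) torus" if p: "is_edge ?L p" for p
  proof -
    obtain \<Delta> where \<Delta>: "\<Delta> \<in> compact_faces 1 f" "\<And>t. t \<in> ?L \<Longrightarrow> emb t \<in> \<Delta> \<longleftrightarrow> t \<in> minset ?L p"
      by (rule edge_imp_compact_face[OF p]) (rule that)
    show ?thesis
      by (rule compact_face_regular[OF _ order_refl \<Delta>(2)]) (use nd \<Delta>(1) in \<open>auto simp: newton_nondegenerate_def\<close>)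
  qed
  have vertex: "regular_on ?K (part {s} ?c) torus" if s: "vertex_of ?L s" for s
    by (rule compact_face_regular[where \<Delta> = "{emb s}"])
      (use nd newton_vertex_imp_compact_face[OF s] in \<open>auto simp: newton_nondegenerate_def\<close>)
  obtain a b where ab: "(a, 0) \<in> ?L" "(0, b) \<in> ?L"
    using conv newton_boundary_exponent_0 unfolding convenient_def by (metis fst_conv snd_conv)
  have no0: "(0, 0) \<notin> ?L" using exponent_0_iff f0 by blast
  have fin: "finite ?L" "?L \<noteq> {}" using ab by auto
  obtain l where l: "left_vertex ?L l" using left_vertex_exists[OF fin] .
  have "finite (prod.swap ` ?L)" "prod.swap ` ?L \<noteq> {}" using fin by auto
  then obtain r where r: "left_vertex (prod.swap ` ?L) r" using left_vertex_exists by blast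
  have l0: "fst l = 0" using l ab(2) by (fastforce simp: left_vertex_def)
  have "(0, a) \<in> prod.swap ` ?L" using ab(1) by force
  then have r0: "fst r = 0" using r by (fastforce simp: left_vertex_def)
  have first: "regular_on ?K (part (minset ?L P) ?c) {z. snd z \<noteq> 0}" if P: "is_first_weight f P" for P
  proof -
    have P': "is_edge ?L P" "l \<in> minset ?L P" using P first_weight_left_vertex[OF l] by auto
    then have "{t \<in> minset ?L P. fst t = 0} = {l}"
      using minset_column[OF P'(2)] l0 by (simp add: is_edge_def)
    then show ?thesis by (rule regular_beyond_axis[OF _ vertex[OF left_vertex_imp_vertex[OF l]] edge[OF P'(1)]])
  qed
  have last: "regular_on ?K (part (minset ?L P) ?c) {z. fst z \<noteq> 0}" if P: "is_last_weight f P" for P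
  proof -
    have P': "is_edge ?L P" "r \<in> minset (prod.swap ` ?L) (prod.swap P)" using P last_weight_left_vertex[OF r] by auto
    have col: "{t \<in> prod.swap ` minset ?L P. fst t = 0} = {r}"
      using minset_column[OF P'(2)] r0 P'(1) unfolding minset_swap by (simp add: is_edge_def)
    have rv: "vertex_of ?L (prod.swap r)"
      using left_vertex_imp_vertex[OF r] vertex_of_swap[of ?L "prod.swap r"] by simp
    have "regular_on (swap_mono ` ?K) (part (prod.swap ` minset ?L P) (?c \<circ> swap_mono)) {z. snd z \<noteq> 0}"
    proof (rule regular_beyond_axis[OF col])
      show "regular_on (swap_mono ` ?K) (part {r} (?c \<circ> swap_mono)) torus"
        using vertex[OF rv] regular_on_swap[of ?K "part {prod.swap r} ?c" torus] part_swap_image[of "{prod.swap r}" ?c]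
        by (simp add: swap_torus)
      show "regular_on (swap_mono ` ?K) (part (prod.swap ` minset ?L P) (?c \<circ> swap_mono)) torus"
        using edge[OF P'(1)] regular_on_swap[of ?K "part (minset ?L P) ?c" torus]
        by (simp add: part_swap_image swap_torus)
    qed
    then show ?thesis
      using regular_on_swap[of ?K "part (minset ?L P) ?c" "{z. fst z \<noteq> 0}"] by (simp add: part_swap_image swap_upper)
  qed
  \<comment> \<open>A single boundary vertex on both axes would be the exponent
    \<open>(0, 0)\<close>, which \<open>f0\<close> excludes.\<close>
  have single: False if \<Delta>: "\<Delta> \<in> compact_faces 0 f" "newton_boundary f = \<Delta>" for \<Delta>
  proof -
    obtain s where s: "vertex_of ?L s" "\<Delta> = {emb s}" using compact_face_imp_newton_vertex[OF \<Delta>(1)] .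
    obtain x y where "(x, 0) = emb s" "(0, y) = emb s" using conv \<Delta>(2) s(2) by (auto simp: convenient_def)
    then have "s = (0, 0)" by (auto simp: emb_def prod_eq_iff)
    then show False using s(1) no0 by (simp add: vertex_of_def)
  qed
  show ?thesis
    unfolding inner_nondegenerate_def
  proof (intro conjI impI allI ballI)
    fix P assume "is_first_weight f P"
    then show "zero_set (weight_part P f) \<inter> critical_set (weight_part P f) \<inter> {(u, v). v \<noteq> 0} = {}"
      unfolding weight_part_regular[OF finite_keys order_refl] mem_upper by (rule first)
  next
    fix P assume "is_last_weight f P"
    then show "zero_set (weight_part P f) \<inter> critical_set (weight_part P f) \<inter> {(u, v). u \<noteq> 0} = {}"
      unfolding weight_part_regular[OF finite_keys order_refl] mem_upper by (rule last)
  next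
    fix \<Delta> assume "\<Delta> \<in> compact_faces 1 f \<union> non_extreme_vertices f"
    then have "\<Delta> \<in> compact_faces 0 f \<union> compact_faces 1 f" by (auto simp: non_extreme_vertices_def)
    then show "zero_set (restrict_terms \<Delta> f) \<inter> critical_set (restrict_terms \<Delta> f) \<inter> torus = {}"
      using nd by (simp add: newton_nondegenerate_def)
  next
    fix \<Delta> assume "\<Delta> \<in> compact_faces 0 f" "newton_boundary f = \<Delta>"
    then show "zero_set (restrict_terms \<Delta> f) \<inter> critical_set (restrict_terms \<Delta> f) \<subseteq> {(0, 0)}"
      using single by blast
  qed
qed

section \<open>New exponents on the axes\<close>

lemma linear_dev_fst: "linear (\<lambda>x. dev K c z (x, 0))"
proof -
  have "linear (\<lambda>x::complex. (x, 0::complex))" by (auto simp: linear_iff)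
  from linear_compose[OF this linear_dev] show ?thesis by (simp add: o_def)
qed

lemma linear_dev_snd: "linear (\<lambda>y. dev K c z (0, y))"
proof -
  have "linear (\<lambda>y::complex. (0::complex, y))" by (auto simp: linear_iff)
  from linear_compose[OF this linear_dev] show ?thesis by (simp add: o_def)
qed

text \<open>If every exponent had column at least 2, the value and the derivative would both vanish
  along the axis \<open>u = 0\<close>, against regularity at \<open>(0, 1)\<close>.\<close>

lemma left_end_column_le_1:
  assumes l: "left_vertex L l" "M \<subseteq> L" and reg: "regular_on K (part M c) {z. snd z \<noteq> 0}"
  shows "fst l \<le> 1"
proof (rule ccontr)
  assume "\<not> fst l \<le> 1"
  then have "fst t \<ge> 2" if "t \<in> M" for t
    using l that by (fastforce simp: left_vertex_def)
  then have M: "{t \<in> M. fst t = 0} = {}" "{t \<in> M. fst t = 1} = {}" by fastforce+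
  have "ev K (part M c) (0, 1) = 0"
    using ev_part_on_axis[of K M c 1 0] unfolding M ev_part_zero_set .
  then have "surj (dev K (part M c) (0, 1))" using reg by (auto simp: regular_on_def)
  then obtain w where "1 = dev K (part M c) (0, 1) w" unfolding surj_def by blast
  moreover have "dev K (part M c) (0, 1) w = 0" for w
  proof -
    obtain x y where w: "w = (x, y)" by (cases w)
    show ?thesis
      using dev_part_on_axis[of K M c 1 x y 0 0] unfolding w M ev_part_zero_set dev_part_zero_set by simp
  qed
  ultimately show False by simp
qed

text \<open>On the axis the derivative of the face part is the polynomial of \<open>l\<close>, which
  is real linear in its first argument. Being onto the plane it is injective, so an end vertex in
  column 1 is automatically zero-free on the torus.\<close>

lemma left_end_column_1:
  assumes l: "left_vertex L l" "fst l = 1" and M: "M \<subseteq> L" "{t \<in> M. fst t = fst l} = {l}"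
    and reg: "regular_on K (part M c) {z. snd z \<noteq> 0}"
  shows "\<forall>z\<in>torus. ev K (part {l} c) z \<noteq> 0" "regular_on K (part {l} c) {z. snd z \<noteq> 0}"
proof -
  have M0: "{t \<in> M. fst t = 0} = {}" using l M(1) by (fastforce simp: left_vertex_def)
  have M1: "{t \<in> M. fst t = 1} = {l}" using M(2) l(2) by simp
  have l0: "{t \<in> {l}. fst t = 0} = {}" and l1: "{t \<in> {l}. fst t = 1} = {l}" using l(2) by auto
  have dev: "dev K (part M c) (0, v) (x, y) = ev K (part {l} c) (x, v)" for v x y
    using dev_part_on_axis[of K M c v x y 0 0] unfolding M0 M1 dev_part_zero_set by simp
  have dev': "dev K (part {l} c) (0, v) (x, y) = ev K (part {l} c) (x, v)" for v x y
    using dev_part_on_axis[of K "{l}" c v x y 0 0] unfolding l0 l1 dev_part_zero_set by simp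
  have surj: "surj (\<lambda>x. ev K (part {l} c) (x, v))" if "v \<noteq> 0" for v
  proof -
    have "ev K (part M c) (0, v) = 0"
      using ev_part_on_axis[of K M c v 0] unfolding M0 ev_part_zero_set .
    then have "surj (dev K (part M c) (0, v))" using reg that by (auto simp: regular_on_def)
    then show ?thesis unfolding surj_def by (metis dev prod.collapse)
  qed
  have nonzero: "ev K (part {l} c) (u, v) \<noteq> 0" if "u \<noteq> 0" "v \<noteq> 0" for u v
  proof -
    have lin: "linear (\<lambda>x. ev K (part {l} c) (x, v))"
      using linear_dev_fst[of K "part {l} c" "(0, v)"] by (simp add: dev')
    have "inj (\<lambda>x. ev K (part {l} c) (x, v))"
      using linear_surjective_imp_injective[OF lin surj[OF that(2)]] by simp
    then show ?thesis using that(1) linear_0[OF lin] by (metis injD)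
  qed
  then show "\<forall>z\<in>torus. ev K (part {l} c) z \<noteq> 0" by (auto simp: torus_def)
  show "regular_on K (part {l} c) {z. snd z \<noteq> 0}"
    unfolding regular_on_def
  proof (intro ballI impI)
    fix z assume z: "z \<in> {z. snd z \<noteq> 0}" "ev K (part {l} c) z = 0"
    obtain u v where uv: "z = (u, v)" "v \<noteq> 0" using z(1) by (cases z) auto
    then have "u = 0" using nonzero z(2) by blast
    then show "surj (dev K (part {l} c) z)"
      using surj[OF uv(2)] unfolding surj_def uv by (metis dev')
  qed
qed

text \<open>Without an exponent in column 1, surjectivity at a zero on the axis would come from the
  derivative in \<open>v\<close> alone, a real linear map of the plane. But by homogeneity the
  radial direction \<open>v\<close> lies in its kernel.\<close>

lemma left_end_column_0:
  assumes M: "{t \<in> M. fst t = 0} = {(0, n)}"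
    and reg: "regular_on K (part M c) {z. snd z \<noteq> 0}"
    and zero: "z \<in> torus" "ev K (part {(0, n)} c) z = 0"
  shows "\<exists>t\<in>M. fst t = 1"
proof (rule ccontr)
  assume "\<not> ?thesis"
  then have M1: "{t \<in> M. fst t = 1} = {}" by auto
  obtain u v where z: "z = (u, v)" "v \<noteq> 0" using zero(1) by (auto simp: torus_def)
  let ?g = "part {(0, n)} c"
  have dev: "dev K (part M c) (0, v) (x, y) = dev K ?g (1, v) (0, y)" for x y
    using dev_part_on_axis[of K M c v x y 1 0] unfolding M M1 ev_part_zero_set by simp
  have "ev K (part M c) (0, v) = 0"
    using ev_part_on_axis[of K M c v u] zero(2) unfolding M z(1) by simp
  then have surj: "surj (dev K (part M c) (0, v))" using reg z by (auto simp: regular_on_def)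
  note lin = linear_dev_snd[of K ?g "(1, v)"]
  have "surj (\<lambda>y. dev K ?g (1, v) (0, y))"
    using surj unfolding surj_def by (metis dev prod.collapse)
  then have inj: "inj (\<lambda>y. dev K ?g (1, v) (0, y))" using linear_surjective_imp_injective[OF lin] by simp
  have "dev K ?g (1, v) (0, v) = 0"
  proof -
    have "mono_deriv m (1, v) (0, v) = of_nat n * mono_eval m (1, v)" if "mono_deg m = (0, n)" for m
      using mono_deriv_euler[of m 1 v 0 1] that by simp
    then have "dev K ?g (1, v) (0, v) = of_nat n * ev K ?g (1, v)"
      unfolding dev_def ev_def sum_distrib_left by (intro sum.cong) (auto simp: part_def)
    also have "ev K ?g (1, v) = ev K ?g (u, v)" by (rule ev_part_axis)
    finally show ?thesis using zero(2) z(1) by simp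
  qed
  then show False using inj z(2) linear_0[OF lin] by (metis injD)
qed

lemma mono_deriv_linear:
  assumes "fst (mono_deg m) + snd (mono_deg m) = 1"
  shows "mono_deriv m z w = mono_eval m w"
proof -
  obtain a b c d where m: "m = (a, b, c, d)" by (cases m) auto
  have "a + b + (c + d) = 1" using assms by (simp add: m mono_deg_def)
  then have "m = (1, 0, 0, 0) \<or> m = (0, 1, 0, 0) \<or> m = (0, 0, 1, 0) \<or> m = (0, 0, 0, 1)"
    unfolding m by auto
  then show ?thesis by (cases z, cases w) (auto simp: mono_deriv_def mono_eval_def)
qed

lemma mono_deriv_origin:
  assumes "fst (mono_deg m) + snd (mono_deg m) \<noteq> 1"
  shows "mono_deriv m 0 w = 0"
proof -
  obtain a b c d where m: "m = (a, b, c, d)" by (cases m) auto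
  have "a + b + c + d \<noteq> 1" using assms by (simp add: m mono_deg_def)
  then show ?thesis
    by (cases w) (auto simp: m mono_deriv_def zero_prod_def power_0_left)
qed

lemma dev_linear_part:
  "dev K (part {(1, 0), (0, 1)} c) z w = ev K (part {(1, 0), (0, 1)} c) w"
  "dev K c 0 w = ev K (part {(1, 0), (0, 1)} c) w"
  unfolding dev_def ev_def
proof (safe intro!: sum.cong)
  fix m
  have iff: "mono_deg m \<in> {(1, 0), (0, 1)} \<longleftrightarrow> fst (mono_deg m) + snd (mono_deg m) = 1"
    by (cases "mono_deg m") auto
  show "part {(1, 0), (0, 1)} c m * mono_deriv m z w = part {(1, 0), (0, 1)} c m * mono_eval m w"
    using mono_deriv_linear[of m z w] unfolding part_def iff by simp
  show "c m * mono_deriv m 0 w = part {(1, 0), (0, 1)} c m * mono_eval m w"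
    using mono_deriv_linear[of m 0 w] mono_deriv_origin[of m w] unfolding part_def iff by simp
qed

text \<open>The value \<open>n = 2 * m0 + 2\<close> makes the edge from \<open>(0, n)\<close> to \<open>(1, m0)\<close> so steep that it contains no
  other exponent, and \<open>n \<ge> 2\<close> keeps the origin critical.\<close>

definition left_end_data :: "(nat \<times> nat) set \<Rightarrow> (nat \<times> nat \<times> nat \<times> nat) set \<Rightarrow> (nat \<times> nat \<times> nat \<times> nat \<Rightarrow> complex) \<Rightarrow> nat \<Rightarrow> bool" where
  "left_end_data L K c n \<longleftrightarrow> n \<ge> 2 \<and>
    (left_vertex L (0, n) \<and> ((\<exists>z\<in>torus. ev K (part {(0, n)} c) z = 0) \<longrightarrow>
       (\<exists>m\<ge>1. m \<le> n \<and> (1, n - m) \<in> L \<and> (\<forall>t\<in>L. n \<le> wt (m, 1) t) \<and>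
          regular_on K (part {t. wt (m, 1) t = n} c) {z. snd z \<noteq> 0})) \<or>
     (\<exists>m0. left_vertex L (1, m0) \<and> n = 2 * m0 + 2 \<and> (\<forall>z\<in>torus. ev K (part {(1, m0)} c) z \<noteq> 0) \<and>
        regular_on K (part {(1, m0)} c) {z. snd z \<noteq> 0}))"

lemma part_cong_support:
  assumes "\<And>m. c m \<noteq> 0 \<Longrightarrow> mono_deg m \<in> L" "\<And>t. t \<in> L \<Longrightarrow> t \<in> M \<longleftrightarrow> t \<in> M'"
  shows "part M c = part M' c"
proof
  fix m
  show "part M c m = part M' c m"
    using assms(1)[of m] assms(2)[of "mono_deg m"] by (cases "c m = 0") (simp_all add: part_def)
qed

text \<open>The column of the left vertex is 0 or 1. Column 1 calls for a new exponent on the axis.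
  In column 0 a zero of the axis polynomial forces an exponent \<open>(1, n - m)\<close> on the edge
  at \<open>l\<close>, and criticality of the origin forces \<open>n \<ge> 2\<close>.\<close>

lemma left_end_data_exists:
  assumes supp: "\<And>m. c m \<noteq> 0 \<Longrightarrow> mono_deg m \<in> L"
    and l: "left_vertex L l" and no0: "(0, 0) \<notin> L" and crit: "\<not> surj (dev K c 0)"
    and reg: "(\<exists>P. is_edge L P \<and> l \<in> minset L P \<and> regular_on K (part (minset L P) c) {z. snd z \<noteq> 0}) \<or>
      (\<forall>t\<in>L. snd l \<le> snd t) \<and> snd l \<le> 1 \<and> regular_on K (part {l} c) {z. snd z \<noteq> 0}"
  obtains n where "left_end_data L K c n"
proof -
  have lL: "l \<in> L" using l by (simp add: left_vertex_def)
  obtain M where M: "M \<subseteq> L" "{t \<in> M. fst t = fst l} = {l}" "regular_on K (part M c) {z. snd z \<noteq> 0}"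
    and M_cases: "(\<exists>P. is_edge L P \<and> l \<in> minset L P \<and> M = minset L P) \<or> snd l \<le> 1 \<and> M = {l}"
  proof -
    from reg consider P where "is_edge L P" "l \<in> minset L P" "regular_on K (part (minset L P) c) {z. snd z \<noteq> 0}" |
      "snd l \<le> 1" "regular_on K (part {l} c) {z. snd z \<noteq> 0}" by blast
    then show ?thesis
    proof cases
      case 1
      have "0 < snd P" using 1(1) by (simp add: is_edge_def)
      show ?thesis
      proof (rule that[of "minset L P"])
        show "minset L P \<subseteq> L" by (auto simp: minset_def)
        show "{t \<in> minset L P. fst t = fst l} = {l}" using minset_column[OF 1(2) \<open>0 < snd P\<close>] .
      qed (use 1 in blast)+
    next
      case 2
      then show ?thesis using that[of "{l}"] lL by auto
    qed
  qed
  have "fst l \<le> 1" using left_end_column_le_1[OF l M(1,3)] .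
  then consider "fst l = 0" | "fst l = 1" by linarith
  then show ?thesis
  proof cases
    case 2
    then obtain m0 where "l = (1, m0)" by (metis prod.collapse)
    then show ?thesis
      using that[of "2 * m0 + 2"] left_end_column_1[OF l 2 M] l by (auto simp: left_end_data_def)
  next
    case 1
    then obtain n where ln: "l = (0, n)" by (metis prod.collapse)
    have step: "\<exists>m\<ge>1. m \<le> n \<and> (1, n - m) \<in> L \<and> (\<forall>t\<in>L. n \<le> wt (m, 1) t) \<and>
          regular_on K (part {t. wt (m, 1) t = n} c) {z. snd z \<noteq> 0}"
      if z: "z \<in> torus" "ev K (part {(0, n)} c) z = 0" for z
    proof -
      have "{t \<in> M. fst t = 0} = {(0, n)}" using M(2) by (simp add: ln)
      then obtain t where t: "t \<in> M" "fst t = 1" using left_end_column_0[OF _ M(3) z] by blast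
      then have "M \<noteq> {l}" using 1 by auto
      then obtain P where P: "is_edge L P" "l \<in> minset L P" "M = minset L P" using M_cases by blast
      obtain \<nu> where \<nu>: "t = (1, \<nu>)" using t(2) by (metis prod.collapse)
      have pos: "0 < fst P" "0 < snd P" using P(1) by (auto simp: is_edge_def)
      have "wt P t = wt P l" using t(1) P(2,3) by (auto simp: minset_def intro: antisym)
      then have eq: "fst P + snd P * \<nu> = snd P * n" by (simp add: \<nu> ln wt_def)
      then have "snd P * \<nu> < snd P * n" using pos by linarith
      then have "\<nu> < n" by simp
      \<comment> \<open>The step from \<open>(0, n)\<close> to \<open>(1, \<nu>)\<close> crosses one
        column, so the edge has integral slope \<open>m\<close> and its weight is a multiple of
        \<open>(m, 1)\<close>.\<close>
      define m where "m = n - \<nu>"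
      have m: "m \<ge> 1" "m \<le> n" "n - m = \<nu>" using \<open>\<nu> < n\<close> by (auto simp: m_def)
      have fP: "fst P = snd P * m" using eq m by (simp add: m_def right_diff_distrib')
      have wt: "wt P t' = snd P * wt (m, 1) t'" for t' by (simp add: wt_def fP algebra_simps)
      have wl: "wt (m, 1) l = n" by (simp add: ln wt_def)
      have min: "n \<le> wt (m, 1) t'" if "t' \<in> L" for t'
        using P(2) that pos unfolding minset_def wt wl[symmetric] by simp
      have "part {t. wt (m, 1) t = n} c = part (minset L P) c"
      proof (rule part_cong_support[OF supp])
        fix t' assume t': "t' \<in> L"
        have "wt (m, 1) t' \<le> n" if "t' \<in> minset L P"
        proof -
          have "wt P t' \<le> wt P l" using that lL unfolding minset_def by blast
          then show ?thesis unfolding wt wl using pos by simp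
        qed
        moreover have "t' \<in> minset L P" if "wt (m, 1) t' = n"
          using t' min that unfolding minset_def wt by simp
        ultimately show "t' \<in> {t. wt (m, 1) t = n} \<longleftrightarrow> t' \<in> minset L P"
          using min[OF t'] by fastforce
      qed
      then show ?thesis
        using m min M(1,3) t(1) \<nu> P(3) by (intro exI[of _ m]) auto
    qed
    \<comment> \<open>For \<open>n = 1\<close> the linear part would make the origin regular: if the
      axis polynomial has a zero, through the part of weight \<open>(1, 1)\<close> provided by
      \<open>step\<close>; otherwise because this polynomial is an injective real linear map of the
      plane.\<close>
    have "n \<ge> 2"
    proof (rule ccontr)
      assume "\<not> n \<ge> 2"
      moreover have "n \<noteq> 0" using no0 lL ln by (cases "n = 0") simp_all
      ultimately have n: "n = 1" by simp
      let ?g = "part {(1, 0), (0, 1)} c"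
      have g_axis: "ev K ?g (0, v) = ev K (part {(0, 1)} c) (u, v)" for u v
      proof -
        have "{t \<in> {(1, 0), (0, 1)}. fst t = 0} = {(0 :: nat, 1 :: nat)}" by auto
        then show ?thesis using ev_part_on_axis[of K "{(1, 0), (0, 1)}" c v u] by simp
      qed
      show False
      proof (cases "\<exists>z\<in>torus. ev K (part {(0, n)} c) z = 0")
        case True
        then obtain u v where z: "(u, v) \<in> torus" "ev K (part {(0, n)} c) (u, v) = 0" by auto
        from step[OF z] obtain m where m: "m \<ge> 1" "m \<le> n" "regular_on K (part {t. wt (m, 1) t = n} c) {z. snd z \<noteq> 0}"
          by blast
        have "{t. wt (m, 1) t = n} = {(1, 0), (0, 1)}"
          using m n by (auto simp: wt_def add_is_1)
        then have "regular_on K ?g {z. snd z \<noteq> 0}" using m(3) by simp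
        moreover have "ev K ?g (0, v) = 0" using g_axis[of v u] z(2) n by simp
        moreover have "v \<noteq> 0" using z(1) by (simp add: torus_def)
        ultimately have "surj (dev K ?g (0, v))" by (auto simp: regular_on_def)
        moreover have "dev K ?g (0, v) = dev K c 0" unfolding fun_eq_iff dev_linear_part by simp
        ultimately show False using crit by simp
      next
        case False
        note lin = linear_dev_snd[of K c 0]
        have "inj (\<lambda>y. dev K c 0 (0, y))"
          unfolding linear_injective_0[OF lin]
        proof (intro allI impI)
          fix y assume "dev K c 0 (0, y) = 0"
          then have "ev K (part {(0, n)} c) (1, y) = 0" using g_axis[of y 1] n by (simp add: dev_linear_part)
          moreover have "(1, y) \<in> torus" if "y \<noteq> 0" using that by (simp add: torus_def)
          ultimately show "y = 0" using False by blast
        qed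
        then have "surj (\<lambda>y. dev K c 0 (0, y))" by (intro linear_injective_imp_surjective[OF lin _ refl])
        then have "surj (dev K c 0)" unfolding surj_def by metis
        then show False using crit by simp
      qed
    qed
    then have "left_end_data L K c n"
      using l step by (auto simp: left_end_data_def ln)
    then show ?thesis by (rule that)
  qed
qed

text \<open>The hypotheses give \<open>fst p \<ge> snd p * (m0 + 2)\<close>, so two columns cost at
  least \<open>snd p * (2 * m0 + 4)\<close>, more than the weight
  \<open>snd p * (2 * m0 + 2)\<close> of the new point \<open>(0, 2 * m0 + 2)\<close>. Hence
  \<open>t\<close> lies in column 1.\<close>

lemma new_point_minimiser:
  assumes l: "left_vertex L (1, m0)" and p: "0 < fst p" "0 < snd p" and t: "t \<in> L"
    and eq: "wt p t = snd p * (2 * m0 + 2)" and le: "wt p t \<le> wt p (1, m0)"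
  shows "t = (1, m0)"
proof -
  have t1: "1 < fst t \<or> 1 = fst t \<and> m0 \<le> snd t" using l t by (auto simp: left_vertex_def)
  have le': "snd p * (2 * m0 + 2) \<le> fst p + snd p * m0" using eq le by (simp add: wt_def)
  then have p1: "snd p * (m0 + 2) \<le> fst p" by (simp add: algebra_simps)
  have "\<not> 1 < fst t"
  proof
    assume "1 < fst t"
    then have "fst p * 2 \<le> fst p * fst t" by simp
    also have "\<dots> \<le> snd p * (2 * m0 + 2)" using eq by (simp add: wt_def)
    finally have "fst p \<le> snd p * (m0 + 1)" by (simp add: algebra_simps)
    then have "snd p * (m0 + 2) \<le> snd p * (m0 + 1)" using p1 by linarith
    then show False using p by simp
  qed
  then have t1: "fst t = 1" "m0 \<le> snd t" using t1 by auto
  have "fst p + snd p * snd t \<le> fst p + snd p * m0" using le t1 by (simp add: wt_def)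
  then have "snd t \<le> m0" using p by simp
  then show ?thesis using t1 by (simp add: prod_eq_iff)
qed

lemma left_end_data_cases:
  assumes "left_end_data L K c n"
  shows "n \<ge> 2" "(0, n) \<in> L \<or> (\<exists>m0. (1, m0) \<in> L \<and> n = 2 * m0 + 2)"
  using assms by (auto simp: left_end_data_def left_vertex_def)

lemma left_end_data_new:
  assumes "left_end_data L K c n" "(0, n) \<notin> L"
  obtains m0 where "left_vertex L (1, m0)" "n = 2 * m0 + 2" "\<forall>z\<in>torus. ev K (part {(1, m0)} c) z \<noteq> 0"
  using assms by (auto simp: left_end_data_def left_vertex_def)

text \<open>The coefficients are still those of \<open>c\<close>, so the polynomial at a new axis
  point is zero and regularity has to come from column 1; the weight of the new edge singles out
  \<open>(1, m0)\<close> for this. If the axis point is old, it remains to see that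
  \<open>(n', 0)\<close> does not fall below the old edge.\<close>

lemma left_end_regular_extended:
  assumes supp: "\<And>m. c m \<noteq> 0 \<Longrightarrow> mono_deg m \<in> L"
    and left: "left_end_data L K c n"
    and n': "n' \<ge> 2" "(n', 0) \<in> L \<or> (\<exists>m1. (m1, 1) \<in> L \<and> n' = 2 * m1 + 2)"
  shows "left_end_regular (insert (0, n) (insert (n', 0) L)) K c"
  unfolding left_end_regular_def
proof (intro allI impI)
  let ?T = "insert (0, n) (insert (n', 0) L)"
  fix k assume k: "(0, k) \<in> ?T" "\<forall>k'. (0, k') \<in> ?T \<longrightarrow> k \<le> k'"
    and zero: "\<exists>z\<in>torus. ev K (part {(0, k)} c) z = 0"
  have kn: "k \<le> n" using k(2) by simp
  consider "left_vertex L (0, n)" "(\<exists>z\<in>torus. ev K (part {(0, n)} c) z = 0) \<longrightarrow>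
       (\<exists>m\<ge>1. m \<le> n \<and> (1, n - m) \<in> L \<and> (\<forall>t\<in>L. n \<le> wt (m, 1) t) \<and>
          regular_on K (part {t. wt (m, 1) t = n} c) {z. snd z \<noteq> 0})" |
     m0 where "left_vertex L (1, m0)" "n = 2 * m0 + 2" "regular_on K (part {(1, m0)} c) {z. snd z \<noteq> 0}"
    using left unfolding left_end_data_def by blast
  then show "\<exists>m\<ge>1. m \<le> k \<and> (1, k - m) \<in> ?T \<and> (\<forall>t\<in>?T. k \<le> wt (m, 1) t) \<and>
        regular_on K (part {t. wt (m, 1) t = k} c) {z. snd z \<noteq> 0}"
  proof cases
    case 1
    have "k = n"
    proof -
      have "(0, k) \<in> L \<or> k = n" using k(1) n'(1) by auto
      then have "n \<le> k" using 1(1) by (fastforce simp: left_vertex_def)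
      then show ?thesis using kn by simp
    qed
    then obtain m where m: "m \<ge> 1" "m \<le> n" "(1, n - m) \<in> L" "\<And>t. t \<in> L \<Longrightarrow> n \<le> wt (m, 1) t"
      "regular_on K (part {t. wt (m, 1) t = n} c) {z. snd z \<noteq> 0}"
      using 1(2) zero by blast
    have "n \<le> wt (m, 1) (n', 0)"
      using n'(2)
    proof (elim disjE exE conjE)
      \<comment> \<open>The old exponent \<open>(m1, 1)\<close> has weight
        \<open>m * m1 + 1\<close>, which is at least \<open>n\<close>, and the point
        \<open>(2 * m1 + 2, 0)\<close> is heavier because \<open>m \<ge> 1\<close>.\<close>
      fix m1 assume m1: "(m1, 1) \<in> L" "n' = 2 * m1 + 2"
      have "n \<le> m * m1 + 1" using m(4)[OF m1(1)] by (simp add: wt_def)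
      also have "\<dots> \<le> m * m1 + (m * m1 + 2 * m)" using m(1) by simp
      also have "\<dots> = wt (m, 1) (n', 0)" by (simp add: wt_def m1(2) algebra_simps)
      finally show ?thesis .
    qed (rule m(4))
    moreover have "n \<le> wt (m, 1) (0, n)" by (simp add: wt_def)
    ultimately have "\<forall>t\<in>?T. n \<le> wt (m, 1) t" using m(4) by blast
    then show ?thesis using m \<open>k = n\<close> by blast
  next
    case 2
    have "(0, j) \<notin> L" for j using 2(1) by (fastforce simp: left_vertex_def)
    then have "k = n" using k(1) n'(1) by auto
    \<comment> \<open>This is the slope \<open>n - m0\<close> of the new edge. Two columns to the
      right already cost \<open>2 * m0 + 4\<close>, more than \<open>n\<close>.\<close>
    define m where "m = m0 + 2"
    have m: "m \<ge> 1" "m \<le> n" "n - m = m0" by (auto simp: m_def 2(2))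
    have big: "n < wt (m, 1) t" if "2 \<le> fst t" for t
    proof -
      have "m * 2 \<le> m * fst t" using that by simp
      then show ?thesis by (simp add: wt_def 2(2) m_def)
    qed
    have col: "1 < fst t \<or> 1 = fst t \<and> m0 \<le> snd t" if "t \<in> L" for t
      using 2(1) that by (auto simp: left_vertex_def)
    have one: "wt (m, 1) t = m0 + 2 + snd t" if "fst t = 1" for t using that by (simp add: wt_def m_def)
    have L: "n \<le> wt (m, 1) t" "wt (m, 1) t = n \<longleftrightarrow> t = (1, m0)" if "t \<in> L" for t
    proof -
      have "n \<le> wt (m, 1) t \<and> (wt (m, 1) t = n \<longleftrightarrow> t = (1, m0))"
      proof (cases "fst t = 1")
        case True
        then show ?thesis using col[OF that] one[OF True] 2(2) by (simp add: prod_eq_iff)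
      next
        case False
        then have "2 \<le> fst t" using col[OF that] by auto
        from big[OF this] False show ?thesis by (auto simp: less_imp_le)
      qed
      then show "n \<le> wt (m, 1) t" "wt (m, 1) t = n \<longleftrightarrow> t = (1, m0)" by auto
    qed
    have min: "\<forall>t\<in>?T. n \<le> wt (m, 1) t"
    proof
      fix t assume "t \<in> ?T"
      then consider "t = (0, n)" | "t = (n', 0)" | "t \<in> L" by blast
      then show "n \<le> wt (m, 1) t"
      proof cases
        case 2
        then show ?thesis using big[of t] n'(1) by simp
      qed (use L(1) in \<open>auto simp: wt_def\<close>)
    qed
    have "part {t. wt (m, 1) t = n} c = part {(1, m0)} c"
      by (rule part_cong_support[OF supp]) (use L(2) in auto)
    moreover have "(1, m0) \<in> L" using 2(1) by (simp add: left_vertex_def)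
    ultimately show ?thesis using m min 2(3) \<open>k = n\<close> by (intro exI[of _ m]) auto
  qed
qed

lemma vertex_of_subset: "vertex_of T s \<Longrightarrow> L \<subseteq> T \<Longrightarrow> s \<in> L \<Longrightarrow> vertex_of L s"
  unfolding vertex_of_def by blast

lemma zero_free_swap:
  assumes "\<forall>z\<in>torus. ev (swap_mono ` K) (part {s} (c \<circ> swap_mono)) z \<noteq> 0"
  shows "\<forall>z\<in>torus. ev K (part {prod.swap s} c) z \<noteq> 0"
proof
  fix z assume "z \<in> torus"
  then have "prod.swap z \<in> torus" by (auto simp: torus_def)
  then show "ev K (part {prod.swap s} c) z \<noteq> 0"
    using assms ev_swap[of K "part {prod.swap s} c" z] part_swap_image[of "{prod.swap s}" c] by auto
qed

text \<open>The new axis points create no uncontrolled faces. An edge of the enlarged set either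
  carries an old edge, or its only old exponent is \<open>(1, m0)\<close> or the mirror image of
  such a point, where the polynomial is zero-free. Former end vertices off the axes are of the same
  kind.\<close>

lemma admissible_extended:
  assumes supp: "\<And>m. c m \<noteq> 0 \<Longrightarrow> mono_deg m \<in> L"
    and left: "left_end_data L K c n"
    and right: "left_end_data (prod.swap ` L) (swap_mono ` K) (c \<circ> swap_mono) n'"
    and edge: "\<And>p. is_edge L p \<Longrightarrow> regular_on K (part (minset L p) c) torus"
    and vertex: "\<And>s. vertex_of L s \<Longrightarrow> \<exists>t\<in>L. fst t < fst s \<Longrightarrow> \<exists>t\<in>L. snd t < snd s \<Longrightarrow>
       \<forall>z\<in>torus. ev K (part {s} c) z \<noteq> 0"
  shows "admissible (insert (0, n) (insert (n', 0) L)) K c"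
proof -
  let ?T = "insert (0, n) (insert (n', 0) L)"
  have swap_mem: "(a, b) \<in> prod.swap ` L \<longleftrightarrow> (b, a) \<in> L" for a b
    by (metis (no_types, lifting) imageE image_eqI swap_simp swap_swap)
  have n: "n \<ge> 2" "(0, n) \<in> L \<or> (\<exists>m0. (1, m0) \<in> L \<and> n = 2 * m0 + 2)"
    using left_end_data_cases[OF left] .
  have n': "n' \<ge> 2" "(n', 0) \<in> L \<or> (\<exists>m1. (m1, 1) \<in> L \<and> n' = 2 * m1 + 2)"
    using left_end_data_cases[OF right] by (auto simp only: swap_mem)
  have regular_zero_free: "regular_on K e torus" if "\<forall>z\<in>torus. ev K e z \<noteq> 0" for e
    using that unfolding regular_on_def by blast
  have edges: "regular_on K (part {t. wt p t = wt p s} c) torus"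
    if p: "0 < fst p" "0 < snd p" and s: "s \<in> ?T" "q \<in> ?T" "s \<noteq> q" "wt p s = wt p q" "\<forall>t\<in>?T. wt p s \<le> wt p t" for p s q
  proof -
    \<comment> \<open>If the edge contained new points only, comparison with \<open>(1, m0)\<close>
      and \<open>(m1, 1)\<close> would give \<open>fst p \<ge> snd p * (m0 + 2)\<close> and
      \<open>snd p \<ge> fst p * (m1 + 2)\<close>, which is impossible for positive weights.\<close>
    have "\<exists>t0\<in>L. wt p t0 = wt p s"
    proof (rule ccontr)
      assume no: "\<not> ?thesis"
      then have "s \<notin> L" "q \<notin> L" using s(4) by auto
      then have new: "(0, n) \<notin> L" "(n', 0) \<notin> L" "wt p s = wt p (0, n)" "wt p s = wt p (n', 0)"
        using s by auto
      obtain m0 where m0: "(1, m0) \<in> L" "n = 2 * m0 + 2" using n(2) new(1) by blast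
      obtain m1 where m1: "(m1, 1) \<in> L" "n' = 2 * m1 + 2" using n'(2) new(2) by blast
      have "wt p (0, n) \<le> wt p (1, m0)" "wt p (n', 0) \<le> wt p (m1, 1)"
        using s(5) m0(1) m1(1) unfolding new(3)[symmetric] new(4)[symmetric] by auto
      then have "snd p * m0 + snd p * 2 \<le> fst p" "fst p * m1 + fst p * 2 \<le> snd p"
        by (auto simp: wt_def m0(2) m1(2) algebra_simps)
      then show False using p by linarith
    qed
    then obtain t0 where t0: "t0 \<in> L" "wt p t0 = wt p s" by blast
    have minL: "t \<in> minset L p \<longleftrightarrow> wt p t = wt p s" if "t \<in> L" for t
    proof
      assume "t \<in> minset L p"
      then have "wt p t \<le> wt p s" using t0 by (metis (mono_tags, lifting) mem_Collect_eq minset_def)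
      moreover have "wt p s \<le> wt p t" using s(5) that by blast
      ultimately show "wt p t = wt p s" by simp
    next
      assume "wt p t = wt p s"
      then show "t \<in> minset L p" using that s(5) by (simp add: minset_def)
    qed
    have partL: "part {t. wt p t = wt p s} c = part (minset L p) c"
      by (rule part_cong_support[OF supp]) (use minL in auto)
    show ?thesis
    proof (cases "\<exists>t1\<in>minset L p. t1 \<noteq> t0")
      case True
      then have "is_edge L p" unfolding is_edge_def using p t0 minL by blast
      then show ?thesis using edge partL by simp
    next
      case False
      then have single: "minset L p = {t0}" using minL[OF t0(1)] t0(2) by blast
      have "\<exists>x\<in>{s, q}. x \<notin> L"
      proof (rule ccontr)
        assume "\<not> ?thesis"
        then have "s \<in> minset L p" "q \<in> minset L p" using minL s(4) by auto
        then show False using single s(3) by auto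
      qed
      then obtain x where x: "x \<in> ?T" "x \<notin> L" "wt p x = wt p s" using s by auto
      then consider "x = (0, n)" | "x = (n', 0)" by blast
      then have "\<forall>z\<in>torus. ev K (part {t0} c) z \<noteq> 0"
      proof cases
        case 1
        then obtain m0 where m0: "left_vertex L (1, m0)" "n = 2 * m0 + 2" "\<forall>z\<in>torus. ev K (part {(1, m0)} c) z \<noteq> 0"
          using left_end_data_new[OF left] x(2) by blast
        have "(1, m0) \<in> L" using m0(1) by (simp add: left_vertex_def)
        then have "wt p t0 \<le> wt p (1, m0)" using s(5) t0(2) by simp
        moreover have "wt p t0 = snd p * (2 * m0 + 2)" using x(3) t0(2) unfolding 1 by (simp add: wt_def m0(2))
        ultimately have "t0 = (1, m0)" using new_point_minimiser[OF m0(1) p t0(1)] by blast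
        then show ?thesis using m0(3) by simp
      next
        case 2
        have "(0, n') \<notin> prod.swap ` L" using x(2) 2 swap_mem by blast
        then obtain m0 where m0: "left_vertex (prod.swap ` L) (1, m0)" "n' = 2 * m0 + 2"
          "\<forall>z\<in>torus. ev (swap_mono ` K) (part {(1, m0)} (c \<circ> swap_mono)) z \<noteq> 0"
          using left_end_data_new[OF right] by blast
        have wts: "wt (prod.swap p) (prod.swap t) = wt p t" for t by (simp add: wt_def)
        have "(1, m0) \<in> prod.swap ` L" using m0(1) by (simp add: left_vertex_def)
        then have "(m0, 1) \<in> L" by (simp only: swap_mem)
        then have "wt (prod.swap p) (prod.swap t0) \<le> wt (prod.swap p) (1, m0)"
          using s(5) t0(2) wts[of "(m0, 1)"] wts[of t0] by simp
        moreover have "wt (prod.swap p) (prod.swap t0) = snd (prod.swap p) * (2 * m0 + 2)"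
          using x(3) t0(2) unfolding 2 wts by (simp add: wt_def m0(2))
        moreover have "prod.swap t0 \<in> prod.swap ` L" using t0(1) by (rule imageI)
        ultimately have "prod.swap t0 = (1, m0)" using new_point_minimiser[OF m0(1), of "prod.swap p"] p by simp
        then have "prod.swap (1, m0) = t0" by (metis swap_swap)
        then show ?thesis using zero_free_swap[OF m0(3)] by simp
      qed
      then show ?thesis using partL single regular_zero_free by simp
    qed
  qed
  have vertices: "\<forall>z\<in>torus. ev K (part {s} c) z \<noteq> 0" if s: "vertex_of ?T s" "0 < fst s" "0 < snd s" for s
  proof -
    have "s \<in> ?T" using s(1) by (simp add: vertex_of_def)
    then have sL: "s \<in> L" using s(2,3) by auto
    have v: "vertex_of L s" by (rule vertex_of_subset[OF s(1) _ sL]) auto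
    consider "\<exists>t\<in>L. fst t < fst s" "\<exists>t\<in>L. snd t < snd s" | "\<forall>t\<in>L. fst s \<le> fst t" | "\<forall>t\<in>L. snd s \<le> snd t"
      by (meson not_le)
    then show ?thesis
    proof cases
      case 1
      then show ?thesis using vertex[OF v] by blast
    next
      \<comment> \<open>Here \<open>s\<close> lies in the leftmost column of \<open>L\<close>, which
        is not column 0. So \<open>L\<close> misses that axis, and \<open>s\<close> is the old left
        end \<open>(1, m0)\<close>.\<close>
      case 2
      have "(0, n) \<notin> L"
      proof
        assume "(0, n) \<in> L"
        then show False using 2 s(2) by fastforce
      qed
      then obtain m0 where m0: "left_vertex L (1, m0)" "\<forall>z\<in>torus. ev K (part {(1, m0)} c) z \<noteq> 0"
        using left_end_data_new[OF left] by blast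
      have "s = (1, m0)" using left_vertex_unique_column[OF m0(1) v] 2 by blast
      then show ?thesis using m0(2) by simp
    next
      case 3
      have nin: "(0, n') \<notin> prod.swap ` L"
      proof
        assume "(0, n') \<in> prod.swap ` L"
        then have "(n', 0) \<in> L" by (simp only: swap_mem)
        then show False using 3 s(3) by fastforce
      qed
      obtain m0 where m0: "left_vertex (prod.swap ` L) (1, m0)" "n' = 2 * m0 + 2"
          "\<forall>z\<in>torus. ev (swap_mono ` K) (part {(1, m0)} (c \<circ> swap_mono)) z \<noteq> 0"
        by (rule left_end_data_new[OF right nin]) (rule that)
      have "vertex_of (prod.swap ` L) (prod.swap s)" using v by (simp add: vertex_of_swap)
      moreover have "fst (prod.swap s) \<le> fst t" if "t \<in> prod.swap ` L" for t using 3 that by auto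
      ultimately have "prod.swap s = (1, m0)" using left_vertex_unique_column[OF m0(1)] by blast
      then have "prod.swap (1, m0) = s" by (metis swap_swap)
      then show ?thesis using zero_free_swap[OF m0(3)] by simp
    qed
  qed
  have lend: "left_end_regular ?T K c" by (rule left_end_regular_extended[OF supp left n'])
  have rend: "left_end_regular (prod.swap ` ?T) (swap_mono ` K) (c \<circ> swap_mono)"
  proof -
    have "prod.swap ` ?T = insert (0, n') (insert (n, 0) (prod.swap ` L))" by auto
    moreover have "left_end_regular (insert (0, n') (insert (n, 0) (prod.swap ` L))) (swap_mono ` K) (c \<circ> swap_mono)"
    proof (rule left_end_regular_extended[OF _ right n(1)])
      show "mono_deg m \<in> prod.swap ` L" if "(c \<circ> swap_mono) m \<noteq> 0" for m
        using supp[of "swap_mono m"] that by (cases "mono_deg m") (simp add: swap_mem)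
      show "(n, 0) \<in> prod.swap ` L \<or> (\<exists>m1. (m1, 1) \<in> prod.swap ` L \<and> n = 2 * m1 + 2)"
        using n(2) by (simp only: swap_mem)
    qed
    ultimately show ?thesis by simp
  qed
  show ?thesis
    unfolding admissible_def using edges vertices lend rend by blast
qed

section \<open>From the whole support to a single edge\<close>

lemma left_end_regular_edge:
  assumes supp: "\<And>m. c m \<noteq> 0 \<Longrightarrow> mono_deg m \<in> T" and p: "is_edge T p" and reg: "left_end_regular T K c"
  shows "left_end_regular (minset T p) K (part (minset T p) c)"
  unfolding left_end_regular_def
proof (intro allI impI)
  let ?M = "minset T p"
  fix n assume n: "(0, n) \<in> ?M" "\<forall>n'. (0, n') \<in> ?M \<longrightarrow> n \<le> n'"
    and zero: "\<exists>z\<in>torus. ev K (part {(0, n)} (part ?M c)) z = 0"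
  have pos: "0 < fst p" "0 < snd p" using p by (auto simp: is_edge_def)
  have min: "wt p (0, n) \<le> wt p t" if "t \<in> T" for t using n(1) that by (simp add: minset_def)
  have M: "t \<in> ?M \<longleftrightarrow> wt p t = wt p (0, n)" if "t \<in> T" for t
    using n(1) that min by (fastforce simp: minset_def)
  have nT: "(0, n) \<in> T" "\<And>n'. (0, n') \<in> T \<Longrightarrow> n \<le> n'"
    using n(1) min pos by (auto simp: minset_def wt_def)
  have "part {(0, n)} (part ?M c) = part {(0, n)} c" using n(1) by (auto simp: part_def)
  then have "\<exists>z\<in>torus. ev K (part {(0, n)} c) z = 0" using zero by simp
  then obtain m where m: "m \<ge> 1" "m \<le> n" "(1, n - m) \<in> T" "\<And>t. t \<in> T \<Longrightarrow> n \<le> wt (m, 1) t"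
    "regular_on K (part {t. wt (m, 1) t = n} c) {z. snd z \<noteq> 0}"
    using reg nT unfolding left_end_regular_def by blast
  \<comment> \<open>The second point \<open>t\<close> of the edge gives
    \<open>fst p \<le> snd p * m\<close>, and the exponent \<open>(1, n - m)\<close> gives the
    reverse inequality. So \<open>p\<close> is a multiple of \<open>(m, 1)\<close>, and both weights
    describe the same edge.\<close>
  obtain t where t: "t \<in> ?M" "t \<noteq> (0, n)" using p n(1) unfolding is_edge_def by metis
  have tT: "t \<in> T" using t(1) by (simp add: minset_def)
  have eq: "fst p * fst t + snd p * snd t = snd p * n" using M[OF tT] t(1) by (simp add: wt_def)
  have t1: "fst t > 0"
  proof (rule gr0I)
    assume "fst t = 0"
    then have "snd t = n" using eq pos by simp
    then show False using t(2) \<open>fst t = 0\<close> by (simp add: prod_eq_iff)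
  qed
  have "fst p * fst t + snd p * snd t \<le> snd p * (m * fst t + snd t)"
    unfolding eq using m(4)[OF tT] by (simp add: wt_def)
  then have "fst p * fst t + snd p * snd t \<le> (snd p * m) * fst t + snd p * snd t"
    by (simp only: distrib_left mult.assoc)
  then have "fst p * fst t \<le> (snd p * m) * fst t" by (simp only: add_le_cancel_right)
  then have le: "fst p \<le> snd p * m" using t1 by simp
  have "snd p * n \<le> fst p + snd p * (n - m)" using min[OF m(3)] by (simp add: wt_def)
  also have "snd p * (n - m) = snd p * n - snd p * m" by (simp add: right_diff_distrib')
  finally have "snd p * m \<le> fst p" using m(2) mult_le_mono2[OF m(2), of "snd p"] by linarith
  then have fp: "fst p = snd p * m" using le by simp
  have wt: "wt p t = snd p * wt (m, 1) t" for t by (simp add: wt_def fp algebra_simps)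
  have iff: "t \<in> ?M \<longleftrightarrow> wt (m, 1) t = n" if "t \<in> T" for t
    using M[OF that] pos unfolding wt by (simp add: wt_def)
  have "part {t. wt (m, 1) t = n} (part ?M c) = part {t. wt (m, 1) t = n} c"
  proof
    fix i
    show "part {t. wt (m, 1) t = n} (part ?M c) i = part {t. wt (m, 1) t = n} c i"
      using supp[of i] iff[of "mono_deg i"] by (cases "c i = 0") (auto simp: part_def)
  qed
  moreover have "(1, n - m) \<in> ?M" using iff[OF m(3)] m(2) by (simp add: wt_def)
  moreover have "\<forall>t\<in>?M. n \<le> wt (m, 1) t" using m(4) by (simp add: minset_def)
  ultimately show "\<exists>m\<ge>1. m \<le> n \<and> (1, n - m) \<in> ?M \<and> (\<forall>t\<in>?M. n \<le> wt (m, 1) t) \<and>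
        regular_on K (part {t. wt (m, 1) t = n} (part ?M c)) {z. snd z \<noteq> 0}"
    using m by auto
qed

lemma vertex_of_minset:
  assumes p: "is_edge T p" and s: "vertex_of (minset T p) s"
  shows "vertex_of T s"
proof -
  obtain x y :: real where xy: "x > 0" "y > 0" "\<forall>t\<in>minset T p - {s}. x * real (fst s) + y * real (snd s) < x * real (fst t) + y * real (snd t)"
    and sM: "s \<in> minset T p"
    using s unfolding vertex_of_def by blast
  \<comment> \<open>In the weight \<open>N * p + (x, y)\<close> the first summand decides off the
    edge and the second one on it: \<open>N\<close> exceeds the value of \<open>(x, y)\<close> at
    \<open>s\<close>, so one unit of \<open>wt p\<close> outweighs that value.\<close>
  define N where "N = x * real (fst s) + y * real (snd s) + 1"
  have N: "N > 0" using xy(1,2) by (simp add: N_def add_nonneg_pos)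
  have pos: "0 < fst p" "0 < snd p" using p by (auto simp: is_edge_def)
  show ?thesis
    unfolding vertex_of_def
  proof (intro conjI exI ballI)
    show "s \<in> T" using sM by (simp add: minset_def)
    show "0 < N * real (fst p) + x" "0 < N * real (snd p) + y" using N pos xy(1,2) by (auto intro!: add_pos_pos)
    fix t assume t: "t \<in> T - {s}"
    have e: "(N * real (fst p) + x) * real (fst t) + (N * real (snd p) + y) * real (snd t)
        = N * real (wt p t) + (x * real (fst t) + y * real (snd t))" for t
      by (simp add: wt_def algebra_simps)
    have le: "wt p s \<le> wt p t" using sM t by (simp add: minset_def)
    show "(N * real (fst p) + x) * real (fst s) + (N * real (snd p) + y) * real (snd s)
        < (N * real (fst p) + x) * real (fst t) + (N * real (snd p) + y) * real (snd t)"
      unfolding e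
    proof (cases "wt p t = wt p s")
      case True
      then have "t \<in> minset T p - {s}" using sM t by (simp add: minset_def)
      then show "N * real (wt p s) + (x * real (fst s) + y * real (snd s)) < N * real (wt p t) + (x * real (fst t) + y * real (snd t))"
        using xy(3) True by auto
    next
      case False
      then have "real (wt p s) + 1 \<le> real (wt p t)" using le by linarith
      then have "N * (real (wt p s) + 1) \<le> N * real (wt p t)" using N by (intro mult_left_mono) auto
      moreover have "0 \<le> x * real (fst t) + y * real (snd t)" using xy(1,2) by simp
      ultimately show "N * real (wt p s) + (x * real (fst s) + y * real (snd s)) < N * real (wt p t) + (x * real (fst t) + y * real (snd t))"
        by (simp add: algebra_simps N_def)
    qed
  qed
qed

text \<open>Two distinct exponents on the edge determine its weight up to proportionality, so the
  edge polynomial has only the edge it comes from. This makes \<open>uniform_transversality\<close>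
  applicable to edge polynomials.\<close>

lemma admissible_edge:
  assumes supp: "\<And>m. c m \<noteq> 0 \<Longrightarrow> mono_deg m \<in> T" and p: "is_edge T p" and adm: "admissible T K c"
  shows "admissible (minset T p) K (part (minset T p) c)"
proof -
  let ?M = "minset T p"
  have pos: "0 < fst p" "0 < snd p" using p by (auto simp: is_edge_def)
  have Mwt: "wt p t = wt p s" if "t \<in> ?M" "s \<in> ?M" for s t using that by (auto simp: minset_def intro: antisym)
  have edges: "regular_on K (part {t. wt p' t = wt p' s} (part ?M c)) torus"
    if p': "0 < fst p'" "0 < snd p'" and s: "s \<in> ?M" "q \<in> ?M" "s \<noteq> q" "wt p' s = wt p' q" for p' s q
  proof -
    have "int (fst p) * (int (fst s) - int (fst q)) = int (snd p) * (int (snd q) - int (snd s))"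
      using arg_cong[OF Mwt[OF s(1,2)], of int] by (simp add: wt_def algebra_simps)
    moreover have "int (fst p') * (int (fst s) - int (fst q)) = int (snd p') * (int (snd q) - int (snd s))"
      using arg_cong[OF s(4), of int] by (simp add: wt_def algebra_simps)
    ultimately have "(int (fst p) * int (snd p') - int (fst p') * int (snd p)) * (int (fst s) - int (fst q)) = 0"
      by algebra
    moreover have "int (fst s) \<noteq> int (fst q)"
    proof
      assume "int (fst s) = int (fst q)"
      then have "snd s = snd q" using s(4) p' by (simp add: wt_def)
      then show False using s(3) \<open>int (fst s) = int (fst q)\<close> by (simp add: prod_eq_iff)
    qed
    ultimately have "int (fst p * snd p') = int (fst p' * snd p)" by simp
    then have ratio: "fst p * snd p' = fst p' * snd p" by (simp only: of_nat_eq_iff)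
    have scaled: "fst p * wt p' t = fst p' * wt p t" for t
    proof -
      have "fst p * wt p' t = fst p' * fst p * fst t + (fst p * snd p') * snd t" by (simp add: wt_def algebra_simps)
      also have "\<dots> = fst p' * wt p t" unfolding ratio by (simp add: wt_def algebra_simps)
      finally show ?thesis .
    qed
    have eq: "wt p' t = wt p' s" if "t \<in> ?M" for t
    proof -
      have "fst p * wt p' t = fst p * wt p' s" by (simp only: scaled Mwt[OF that s(1)])
      then show ?thesis using pos by simp
    qed
    have "part {t. wt p' t = wt p' s} (part ?M c) = part ?M c"
      by (rule ext) (use eq in \<open>simp add: part_def\<close>)
    moreover have "part ?M c = part {t. wt p t = wt p s} c"
    proof (rule part_cong_support[OF supp])
      fix t assume t: "t \<in> T"
      have "t \<in> ?M" if "wt p t = wt p s" using s(1) t that by (simp add: minset_def)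
      then show "t \<in> ?M \<longleftrightarrow> t \<in> {t. wt p t = wt p s}" using Mwt[OF _ s(1)] by blast
    qed
    moreover have "regular_on K (part {t. wt p t = wt p s} c) torus"
    proof -
      have "s \<in> T" "q \<in> T" "\<forall>t\<in>T. wt p s \<le> wt p t" "wt p s = wt p q"
        using s(1,2) Mwt[OF s(1,2)] by (auto simp: minset_def)
      then show ?thesis using adm pos s(3) unfolding admissible_def by blast
    qed
    ultimately show ?thesis by simp
  qed
  have vertices: "\<forall>z\<in>torus. ev K (part {s} (part ?M c)) z \<noteq> 0" if s: "vertex_of ?M s" "0 < fst s" "0 < snd s" for s
  proof -
    have "s \<in> ?M" using s(1) by (simp add: vertex_of_def)
    then have eq: "part {s} (part ?M c) = part {s} c" by (auto simp: part_def)
    show ?thesis unfolding eq using adm vertex_of_minset[OF p s(1)] s(2,3) unfolding admissible_def by blast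
  qed
  have lend: "left_end_regular ?M K (part ?M c)"
    by (rule left_end_regular_edge[OF supp p]) (use adm in \<open>auto simp: admissible_def\<close>)
  have rend: "left_end_regular (prod.swap ` ?M) (swap_mono ` K) (part ?M c \<circ> swap_mono)"
  proof -
    have swap_mem: "t \<in> prod.swap ` T \<longleftrightarrow> prod.swap t \<in> T" for t by (metis image_iff swap_swap)
    have "left_end_regular (minset (prod.swap ` T) (prod.swap p)) (swap_mono ` K) (part (minset (prod.swap ` T) (prod.swap p)) (c \<circ> swap_mono))"
    proof (rule left_end_regular_edge)
      show "mono_deg m \<in> prod.swap ` T" if "(c \<circ> swap_mono) m \<noteq> 0" for m
        using supp[of "swap_mono m"] that by (simp add: swap_mem)
      show "is_edge (prod.swap ` T) (prod.swap p)" using p by (simp add: is_edge_swap)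
      show "left_end_regular (prod.swap ` T) (swap_mono ` K) (c \<circ> swap_mono)" using adm by (simp add: admissible_def)
    qed
    then show ?thesis unfolding minset_swap part_swap_image .
  qed
  show ?thesis
    unfolding admissible_def using edges vertices lend rend by blast
qed

section \<open>Generic coefficients\<close>

text \<open>By homogeneity in \<open>\<bar>v\<bar>\<close> the coefficients to be avoided form the image of the unit circle under a
  smooth map into the plane, which is negligible.\<close>

lemma generic_axis_coefficient:
  assumes \<delta>: "\<delta> > 0"
  obtains \<kappa> where "norm \<kappa> \<le> \<delta>" "\<And>v. v \<noteq> 0 \<Longrightarrow> ev K (part {(0, n)} c) (1, v) + \<kappa> * v ^ n \<noteq> 0"
proof -
  let ?e = "part {(0, n)} c"
  \<comment> \<open>\<open>h t\<close> is the only \<open>\<kappa>\<close> that produces a zero at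
    \<open>cis t\<close>; the first argument 1 is arbitrary, as the exponent \<open>(0, n)\<close>
    does not involve \<open>u\<close>.\<close>
  define h where "h = (\<lambda>t::real. - ev K ?e (1, cis t) / cis t ^ n)"
  have dcis: "(cis has_derivative (\<lambda>s. s *\<^sub>R (\<i> * cis t))) (at t)" for t
    using has_derivative_cis[OF has_derivative_ident] .
  have "h differentiable (at t)" for t
  proof -
    have "((\<lambda>t. (1 :: complex, cis t)) has_derivative (\<lambda>s. (0, s *\<^sub>R (\<i> * cis t)))) (at t)"
      by (intro has_derivative_Pair has_derivative_const dcis)
    from has_derivative_compose[OF this has_derivative_ev]
    have "(\<lambda>t. ev K ?e (1, cis t)) differentiable (at t)" unfolding differentiable_def by blast
    moreover have "(\<lambda>t. cis t ^ n) differentiable (at t)"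
      using has_derivative_power[OF dcis] unfolding differentiable_def by blast
    ultimately show ?thesis unfolding h_def by (intro differentiable_divide differentiable_minus) auto
  qed
  then have "h differentiable_on UNIV" by (simp add: differentiable_on_def)
  then have "negligible (range h)" by (intro negligible_differentiable_image_lowdim) auto
  moreover have "\<not> negligible (ball (0::complex) \<delta>)" by (rule open_not_negligible) (use \<delta> in auto)
  ultimately obtain \<kappa> where \<kappa>: "\<kappa> \<in> ball 0 \<delta>" "\<kappa> \<notin> range h" by (meson negligible_subset subsetI)
  show ?thesis
  proof (rule that)
    show "norm \<kappa> \<le> \<delta>" using \<kappa>(1) by simp
    fix v :: complex assume v: "v \<noteq> 0"
    define t where "t = Arg v"
    have vt: "v = of_real (norm v) * cis t" using v by (metis rcis_cmod_Arg rcis_def t_def)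
    have "mono_eval m (1, v) = of_real (norm v ^ n) * mono_eval m (1, cis t)" if "mono_deg m = (0, n)" for m
      using mono_eval_scale[of m 1 1 "norm v" "cis t"] that vt by simp
    then have ev: "ev K ?e (1, v) = of_real (norm v ^ n) * ev K ?e (1, cis t)"
      unfolding ev_def sum_distrib_left by (intro sum.cong) (auto simp: part_def)
    have pow: "v ^ n = of_real (norm v ^ n) * cis t ^ n" by (subst vt) (simp add: power_mult_distrib)
    show "ev K ?e (1, v) + \<kappa> * v ^ n \<noteq> 0"
    proof
      assume "ev K ?e (1, v) + \<kappa> * v ^ n = 0"
      then have "of_real (norm v ^ n) * (ev K ?e (1, cis t) + \<kappa> * cis t ^ n) = 0"
        unfolding ev pow by (simp add: algebra_simps)
      then have "ev K ?e (1, cis t) + \<kappa> * cis t ^ n = 0" using v by simp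
      then have eq: "\<kappa> * cis t ^ n = - ev K ?e (1, cis t)" by (simp add: add_eq_0_iff)
      have "\<kappa> = \<kappa> * cis t ^ n / cis t ^ n" by simp
      then have "\<kappa> = h t" unfolding eq h_def .
      then show False using \<kappa>(2) by blast
    qed
  qed
qed

lemma homogeneous_scale:
  assumes M: "\<And>t. t \<in> M \<Longrightarrow> wt p t = d" and \<rho>: "\<rho> > 0"
  shows "ev K (part M c) (of_real (\<rho> ^ fst p) * u, of_real (\<rho> ^ snd p) * v) = of_real (\<rho> ^ d) * ev K (part M c) (u, v)"
    and "surj (dev K (part M c) (of_real (\<rho> ^ fst p) * u, of_real (\<rho> ^ snd p) * v)) \<Longrightarrow> surj (dev K (part M c) (u, v))"
proof -
  have pow: "(\<rho> ^ fst p) ^ fst (mono_deg m) * (\<rho> ^ snd p) ^ snd (mono_deg m) = \<rho> ^ d" if "mono_deg m \<in> M" for m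
    using M[OF that] by (simp add: wt_def flip: power_mult power_add)
  show "ev K (part M c) (of_real (\<rho> ^ fst p) * u, of_real (\<rho> ^ snd p) * v) = of_real (\<rho> ^ d) * ev K (part M c) (u, v)"
    unfolding ev_def sum_distrib_left mono_eval_scale
    by (rule sum.cong) (auto simp: part_def pow simp del: of_real_mult of_real_power)
  have dev: "dev K (part M c) (of_real (\<rho> ^ fst p) * u, of_real (\<rho> ^ snd p) * v) (of_real (\<rho> ^ fst p) * x, of_real (\<rho> ^ snd p) * y)
      = of_real (\<rho> ^ d) * dev K (part M c) (u, v) (x, y)" for x y
    unfolding dev_def sum_distrib_left mono_deriv_scale
    by (rule sum.cong) (auto simp: part_def pow simp del: of_real_mult of_real_power)
  assume surj: "surj (dev K (part M c) (of_real (\<rho> ^ fst p) * u, of_real (\<rho> ^ snd p) * v))"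
  show "surj (dev K (part M c) (u, v))"
    unfolding surj_def
  proof
    fix w
    obtain X Y where "of_real (\<rho> ^ d) * w = dev K (part M c) (of_real (\<rho> ^ fst p) * u, of_real (\<rho> ^ snd p) * v) (X, Y)"
      using surj unfolding surj_def by (metis prod.collapse)
    also have "\<dots> = of_real (\<rho> ^ d) * dev K (part M c) (u, v) (X / of_real (\<rho> ^ fst p), Y / of_real (\<rho> ^ snd p))"
      using dev[of "X / of_real (\<rho> ^ fst p)" "Y / of_real (\<rho> ^ snd p)"] \<rho> by simp
    finally have "w = dev K (part M c) (u, v) (X / of_real (\<rho> ^ fst p), Y / of_real (\<rho> ^ snd p))"
      using \<rho> by simp
    then show "\<exists>x. w = dev K (part M c) (u, v) x" by blast
  qed
qed

section \<open>End vertices of an inner non-degenerate function\<close>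

lemma boundary_vertex: "vertex_of (exponents f) s \<Longrightarrow> emb s \<in> newton_boundary f"
  using newton_vertex_imp_compact_face[of f s] unfolding newton_boundary_def by blast

lemma right_vertex:
  assumes "left_vertex (prod.swap ` L) r"
  shows "vertex_of L (prod.swap r)" "\<And>t. t \<in> L \<Longrightarrow> snd (prod.swap r) \<le> snd t"
proof -
  show "vertex_of L (prod.swap r)"
    using left_vertex_imp_vertex[OF assms] vertex_of_swap[of L "prod.swap r"] by simp
  show "snd (prod.swap r) \<le> snd t" if "t \<in> L" for t
  proof -
    have "prod.swap t \<in> prod.swap ` L" using that by (rule imageI)
    then have "fst r < fst (prod.swap t) \<or> fst r = fst (prod.swap t) \<and> snd r \<le> snd (prod.swap t)"
      using assms unfolding left_vertex_def by blast
    then show ?thesis by auto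
  qed
qed

text \<open>The two ends of the boundary serve as witnesses. The right end lies below
  \<open>s\<close>, and since \<open>s\<close> is the unique minimiser of a positive weight, it must
  lie strictly to the right.\<close>

lemma non_extreme_vertex:
  assumes s: "vertex_of (exponents f) s" and t: "t \<in> exponents f" "fst t < fst s" and t': "t' \<in> exponents f" "snd t' < snd s"
  shows "{emb s} \<in> non_extreme_vertices f"
proof -
  let ?L = "exponents f"
  obtain l where l: "left_vertex ?L l" using left_vertex_exists[of ?L] t(1) by auto
  obtain r where r: "left_vertex (prod.swap ` ?L) r" using left_vertex_exists[of "prod.swap ` ?L"] t(1) by auto
  have "fst l < fst s" using l t by (fastforce simp: left_vertex_def)
  moreover have "fst s < fst (prod.swap r)"
  proof -
    have lt: "snd (prod.swap r) < snd s" using right_vertex(2)[OF r t'(1)] t'(2) by simp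
    obtain x y :: real where xy: "x > 0" "y > 0" "\<forall>t\<in>?L - {s}. x * real (fst s) + y * real (snd s) < x * real (fst t) + y * real (snd t)"
      using s unfolding vertex_of_def by blast
    have "prod.swap r \<in> ?L - {s}" using right_vertex(1)[OF r] lt by (auto simp: vertex_of_def)
    then have less: "x * real (fst s) + y * real (snd s) < x * real (fst (prod.swap r)) + y * real (snd (prod.swap r))"
      using xy(3) by blast
    have "y * real (snd (prod.swap r)) < y * real (snd s)" using lt xy(2) by simp
    then have "x * real (fst s) < x * real (fst (prod.swap r))" using less by linarith
    then show ?thesis using xy(1) by simp
  qed
  ultimately have less: "fst (emb l) < fst (emb s)" "fst (emb s) < fst (emb (prod.swap r))" by (auto simp: emb_def)
  show ?thesis
    unfolding non_extreme_vertices_def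
  proof (intro CollectI conjI ballI)
    show "{emb s} \<in> compact_faces 0 f" by (rule newton_vertex_imp_compact_face[OF s])
    fix x assume "x \<in> {emb s}"
    then show "\<exists>y\<in>newton_boundary f. fst y < fst x" "\<exists>y\<in>newton_boundary f. fst x < fst y"
      using less boundary_vertex[OF left_vertex_imp_vertex[OF l]] boundary_vertex[OF right_vertex(1)[OF r]] by blast+
  qed
qed

text \<open>A boundary point further left excludes column 0. Every boundary point minimises some
  positive weight, which is impossible to the right of a vertex in row 0; so a boundary point
  further right excludes row 0.\<close>

lemma non_extreme_vertex_interior:
  assumes "\<Delta> \<in> non_extreme_vertices f"
  obtains s where "\<Delta> = {emb s}" "vertex_of (exponents f) s" "0 < fst s" "0 < snd s"
proof -
  let ?L = "exponents f"
  have \<Delta>: "\<Delta> \<in> compact_faces 0 f" using assms by (simp add: non_extreme_vertices_def)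
  obtain s where s: "vertex_of ?L s" "\<Delta> = {emb s}" using compact_face_imp_newton_vertex[OF \<Delta>] .
  obtain y z where y: "y \<in> newton_boundary f" "fst y < fst (emb s)" and z: "z \<in> newton_boundary f" "fst (emb s) < fst z"
    using assms s(2) unfolding non_extreme_vertices_def by blast
  have nonneg: "0 \<le> fst x" "0 \<le> snd x" if "x \<in> newton_boundary f" for x
  proof -
    have x: "x \<in> upward_hull (supp f)"
      using that by (auto simp: newton_boundary_def compact_faces_def newton_polyhedron_upward_hull dest: face_of_imp_subset)
    have "0 \<le> (1, 0) \<bullet> x" by (rule upward_hull_ge[OF _ _ _ x]) (use supp_quadrant in \<open>auto simp: inner_prod_def\<close>)
    moreover have "0 \<le> (0, 1) \<bullet> x" by (rule upward_hull_ge[OF _ _ _ x]) (use supp_quadrant in \<open>auto simp: inner_prod_def\<close>)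
    ultimately show "0 \<le> fst x" "0 \<le> snd x" by (auto simp: inner_prod_def)
  qed
  have "0 < fst s" using nonneg(1)[OF y(1)] y(2) by (simp add: emb_def)
  moreover have "0 < snd s"
  proof (rule ccontr)
    assume "\<not> 0 < snd s"
    then have s0: "snd s = 0" by simp
    have sL: "s \<in> ?L" using s(1) by (simp add: vertex_of_def)
    consider \<Delta>' where "\<Delta>' \<in> compact_faces 0 f" "z \<in> \<Delta>'" | \<Delta>' where "\<Delta>' \<in> compact_faces 1 f" "z \<in> \<Delta>'"
      using z(1) unfolding newton_boundary_def by blast
    then show False
    proof cases
      case 1
      then obtain t where t: "vertex_of ?L t" "z = emb t" using compact_face_imp_newton_vertex[OF 1(1)] by blast
      obtain a where a: "0 < fst a" "0 < snd a" "\<forall>u\<in>?L - {t}. a \<bullet> emb t < a \<bullet> emb u"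
        using t(1) unfolding vertex_of_iff_inner by blast
      have "s \<in> ?L - {t}" using sL z(2) t(2) by auto
      then have "a \<bullet> emb t < a \<bullet> emb s" using a(3) by blast
      then have "fst a * real (fst t) + snd a * real (snd t) < fst a * real (fst s)" by (simp add: inner_emb s0)
      moreover have "0 \<le> snd a * real (snd t)" using a(2) by simp
      moreover have "fst a * real (fst s) \<le> fst a * real (fst t)" using z(2) t(2) a(1) by (simp add: emb_def)
      ultimately show False by linarith
    next
      case 2
      obtain p where p: "is_edge ?L p" "\<And>z t. z \<in> \<Delta>' \<Longrightarrow> t \<in> ?L \<Longrightarrow> weight p z \<le> weight p (emb t)"
        using compact_face_imp_edge[OF 2(1)] by metis
      have p1: "0 < fst p" using p(1) by (simp add: is_edge_def)
      have "real (fst p) * fst z + real (snd p) * snd z \<le> real (fst p) * fst (emb s)"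
        using p(2)[OF 2(2) sL] by (simp add: weight_def emb_def s0)
      moreover have "0 \<le> real (snd p) * snd z" using nonneg(2)[OF z(1)] by simp
      moreover have "real (fst p) * fst (emb s) < real (fst p) * fst z" using z(2) p1 by simp
      ultimately show False by linarith
    qed
  qed
  ultimately show ?thesis using that s by blast
qed

lemma finite_uniform_bound:
  assumes "finite S" "\<And>M. M \<in> S \<Longrightarrow> \<exists>\<delta>>0::real. Q M \<delta>" "\<And>M \<delta> \<delta>'. Q M \<delta> \<Longrightarrow> 0 < \<delta>' \<Longrightarrow> \<delta>' \<le> \<delta> \<Longrightarrow> Q M \<delta>'"
  shows "\<exists>\<delta>>0. \<forall>M\<in>S. Q M \<delta>"
  using assms(1,2)
proof (induction S rule: finite_induct)
  case empty
  show ?case by (intro exI[of _ 1]) auto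
next
  case (insert M S)
  obtain \<delta>1 where 1: "\<delta>1 > 0" "\<forall>M\<in>S. Q M \<delta>1" using insert by blast
  obtain \<delta>2 where 2: "\<delta>2 > 0" "Q M \<delta>2" using insert by blast
  have m: "min \<delta>1 \<delta>2 > 0" "min \<delta>1 \<delta>2 \<le> \<delta>1" "min \<delta>1 \<delta>2 \<le> \<delta>2" using 1 2 by auto
  have "\<forall>N\<in>insert M S. Q N (min \<delta>1 \<delta>2)"
    using assms(3)[OF 2(2) m(1,3)] assms(3)[OF _ m(1,2)] 1(2) by blast
  then show ?case using m(1) by blast
qed

text \<open>The definition speaks of coprime weights, so \<open>p\<close> is replaced by the
  primitive weight of the same edge; this is the first or the last weight as soon as the edge
  contains the corresponding end vertex.\<close>

lemma inner_nondegenerate_edges: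
  assumes inner: "inner_nondegenerate f" and K: "finite K" "Poly_Mapping.keys f \<subseteq> K" and p: "is_edge (exponents f) p"
  shows "regular_on K (part (minset (exponents f) p) (Poly_Mapping.lookup f)) torus"
    and "left_vertex (exponents f) l \<Longrightarrow> l \<in> minset (exponents f) p \<Longrightarrow>
      regular_on K (part (minset (exponents f) p) (Poly_Mapping.lookup f)) {z. snd z \<noteq> 0}"
    and "left_vertex (prod.swap ` exponents f) r \<Longrightarrow> r \<in> minset (prod.swap ` exponents f) (prod.swap p) \<Longrightarrow>
      regular_on K (part (minset (exponents f) p) (Poly_Mapping.lookup f)) {z. fst z \<noteq> 0}"
proof -
  let ?L = "exponents f" and ?c = "Poly_Mapping.lookup f"
  obtain p' where p': "is_edge ?L p'" "coprime (fst p') (snd p')" "minset ?L p' = minset ?L p"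
    using is_edge_coprime[OF p] .
  then have "p' \<in> edge_weights f" by (simp add: edge_weights_eq)
  then have ne: "edge_weights f \<noteq> {}" by blast
  obtain \<Delta> where \<Delta>: "\<Delta> \<in> compact_faces 1 f" "\<And>t. t \<in> ?L \<Longrightarrow> emb t \<in> \<Delta> \<longleftrightarrow> t \<in> minset ?L p"
    by (rule edge_imp_compact_face[OF p]) (rule that)
  show "regular_on K (part (minset ?L p) ?c) torus"
    by (rule compact_face_regular[OF K \<Delta>(2)]) (use inner ne \<Delta>(1) in \<open>simp_all add: inner_nondegenerate_def\<close>)
  show "regular_on K (part (minset ?L p) ?c) {z. snd z \<noteq> 0}" if l: "left_vertex ?L l" "l \<in> minset ?L p"
  proof -
    have "is_first_weight f p'" using first_weight_left_vertex[OF l(1)] p' l(2) by simp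
    then have "zero_set (weight_part p' f) \<inter> critical_set (weight_part p' f) \<inter> {(u, v). v \<noteq> 0} = {}"
      using inner ne unfolding inner_nondegenerate_def by blast
    then show ?thesis unfolding weight_part_regular[OF K] mem_upper p'(3) .
  qed
  show "regular_on K (part (minset ?L p) ?c) {z. fst z \<noteq> 0}"
    if r: "left_vertex (prod.swap ` ?L) r" "r \<in> minset (prod.swap ` ?L) (prod.swap p)"
  proof -
    have "is_last_weight f p'"
      using last_weight_left_vertex[OF r(1)] p' r(2) by (simp add: minset_swap)
    then have "zero_set (weight_part p' f) \<inter> critical_set (weight_part p' f) \<inter> {(u, v). u \<noteq> 0} = {}"
      using inner ne unfolding inner_nondegenerate_def by blast
    then show ?thesis unfolding weight_part_regular[OF K] mem_upper p'(3) .
  qed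
qed

text \<open>An exponent that is smallest in both coordinates is the unique minimiser of every
  positive weight, which leaves no room for edges or further vertices.\<close>

lemma single_vertex_boundary:
  assumes l: "l \<in> exponents f" "\<And>t. t \<in> exponents f \<Longrightarrow> fst l \<le> fst t \<and> snd l \<le> snd t"
  shows "newton_boundary f = {emb l}" "{emb l} \<in> compact_faces 0 f"
proof -
  let ?L = "exponents f"
  have least: "t = l" if "t \<in> ?L" "x * real (fst t) + y * real (snd t) \<le> x * real (fst l) + y * real (snd l)" "x > 0" "y > 0"
    for t and x y :: real
  proof -
    have "x * real (fst l) \<le> x * real (fst t)" "y * real (snd l) \<le> y * real (snd t)"
      using l(2)[OF that(1)] that(3,4) by auto
    then have "x * real (fst l) = x * real (fst t)" "y * real (snd l) = y * real (snd t)" using that(2) by linarith+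
    then show ?thesis using that(3,4) by (simp add: prod_eq_iff)
  qed
  have "left_vertex ?L l" using l by (fastforce simp: left_vertex_def le_less)
  then have v: "vertex_of ?L l" by (rule left_vertex_imp_vertex)
  then show face: "{emb l} \<in> compact_faces 0 f" by (rule newton_vertex_imp_compact_face)
  have "\<Delta> = {emb l}" if \<Delta>: "\<Delta> \<in> compact_faces 0 f" for \<Delta>
  proof -
    obtain s where s: "vertex_of ?L s" "\<Delta> = {emb s}" using compact_face_imp_newton_vertex[OF \<Delta>] .
    obtain x y :: real where xy: "x > 0" "y > 0" "\<forall>t\<in>?L - {s}. x * real (fst s) + y * real (snd s) < x * real (fst t) + y * real (snd t)"
      and sL: "s \<in> ?L"
      using s(1) unfolding vertex_of_def by blast
    have "s = l"
    proof (rule ccontr)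
      assume "s \<noteq> l"
      then have "l \<in> ?L - {s}" using l(1) by blast
      then have "x * real (fst s) + y * real (snd s) < x * real (fst l) + y * real (snd l)" using xy(3) by blast
      then show False using least[OF sL _ xy(1,2)] \<open>s \<noteq> l\<close> by simp
    qed
    then show ?thesis using s(2) by simp
  qed
  moreover have False if \<Delta>: "\<Delta> \<in> compact_faces 1 f" for \<Delta>
  proof -
    obtain p where p: "is_edge ?L p" using compact_face_imp_edge[OF \<Delta>] by metis
    then obtain s q where pq: "0 < fst p" "0 < snd p" "s \<in> minset ?L p" "q \<in> minset ?L p" "s \<noteq> q"
      unfolding is_edge_def by blast
    have "t = l" if t: "t \<in> minset ?L p" for t
    proof (rule least[of t "real (fst p)" "real (snd p)"])
      have "wt p t \<le> wt p l" using t l(1) unfolding minset_def by blast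
      then show "real (fst p) * real (fst t) + real (snd p) * real (snd t) \<le> real (fst p) * real (fst l) + real (snd p) * real (snd l)"
        unfolding wt_def by (metis of_nat_add of_nat_le_iff of_nat_mult)
    qed (use t pq in \<open>auto simp: minset_def\<close>)
    then show False using pq by blast
  qed
  ultimately have "compact_faces 0 f = {{emb l}}" "compact_faces 1 f = {}" using face by blast+
  then show "newton_boundary f = {emb l}" by (simp add: newton_boundary_def)
qed

lemma inner_nondegenerate_end_data:
  assumes inner: "inner_nondegenerate f" and K: "finite K" "Poly_Mapping.keys f \<subseteq> K"
    and ne: "exponents f \<noteq> {}" and no0: "(0, 0) \<notin> exponents f" and crit: "\<not> surj (dev K (Poly_Mapping.lookup f) 0)"
  obtains n n' where "left_end_data (exponents f) K (Poly_Mapping.lookup f) n"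
    "left_end_data (prod.swap ` exponents f) (swap_mono ` K) (Poly_Mapping.lookup f \<circ> swap_mono) n'"
proof -
  let ?L = "exponents f" and ?c = "Poly_Mapping.lookup f"
  let ?R = "prod.swap ` ?L" and ?K' = "swap_mono ` K" and ?c' = "?c \<circ> swap_mono"
  have swap_mem: "t \<in> ?R \<longleftrightarrow> prod.swap t \<in> ?L" for t by (metis image_iff swap_swap)
  have supp: "mono_deg m \<in> ?L" if "?c m \<noteq> 0" for m using that by (auto simp: exponents_def in_keys_iff)
  have supp': "mono_deg m \<in> ?R" if "?c' m \<noteq> 0" for m
    using supp[of "swap_mono m"] that by (simp add: swap_mem)
  obtain l where l: "left_vertex ?L l" using left_vertex_exists[OF finite_exponents ne] .
  obtain r where r: "left_vertex ?R r" using left_vertex_exists[of ?R] ne by auto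
  have "(\<exists>P. is_edge ?L P \<and> l \<in> minset ?L P \<and> regular_on K (part (minset ?L P) ?c) {z. snd z \<noteq> 0}) \<or>
      (\<forall>t\<in>?L. snd l \<le> snd t) \<and> snd l \<le> 1 \<and> regular_on K (part {l} ?c) {z. snd z \<noteq> 0}" (is ?A)
    and "(\<exists>P. is_edge ?R P \<and> r \<in> minset ?R P \<and> regular_on ?K' (part (minset ?R P) ?c') {z. snd z \<noteq> 0}) \<or>
      (\<forall>t\<in>?R. snd r \<le> snd t) \<and> snd r \<le> 1 \<and> regular_on ?K' (part {r} ?c') {z. snd z \<noteq> 0}" (is ?B)
  proof -
    have "?A \<and> ?B"
    proof (cases "\<exists>p. is_edge ?L p")
      case True
      then obtain p where p: "is_edge ?L p" by blast
      then have pR: "is_edge ?R (prod.swap p)" by (simp add: is_edge_swap)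
      have ?A
      proof -
        obtain B where B: "B \<in> minset ?L p" "snd B < snd l" using edge_lower_right[OF l p] by blast
        have "B \<in> ?L" using B(1) by (simp add: minset_def)
        then obtain P where "is_edge ?L P" "l \<in> minset ?L P"
          using edge_through_left_vertex[OF finite_exponents l _ B(2)] by blast
        then show ?A using inner_nondegenerate_edges(2)[OF inner K _ l] by blast
      qed
      moreover have ?B
      proof -
        obtain B where B: "B \<in> minset ?R (prod.swap p)" "snd B < snd r" using edge_lower_right[OF r pR] by blast
        have "B \<in> ?R" using B(1) by (simp add: minset_def)
        then obtain P where P: "is_edge ?R P" "r \<in> minset ?R P"
          using edge_through_left_vertex[OF finite_imageI[OF finite_exponents] r _ B(2)] by blast
        have P': "is_edge ?L (prod.swap P)" using P(1) is_edge_swap[of ?L "prod.swap P"] by simp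
        have "regular_on K (part (minset ?L (prod.swap P)) ?c) {z. fst z \<noteq> 0}"
          by (rule inner_nondegenerate_edges(3)[OF inner K P' r]) (use P(2) in simp)
        then have "regular_on ?K' (part (minset ?R P) ?c') {z. snd z \<noteq> 0}"
          using regular_on_swap[of K "part (minset ?L (prod.swap P)) ?c" "{z. fst z \<noteq> 0}"] minset_swap[of ?L "prod.swap P"]
            part_swap_image[of "minset ?L (prod.swap P)" ?c]
          by (simp add: swap_upper)
        then show ?B using P by blast
      qed
      ultimately show ?thesis ..
    next
      \<comment> \<open>Without edges the left vertex is smallest in both coordinates and is also
        the right end. The column bound, applied at both ends, then gives
        \<open>snd l \<le> 1\<close> and \<open>snd r \<le> 1\<close>.\<close>
      case False
      have l_le: "fst l \<le> fst t \<and> snd l \<le> snd t" if t: "t \<in> ?L" for t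
      proof -
        have "\<not> snd t < snd l" using edge_through_left_vertex[OF finite_exponents l t] False by blast
        then show ?thesis using l t by (auto simp: left_vertex_def less_imp_le)
      qed
      have lL: "l \<in> ?L" using l by (simp add: left_vertex_def)
      have r_eq: "r = prod.swap l"
      proof -
        have rL: "prod.swap r \<in> ?L" using r by (simp add: left_vertex_def swap_mem)
        have "prod.swap l \<in> ?R" using lL by (rule imageI)
        then have "fst r < fst (prod.swap l) \<or> fst r = fst (prod.swap l) \<and> snd r \<le> snd (prod.swap l)"
          using r unfolding left_vertex_def by blast
        then have "fst r = snd l \<and> snd r = fst l" using l_le[OF rL] by auto
        then show ?thesis by (simp add: prod_eq_iff)
      qed
      have "zero_set (restrict_terms {emb l} f) \<inter> critical_set (restrict_terms {emb l} f) \<subseteq> {(0, 0)}"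
        using inner single_vertex_boundary[OF lL l_le] unfolding inner_nondegenerate_def by blast
      then have reg: "regular_on K (part {l} ?c) (- {(0, 0)})"
        by (intro compact_face_regular[OF K, of "{emb l}"]) auto
      have up: "regular_on K (part {l} ?c) {z. snd z \<noteq> 0}" and rt: "regular_on K (part {l} ?c) {z. fst z \<noteq> 0}"
        using reg unfolding regular_on_def by auto
      have rt': "regular_on ?K' (part {r} ?c') {z. snd z \<noteq> 0}"
        using rt regular_on_swap[of K "part {l} ?c" "{z. fst z \<noteq> 0}"] part_swap_image[of "{l}" ?c]
        by (simp add: swap_upper r_eq)
      have "{l} \<subseteq> ?L" "{r} \<subseteq> ?R" using lL r by (auto simp: left_vertex_def)
      then have "fst l \<le> 1" "fst r \<le> 1"
        using left_end_column_le_1[OF l _ up] left_end_column_le_1[OF r _ rt'] by auto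
      then have "snd l \<le> 1" "snd r \<le> 1" by (auto simp: r_eq)
      moreover have "\<forall>t\<in>?R. snd r \<le> snd t" using l_le by (auto simp: r_eq)
      ultimately show ?thesis using up rt' l_le by blast
    qed
    then show ?A ?B by blast+
  qed
  note AB = this
  obtain n where n: "left_end_data ?L K ?c n"
    by (rule left_end_data_exists[OF supp l no0 crit AB(1)]) (assumption, rule that)
  have no0': "(0, 0) \<notin> ?R" using no0 by (simp add: swap_mem)
  have "prod.swap (0 :: complex \<times> complex) = 0" by (simp add: zero_prod_def)
  then have crit': "\<not> surj (dev ?K' ?c' 0)" using crit surj_dev_swap[of K ?c 0] by simp
  obtain n' where n': "left_end_data ?R ?K' ?c' n'"
    by (rule left_end_data_exists[OF supp' r no0' crit' AB(2)]) (assumption, rule that)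
  show ?thesis using that n n' by blast
qed

lemma slice_eq:
  assumes "finite K" "Poly_Mapping.keys g \<subseteq> K" "\<epsilon> > 0"
  shows "(\<lambda>z. z /\<^sub>R \<epsilon>) ` (zero_set g \<inter> sphere 0 \<epsilon>) = {x \<in> S3. ev K (Poly_Mapping.lookup g) (\<epsilon> *\<^sub>R x) = 0}"
proof (intro set_eqI iffI)
  fix x assume "x \<in> (\<lambda>z. z /\<^sub>R \<epsilon>) ` (zero_set g \<inter> sphere 0 \<epsilon>)"
  then obtain z where z: "x = z /\<^sub>R \<epsilon>" "z \<in> zero_set g" "z \<in> sphere 0 \<epsilon>" by blast
  then show "x \<in> {x \<in> S3. ev K (Poly_Mapping.lookup g) (\<epsilon> *\<^sub>R x) = 0}"
    using assms(3) by (simp add: zero_set_def mixed_eval_ev[OF assms(1,2)])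
next
  fix x assume x: "x \<in> {x \<in> S3. ev K (Poly_Mapping.lookup g) (\<epsilon> *\<^sub>R x) = 0}"
  then have "\<epsilon> *\<^sub>R x \<in> zero_set g \<inter> sphere 0 \<epsilon>"
    using assms(3) by (simp add: zero_set_def mixed_eval_ev[OF assms(1,2)])
  moreover have "x = (\<epsilon> *\<^sub>R x) /\<^sub>R \<epsilon>" using assms(3) by simp
  ultimately show "x \<in> (\<lambda>z. z /\<^sub>R \<epsilon>) ` (zero_set g \<inter> sphere 0 \<epsilon>)" by blast
qed

text \<open>An edge polynomial is quasi-homogeneous, so its zeros on the torus can be scaled into the small
  ball where \<open>uniform_transversality\<close> applies to it.\<close>

lemma edge_regular_perturbation:
  assumes K: "finite K" "mono_deg ` K \<subseteq> T" and T: "finite T" and supp: "\<And>m. c m \<noteq> 0 \<Longrightarrow> mono_deg m \<in> T"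
    and adm: "admissible T K c"
  obtains \<delta> where "\<delta> > 0" "\<And>p c'. is_edge T p \<Longrightarrow> (\<And>m. m \<in> K \<Longrightarrow> norm (c' m - c m) \<le> \<delta>) \<Longrightarrow>
    regular_on K (part (minset T p) c') torus"
proof -
  \<comment> \<open>The index set is cut down to the monomials on the edge, because
    \<open>uniform_transversality\<close> requires all their degrees to lie in the exponent set,
    which is now the edge.\<close>
  define Q where "Q = (\<lambda>M \<delta>. \<forall>c z. (\<forall>m\<in>{m \<in> K. mono_deg m \<in> fst M}. norm (c m - part (fst M) (snd M) m) \<le> \<delta>) \<longrightarrow>
     z \<in> torus \<longrightarrow> norm z \<le> \<delta> \<longrightarrow> transverse_at {m \<in> K. mono_deg m \<in> fst M} c z)"
  \<comment> \<open>An edge has infinitely many weights, as multiples are allowed, but only finitely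
    many subsets of \<open>T\<close> occur as edges; this gives one bound for all of them.\<close>
  define S where "S = (\<lambda>M. (M, c)) ` minset T ` {p. is_edge T p}"
  have "S \<subseteq> (\<lambda>M. (M, c)) ` Pow T" unfolding S_def by (intro image_mono) (auto simp: minset_def)
  then have "finite S" using T by (meson finite_Pow_iff finite_imageI finite_subset)
  have ev_restrict: "ev {m \<in> K. mono_deg m \<in> M} (part M c) z = ev K (part M c) z" for M c z
    unfolding ev_def using K(1) by (intro sum.mono_neutral_left) (auto simp: part_def)
  have dev_restrict: "dev {m \<in> K. mono_deg m \<in> M} (part M c) z w = dev K (part M c) z w" for M c z w
    unfolding dev_def using K(1) by (intro sum.mono_neutral_left) (auto simp: part_def)
  have surj_restrict: "surj (dev {m \<in> K. mono_deg m \<in> M} (part M c) z) \<longleftrightarrow> surj (dev K (part M c) z)" for M c z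
    using dev_restrict[of M c z] unfolding fun_eq_iff[symmetric] by (simp add: fun_eq_iff surj_def del: split_paired_All split_paired_Ex)
  have "\<exists>\<delta>>0. \<forall>M\<in>S. Q M \<delta>"
  proof (rule finite_uniform_bound[OF \<open>finite S\<close>])
    show "Q M \<delta>'" if "Q M \<delta>" "0 < \<delta>'" "\<delta>' \<le> \<delta>" for M \<delta> \<delta>'
      using that unfolding Q_def by (meson order_trans)
    fix N assume "N \<in> S"
    then obtain p where p: "is_edge T p" "N = (minset T p, c)" by (auto simp: S_def)
    let ?M = "minset T p"
    let ?K = "{m \<in> K. mono_deg m \<in> ?M}"
    have adm': "admissible ?M ?K (part ?M c)"
    proof -
      have a: "admissible ?M K (part ?M c)" by (rule admissible_edge[OF supp p(1) adm])
      have pp: "part S (part ?M c) = part ?M (part S c)" for S by (auto simp: part_def)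
      have e: "ev ?K (part S (part ?M c)) z = ev K (part S (part ?M c)) z" for S z
        unfolding pp by (rule ev_restrict)
      have r: "regular_on ?K (part S (part ?M c)) A \<longleftrightarrow> regular_on K (part S (part ?M c)) A" for S A
        unfolding regular_on_def e unfolding pp surj_restrict ..
      have e': "ev (swap_mono ` ?K) (part S (part ?M c \<circ> swap_mono)) z = ev (swap_mono ` K) (part S (part ?M c \<circ> swap_mono)) z" for S z
        using ev_swap[of ?K "part (prod.swap ` S) (part ?M c)" "prod.swap z"] ev_swap[of K "part (prod.swap ` S) (part ?M c)" "prod.swap z"]
        by (simp add: part_swap e)
      have r': "regular_on (swap_mono ` ?K) (part S (part ?M c \<circ> swap_mono)) A \<longleftrightarrow> regular_on (swap_mono ` K) (part S (part ?M c \<circ> swap_mono)) A" for S A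
        using regular_on_swap[of ?K "part (prod.swap ` S) (part ?M c)" "prod.swap ` A"] regular_on_swap[of K "part (prod.swap ` S) (part ?M c)" "prod.swap ` A"]
        by (simp add: part_swap r image_image)
      show ?thesis
        using a unfolding admissible_def left_end_regular_def e r e' r' .
    qed
    have fM: "finite ?M" "?M \<noteq> {}" using T p(1) by (auto simp: minset_def is_edge_def)
    have "\<exists>\<delta>>0. \<forall>c' z. (\<forall>m\<in>?K. norm (c' m - part ?M c m) \<le> \<delta>) \<longrightarrow> z \<in> torus \<longrightarrow> norm z \<le> \<delta> \<longrightarrow> transverse_at ?K c' z"
      by (rule uniform_transversality[OF _ _ fM adm']) (use K(1) in auto)
    then show "\<exists>\<delta>>0. Q N \<delta>" by (simp add: Q_def p(2))
  qed
  then obtain \<delta> where \<delta>: "\<delta> > 0" "\<And>M. M \<in> S \<Longrightarrow> Q M \<delta>" by blast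
  show ?thesis
  proof (rule that[OF \<delta>(1)])
    fix p c' assume p: "is_edge T p" and c': "\<And>m. m \<in> K \<Longrightarrow> norm (c' m - c m) \<le> \<delta>"
    let ?M = "minset T p"
    have QM: "Q (?M, c) \<delta>" using \<delta>(2) p by (auto simp: S_def)
    obtain s where s: "s \<in> ?M" and pos: "0 < fst p" "0 < snd p" using p unfolding is_edge_def by blast
    have d: "wt p t = wt p s" if "t \<in> ?M" for t using that s by (auto simp: minset_def intro: antisym)
    show "regular_on K (part ?M c') torus"
      unfolding regular_on_def
    proof (intro ballI impI)
      fix z assume z: "z \<in> torus" "ev K (part ?M c') z = 0"
      obtain u v where uv: "z = (u, v)" "u \<noteq> 0" "v \<noteq> 0" using z(1) by (auto simp: torus_def)
      \<comment> \<open>As \<open>\<rho> \<le> 1\<close> and both weights are at least 1, the scaled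
        point has norm at most \<open>\<rho> * (norm u + norm v)\<close>, hence at most
        \<open>\<delta>\<close>.\<close>
      define \<rho> where "\<rho> = min 1 (\<delta> / (norm u + norm v))"
      have nuv: "norm u + norm v > 0" using uv by (simp add: add_pos_pos)
      have \<rho>: "\<rho> > 0" "\<rho> \<le> 1" "\<rho> * (norm u + norm v) \<le> \<delta>"
      proof -
        show "\<rho> > 0" "\<rho> \<le> 1" using \<delta>(1) nuv by (auto simp: \<rho>_def)
        have "\<rho> \<le> \<delta> / (norm u + norm v)" by (simp add: \<rho>_def)
        then show "\<rho> * (norm u + norm v) \<le> \<delta>" using nuv by (simp add: pos_le_divide_eq)
      qed
      let ?z = "(of_real (\<rho> ^ fst p) * u, of_real (\<rho> ^ snd p) * v)"
      have "?z \<in> torus" using uv \<rho>(1) by (simp add: torus_def)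
      moreover have "norm ?z \<le> \<delta>"
      proof -
        have le: "\<rho> ^ fst p \<le> \<rho>" "\<rho> ^ snd p \<le> \<rho>"
          using power_decreasing[of 1 "fst p" \<rho>] power_decreasing[of 1 "snd p" \<rho>] pos \<rho> by auto
        have "norm ?z \<le> norm (of_real (\<rho> ^ fst p) * u) + norm (of_real (\<rho> ^ snd p) * v)" by (rule norm_Pair_le)
        also have "\<dots> = \<rho> ^ fst p * norm u + \<rho> ^ snd p * norm v" using \<rho>(1) by (simp add: norm_mult norm_power)
        also have "\<dots> \<le> \<rho> * norm u + \<rho> * norm v" using le by (intro add_mono mult_right_mono) auto
        finally show ?thesis using \<rho>(3) by (simp add: algebra_simps)
      qed
      ultimately have tr: "transverse_at {m \<in> K. mono_deg m \<in> ?M} (part ?M c') ?z"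
        using QM c' by (auto simp: Q_def part_def)
      have "ev K (part ?M c') ?z = 0" using homogeneous_scale(1)[OF d \<rho>(1)] z(2) uv(1) by simp
      then have sj: "surj (dev K (part ?M c') ?z)"
        using tr unfolding transverse_at_def ev_restrict dev_restrict surj_def by metis
      show "surj (dev K (part ?M c') z)"
        unfolding uv(1) by (rule homogeneous_scale(2)[OF _ \<rho>(1) sj]) (rule d)
    qed
  qed
qed

lemma ev_part_axis': "ev K (part {(n, 0)} c) (u, v) = ev K (part {(n, 0)} c) (u, v')"
  unfolding ev_def by (rule sum.cong) (auto simp: part_def mono_eval_def mono_deg_def split: prod.split)

theorem inner_nondegenerate_imp_convenient:
  assumes weak: "weakly_isolated_singularity f" and inner: "inner_nondegenerate f" and nice: "nice f"
    and link: "link_of_singularity f {K'. is_link K' \<and> isotopic K0 K'}"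
  obtains g where "weakly_isolated_singularity g" "convenient g" "newton_nondegenerate g" "nice g"
    "link_of_singularity g {K'. is_link K' \<and> isotopic K0 K'}"
proof -
  let ?L = "exponents f" and ?c = "Poly_Mapping.lookup f"
  have swap_mem: "t \<in> prod.swap ` S \<longleftrightarrow> prod.swap t \<in> S" for t :: "nat \<times> nat" and S by (metis image_iff swap_swap)
  have f0: "mixed_eval f 0 = 0" and f_crit: "0 \<in> critical_set f" using weak by (auto simp: weakly_isolated_singularity_def)
  have no0: "(0, 0) \<notin> ?L" using exponent_0_iff f0 by blast
  have supp: "mono_deg m \<in> ?L" if "?c m \<noteq> 0" for m using that by (auto simp: exponents_def in_keys_iff)
  \<comment> \<open>For the zero function every point is a critical zero, so the singularity would
    not be isolated.\<close>
  have neL: "?L \<noteq> {}"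
  proof
    assume "?L = {}"
    then have c0: "?c m = 0" for m using supp by blast
    have e0: "mixed_eval f z = 0" for z by (simp add: mixed_eval_ev[OF finite_keys order_refl] ev_def c0)
    have d0: "dev (Poly_Mapping.keys f) ?c z w = 0" for z w by (simp add: dev_def c0)
    have "\<not> surj (dev (Poly_Mapping.keys f) ?c z)" for z
      unfolding surj_def d0 by (metis zero_neq_one)
    then have all: "z \<in> zero_set f \<inter> critical_set f" for z
      using e0 critical_set_iff[OF finite_keys order_refl] by (simp add: zero_set_def)
    obtain U where U: "open U" "0 \<in> U" "zero_set f \<inter> critical_set f \<inter> U = {0}"
      using weak by (auto simp: weakly_isolated_singularity_def)
    then have "U = {0}" using all by blast
    then show False using U(1) not_open_singleton by blast
  qed
  have crit0: "\<not> surj (dev K ?c 0)" if "finite K" "Poly_Mapping.keys f \<subseteq> K" for K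
    using f_crit critical_set_iff[OF that] by blast
  obtain n n' where data0: "left_end_data ?L (Poly_Mapping.keys f) ?c n"
    "left_end_data (prod.swap ` ?L) (swap_mono ` Poly_Mapping.keys f) (?c \<circ> swap_mono) n'"
    using inner_nondegenerate_end_data[OF inner finite_keys order_refl neL no0 crit0[OF finite_keys order_refl]] by metis
  have n2: "n \<ge> 2" "n' \<ge> 2" using left_end_data_cases(1) data0 by blast+
  define m1 :: "nat \<times> nat \<times> nat \<times> nat" where "m1 = (0, 0, n, 0)"
  define m2 :: "nat \<times> nat \<times> nat \<times> nat" where "m2 = (n', 0, 0, 0)"
  have deg: "mono_deg m1 = (0, n)" "mono_deg m2 = (n', 0)" by (auto simp: m1_def m2_def mono_deg_def)
  have m12: "m1 \<noteq> m2" using deg n2 by auto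
  \<comment> \<open>Both new monomials are indexed from the start, with a possibly vanishing
    coefficient in \<open>f\<close>, so that \<open>f\<close>, \<open>g\<close> and the segment
    between them are coefficient functions on one set.\<close>
  define K where "K = insert m1 (insert m2 (Poly_Mapping.keys f))"
  have K: "finite K" "Poly_Mapping.keys f \<subseteq> K" by (auto simp: K_def)
  define T where "T = insert (0, n) (insert (n', 0) ?L)"
  have KT: "mono_deg ` K \<subseteq> T" by (auto simp: K_def T_def deg exponents_def)
  have T: "finite T" "T \<noteq> {}" by (auto simp: T_def)
  have suppT: "mono_deg m \<in> T" if "?c m \<noteq> 0" for m using supp[OF that] by (simp add: T_def)
  have ev_K: "ev (Poly_Mapping.keys f) (part M ?c) z = ev K (part M ?c) z" for M z
    unfolding ev_def by (rule sum.mono_neutral_left[OF K]) (auto simp: part_def in_keys_iff)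
  have surj_K: "surj (dev (Poly_Mapping.keys f) (part M ?c) z) \<longleftrightarrow> surj (dev K (part M ?c) z)" for M z
  proof -
    have "dev (Poly_Mapping.keys f) (part M ?c) z = dev K (part M ?c) z"
      unfolding dev_def by (rule ext, rule sum.mono_neutral_left[OF K]) (auto simp: part_def in_keys_iff)
    then show ?thesis by simp
  qed
  have data: "left_end_data ?L K ?c n" "left_end_data (prod.swap ` ?L) (swap_mono ` K) (?c \<circ> swap_mono) n'"
  proof -
    show "left_end_data ?L K ?c n"
      using data0(1) unfolding left_end_data_def regular_on_def ev_K surj_K .
    have ev_K': "ev (swap_mono ` Poly_Mapping.keys f) (part M (?c \<circ> swap_mono)) z = ev (swap_mono ` K) (part M (?c \<circ> swap_mono)) z" for M z
      using ev_swap[of "Poly_Mapping.keys f" "part (prod.swap ` M) ?c" "prod.swap z"] ev_swap[of K "part (prod.swap ` M) ?c" "prod.swap z"]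
      by (simp add: part_swap ev_K)
    have surj_K': "surj (dev (swap_mono ` Poly_Mapping.keys f) (part M (?c \<circ> swap_mono)) z) \<longleftrightarrow> surj (dev (swap_mono ` K) (part M (?c \<circ> swap_mono)) z)" for M z
      using surj_dev_swap[of "Poly_Mapping.keys f" "part (prod.swap ` M) ?c" "prod.swap z"] surj_dev_swap[of K "part (prod.swap ` M) ?c" "prod.swap z"]
      by (simp add: part_swap surj_K)
    show "left_end_data (prod.swap ` ?L) (swap_mono ` K) (?c \<circ> swap_mono) n'"
      using data0(2) unfolding left_end_data_def regular_on_def ev_K' surj_K' .
  qed
  have interior: "\<forall>z\<in>torus. ev K (part {s} ?c) z \<noteq> 0"
    if s: "vertex_of ?L s" "\<exists>t\<in>?L. fst t < fst s" "\<exists>t\<in>?L. snd t < snd s" for s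
  proof -
    have "{emb s} \<in> non_extreme_vertices f" using non_extreme_vertex[OF s(1)] s(2,3) by blast
    then have "zero_set (restrict_terms {emb s} f) \<inter> torus = {}" using nice by (simp add: nice_def)
    moreover have "mixed_eval (restrict_terms {emb s} f) = ev K (part {s} ?c)"
      by (rule mixed_eval_restrict[OF K]) simp
    ultimately show ?thesis unfolding zero_set_def by auto
  qed
  have adm: "admissible T K ?c"
    unfolding T_def
    by (rule admissible_extended[OF supp data inner_nondegenerate_edges(1)[OF inner K] interior])
  have vertex_c: "\<forall>z\<in>torus. ev K (part {s} ?c) z \<noteq> 0" if "vertex_of T s" "0 < fst s" "0 < snd s" for s
    using adm that unfolding admissible_def by blast
  have mem_T: "(0, n) \<in> T" "(n', 0) \<in> T" by (auto simp: T_def)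
  \<comment> \<open>\<open>T\<close> contains exponents on both axes, so the estimate covers all
    points except the origin.\<close>
  then have "\<exists>\<delta>>0. \<forall>c z. (\<forall>m\<in>K. norm (c m - ?c m) \<le> \<delta>) \<longrightarrow> z \<in> - {0} \<longrightarrow> norm z \<le> \<delta> \<longrightarrow> transverse_at K c z"
    by (intro uniform_transversality[OF K(1) KT T adm]) blast
  then obtain \<delta>1 where \<delta>1_pos: "\<delta>1 > 0"
    and D1: "\<forall>c z. (\<forall>m\<in>K. norm (c m - ?c m) \<le> \<delta>1) \<longrightarrow> z \<in> - {0} \<longrightarrow> norm z \<le> \<delta>1 \<longrightarrow> transverse_at K c z"
    by blast
  have \<delta>1: "transverse_at K c z" if "\<And>m. norm (c m - ?c m) \<le> \<delta>1" "z \<noteq> 0" "norm z \<le> \<delta>1" for c z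
    by (rule D1[rule_format]) (use that in simp_all)
  obtain \<delta>2 where \<delta>2: "\<delta>2 > 0" "\<And>p c'. is_edge T p \<Longrightarrow> (\<And>m. m \<in> K \<Longrightarrow> norm (c' m - ?c m) \<le> \<delta>2) \<Longrightarrow>
    regular_on K (part (minset T p) c') torus"
  proof (rule edge_regular_perturbation[OF K(1) KT T(1) suppT adm])
    fix d assume d: "d > 0" "\<And>p c'. is_edge T p \<Longrightarrow> (\<And>m. m \<in> K \<Longrightarrow> norm (c' m - ?c m) \<le> d) \<Longrightarrow>
      regular_on K (part (minset T p) c') torus"
    show thesis by (rule that[OF d(1)], rule d(2); simp)
  qed
  define \<delta> where "\<delta> = min \<delta>1 \<delta>2"
  have \<delta>: "\<delta> > 0" "\<delta> \<le> \<delta>1" "\<delta> \<le> \<delta>2" using \<delta>1_pos \<delta>2(1) by (auto simp: \<delta>_def)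
  \<comment> \<open>The bound \<open>\<delta>\<close> is fixed before the coefficients, so they can
    be chosen generic within it.\<close>
  obtain \<kappa> where \<kappa>: "norm \<kappa> \<le> \<delta>" "\<And>v. v \<noteq> 0 \<Longrightarrow> ev K (part {(0, n)} ?c) (1, v) + \<kappa> * v ^ n \<noteq> 0"
    using generic_axis_coefficient[OF \<delta>(1)] by metis
  obtain \<kappa>' where \<kappa>': "norm \<kappa>' \<le> \<delta>" "\<And>u. u \<noteq> 0 \<Longrightarrow>
      ev (swap_mono ` K) (part {(0, n')} (?c \<circ> swap_mono)) (1, u) + \<kappa>' * u ^ n' \<noteq> 0"
    using generic_axis_coefficient[OF \<delta>(1)] by metis
  define E where "E = (\<lambda>m. (if m = m1 then \<kappa> else 0) + (if m = m2 then \<kappa>' else 0))"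
  define g where "g = f + Poly_Mapping.single m1 \<kappa> + Poly_Mapping.single m2 \<kappa>'"
  have g: "Poly_Mapping.lookup g = (\<lambda>m. ?c m + E m)"
    by (auto simp: fun_eq_iff g_def E_def lookup_add lookup_single when_def)
  have E_le: "norm (E m) \<le> \<delta>" for m using \<kappa>(1) \<kappa>'(1) \<delta>(1) m12 by (auto simp: E_def)
  have gK: "Poly_Mapping.keys g \<subseteq> K"
    by (auto simp: in_keys_iff g E_def K_def split: if_splits)
  have near: "norm (Poly_Mapping.lookup g m - ?c m) \<le> \<delta>" for m using E_le[of m] by (simp add: g)
  have part_g: "ev K (part M (Poly_Mapping.lookup g)) z = ev K (part M ?c) z + ev K (part M E) z" for M z
    unfolding ev_def sum.distrib[symmetric] by (rule sum.cong) (auto simp: part_def g algebra_simps)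
  have left_free: "\<forall>z\<in>torus. ev K (part {(0, n)} (Poly_Mapping.lookup g)) z \<noteq> 0"
  proof
    fix z assume "z \<in> torus"
    then obtain u v where z: "z = (u, v)" "v \<noteq> 0" by (auto simp: torus_def)
    have "ev K (part {(0, n)} E) (1, v) = (\<Sum>m\<in>K. if m = m1 then \<kappa> * v ^ n else 0)"
      unfolding ev_def
    proof (rule sum.cong[OF refl])
      fix m assume "m \<in> K"
      show "part {(0, n)} E m * mono_eval m (1, v) = (if m = m1 then \<kappa> * v ^ n else 0)"
        using deg n2 m12 by (auto simp: part_def E_def) (auto simp: m1_def mono_eval_def)
    qed
    also have "\<dots> = \<kappa> * v ^ n" using K(1) by (simp add: sum.delta K_def)
    finally have "ev K (part {(0, n)} E) (1, v) = \<kappa> * v ^ n" .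
    then show "ev K (part {(0, n)} (Poly_Mapping.lookup g)) z \<noteq> 0"
      using \<kappa>(2)[OF z(2)] unfolding z(1) ev_part_axis[of K n _ u v 1] part_g by simp
  qed
  have right_free: "\<forall>z\<in>torus. ev K (part {(n', 0)} (Poly_Mapping.lookup g)) z \<noteq> 0"
  proof
    fix z assume "z \<in> torus"
    then obtain u v where z: "z = (u, v)" "u \<noteq> 0" by (auto simp: torus_def)
    have "ev K (part {(n', 0)} E) (u, 1) = (\<Sum>m\<in>K. if m = m2 then \<kappa>' * u ^ n' else 0)"
      unfolding ev_def
    proof (rule sum.cong[OF refl])
      fix m assume "m \<in> K"
      show "part {(n', 0)} E m * mono_eval m (u, 1) = (if m = m2 then \<kappa>' * u ^ n' else 0)"
        using deg n2 m12 by (auto simp: part_def E_def) (auto simp: m2_def mono_eval_def)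
    qed
    also have "\<dots> = \<kappa>' * u ^ n'" using K(1) by (simp add: sum.delta K_def)
    finally have e: "ev K (part {(n', 0)} E) (u, 1) = \<kappa>' * u ^ n'" .
    have "ev (swap_mono ` K) (part {(0, n')} (?c \<circ> swap_mono)) (1, u) = ev K (part {(n', 0)} ?c) (u, 1)"
      using ev_swap[of K "part {(n', 0)} ?c" "(u, 1)"] by (simp add: part_swap)
    then show "ev K (part {(n', 0)} (Poly_Mapping.lookup g)) z \<noteq> 0"
      using \<kappa>'(2)[OF z(2)] e unfolding z(1) ev_part_axis'[of K n' _ u v 1] part_g by simp
  qed
  \<comment> \<open>If the axis exponent was already present, the added term could cancel an old
    coefficient; zero-freeness on the torus guarantees that some monomial of this degree survives in
    \<open>g\<close>.\<close>
  have nonzero_coeff: "t \<in> exponents g" if "ev K (part {t} (Poly_Mapping.lookup g)) (1, 1) \<noteq> 0" for t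
  proof (rule ccontr)
    assume "t \<notin> exponents g"
    then have "part {t} (Poly_Mapping.lookup g) m = 0" for m
      by (auto simp: part_def exponents_def in_keys_iff)
    then show False using that by (simp add: ev_def)
  qed
  have one: "(1, 1) \<in> torus" by (simp add: torus_def)
  have exp_g: "exponents g = T"
  proof
    show "exponents g \<subseteq> T" using gK KT unfolding exponents_def by blast
    have "t \<in> exponents g" if t: "t \<in> ?L" "t \<noteq> (0, n)" "t \<noteq> (n', 0)" for t
    proof -
      obtain m where m: "m \<in> Poly_Mapping.keys f" "t = mono_deg m" using t(1) by (auto simp: exponents_def)
      then have "m \<noteq> m1" "m \<noteq> m2" using t deg by auto
      then have "Poly_Mapping.lookup g m \<noteq> 0" using m(1) by (simp add: g E_def in_keys_iff)
      then show ?thesis using m(2) by (simp add: exponents_def in_keys_iff)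
    qed
    moreover have "(0, n) \<in> exponents g" "(n', 0) \<in> exponents g"
      using nonzero_coeff left_free right_free one by blast+
    ultimately show "T \<subseteq> exponents g" unfolding T_def by auto
  qed
  \<comment> \<open>If \<open>?L\<close> reaches this axis, \<open>(0, n)\<close> is its lowest
    exponent there; otherwise \<open>(0, n)\<close> is the only one. In both cases the new boundary
    ends at \<open>(0, n)\<close>.\<close>
  have left_T: "left_vertex T (0, n)"
  proof -
    have "n \<le> snd t" if t: "t \<in> T" "fst t = 0" for t
    proof -
      have "n \<le> b" if "(0, b) \<in> ?L" for b
        using data(1) that unfolding left_end_data_def left_vertex_def by fastforce
      moreover have "t = (0, snd t)" using t(2) by (simp add: prod_eq_iff)
      moreover have "t \<noteq> (n', 0)" using t(2) n2 by auto
      ultimately show ?thesis using t(1) unfolding T_def by (metis insertE order_refl snd_conv)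
    qed
    then show ?thesis using mem_T(1) unfolding left_vertex_def fst_conv snd_conv by (metis gr0I)
  qed
  have right_T: "left_vertex (prod.swap ` T) (0, n')"
  proof -
    have "n' \<le> fst t" if t: "t \<in> T" "snd t = 0" for t
    proof -
      have "n' \<le> b" if "(b, 0) \<in> ?L" for b
      proof -
        have "(0, b) \<in> prod.swap ` ?L" using that by (simp add: swap_mem)
        then show ?thesis using data(2) unfolding left_end_data_def left_vertex_def by fastforce
      qed
      moreover have "t = (fst t, 0)" using t(2) by (simp add: prod_eq_iff)
      moreover have "t \<noteq> (0, n)" using t(2) n2 by auto
      ultimately show ?thesis using t(1) unfolding T_def by (metis insertE order_refl fst_conv)
    qed
    then have "0 < snd t \<or> 0 = snd t \<and> n' \<le> fst t" if "t \<in> T" for t using that by (metis gr0I)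
    then show ?thesis using mem_T(2) unfolding left_vertex_def by (force simp: swap_mem)
  qed
  have vertex_axis: "s = (0, n)" if "vertex_of T s" "fst s = 0" for s
    using left_vertex_unique_column[OF left_T that(1)] that(2) by simp
  have vertex_axis': "s = (n', 0)" if s: "vertex_of T s" "snd s = 0" for s
  proof -
    have "vertex_of (prod.swap ` T) (prod.swap s)" using s(1) by (simp add: vertex_of_swap)
    then have "prod.swap s = (0, n')" using left_vertex_unique_column[OF right_T] s(2) by simp
    then have "prod.swap (0, n') = s" by (metis swap_swap)
    then show ?thesis by simp
  qed
  have vertex_g: "\<forall>z\<in>torus. ev K (part {s} (Poly_Mapping.lookup g)) z \<noteq> 0" if s: "vertex_of T s" for s
  proof (cases "0 < fst s \<and> 0 < snd s")
    case True
    then have "part {s} E m = 0" for m using deg by (auto simp: part_def E_def)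
    then have "ev K (part {s} E) z = 0" for z by (simp add: ev_def)
    then show ?thesis using vertex_c[OF s] True by (simp add: part_g)
  next
    case False
    then consider "fst s = 0" | "snd s = 0" by auto
    then show ?thesis
      using vertex_axis[OF s] vertex_axis'[OF s] left_free right_free by cases simp_all
  qed
  \<comment> \<open>Since \<open>n\<close> and \<open>n'\<close> are at least 2, the linear part is
    unchanged and the origin stays critical.\<close>
  have dev0: "dev K (Poly_Mapping.lookup g) 0 = dev K ?c 0"
  proof -
    have "part {(1, 0), (0, 1)} (Poly_Mapping.lookup g) = part {(1, 0), (0, 1)} ?c"
    proof
      fix m
      show "part {(1, 0), (0, 1)} (Poly_Mapping.lookup g) m = part {(1, 0), (0, 1)} ?c m"
        using deg n2 by (cases "m = m1 \<or> m = m2") (auto simp: part_def g E_def)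
    qed
    then show ?thesis by (intro ext) (simp only: dev_linear_part(2))
  qed
  show ?thesis
  proof (rule that[of g])
    show "weakly_isolated_singularity g"
      unfolding weakly_isolated_singularity_def
    proof (intro conjI exI)
      have "(0, 0) \<notin> exponents g" using no0 n2 by (auto simp: exp_g T_def)
      then show g0: "mixed_eval g 0 = 0" using exponent_0_iff by blast
      show gc: "0 \<in> critical_set g"
        unfolding critical_set_iff[OF K(1) gK] dev0 by (rule crit0[OF K])
      show "open (ball (0 :: complex \<times> complex) \<delta>)" "0 \<in> ball (0 :: complex \<times> complex) \<delta>" using \<delta>(1) by auto
      show "zero_set g \<inter> critical_set g \<inter> ball 0 \<delta> = {0}"
      proof (intro equalityI subsetI)
        fix z assume z: "z \<in> zero_set g \<inter> critical_set g \<inter> ball 0 \<delta>"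
        show "z \<in> {0}"
        proof (rule ccontr)
          assume "z \<notin> {0}"
          moreover have "norm z \<le> \<delta>1" using z \<delta>(2) by simp
          moreover have "norm (Poly_Mapping.lookup g m - ?c m) \<le> \<delta>1" for m using near[of m] \<delta>(2) by linarith
          ultimately have "transverse_at K (Poly_Mapping.lookup g) z" using \<delta>1 by simp
          moreover have "ev K (Poly_Mapping.lookup g) z = 0"
            using z by (simp add: zero_set_def mixed_eval_ev[OF K(1) gK])
          \<comment> \<open>Transversality contains regularity, so the same estimate shows that the
            singularity of \<open>g\<close> is weakly isolated.\<close>
          ultimately have "surj (dev K (Poly_Mapping.lookup g) z)" unfolding transverse_at_def surj_def by metis
          then show False using z critical_set_iff[OF K(1) gK] by blast
        qed
      next
        fix z :: "complex \<times> complex" assume "z \<in> {0}"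
        then show "z \<in> zero_set g \<inter> critical_set g \<inter> ball 0 \<delta>" using g0 gc \<delta>(1) by (simp add: zero_set_def)
      qed
    qed
    show "convenient g"
    proof -
      have "vertex_of T (0, n)" by (rule left_vertex_imp_vertex[OF left_T])
      moreover have "vertex_of T (n', 0)"
        using left_vertex_imp_vertex[OF right_T] vertex_of_swap[of T "(n', 0)"] by simp
      ultimately have "emb (0, n) \<in> newton_boundary g" "emb (n', 0) \<in> newton_boundary g"
        by (auto intro: boundary_vertex simp: exp_g)
      then show ?thesis unfolding convenient_def emb_def by auto
    qed
    show "newton_nondegenerate g"
      unfolding newton_nondegenerate_def
    proof
      fix \<Delta> assume "\<Delta> \<in> compact_faces 0 g \<union> compact_faces 1 g"
      then consider "\<Delta> \<in> compact_faces 0 g" | "\<Delta> \<in> compact_faces 1 g" by blast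
      then show "zero_set (restrict_terms \<Delta> g) \<inter> critical_set (restrict_terms \<Delta> g) \<inter> torus = {}"
      proof cases
        case 1
        obtain s where s: "vertex_of T s" "\<Delta> = {emb s}" using compact_face_imp_newton_vertex[OF 1] exp_g by metis
        have mem: "emb t \<in> \<Delta> \<longleftrightarrow> t \<in> {s}" for t by (simp add: s(2))
        have "regular_on K (part {s} (Poly_Mapping.lookup g)) torus"
          using vertex_g[OF s(1)] unfolding regular_on_def by blast
        then show ?thesis using regular_on_restrict[OF K(1) gK mem] by blast
      next
        case 2
        obtain p where p: "is_edge T p" "\<And>t. t \<in> exponents g \<Longrightarrow> emb t \<in> \<Delta> \<longleftrightarrow> t \<in> minset T p"
          using compact_face_imp_edge[OF 2] exp_g by metis
        have "norm (Poly_Mapping.lookup g m - ?c m) \<le> \<delta>2" for m using near[of m] \<delta>(3) by linarith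
        then have "regular_on K (part (minset T p) (Poly_Mapping.lookup g)) torus" using \<delta>2(2)[OF p(1)] by blast
        then show ?thesis using regular_on_restrict[OF K(1) gK p(2)] by blast
      qed
    qed
    show "nice g"
      unfolding nice_def
    proof
      fix \<Delta> assume "\<Delta> \<in> non_extreme_vertices g"
      then obtain s where s: "\<Delta> = {emb s}" "vertex_of T s"
        using non_extreme_vertex_interior exp_g by metis
      have "mixed_eval (restrict_terms \<Delta> g) = ev K (part {s} (Poly_Mapping.lookup g))"
        by (rule mixed_eval_restrict[OF K(1) gK]) (simp add: s(1))
      then show "zero_set (restrict_terms \<Delta> g) \<inter> torus = {}"
        using vertex_g[OF s(2)] unfolding zero_set_def by auto
    qed
    show "link_of_singularity g {K'. is_link K' \<and> isotopic K0 K'}"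
      unfolding link_of_singularity_def
    proof -
      have "\<forall>\<^sub>F \<epsilon> in at_right 0. 0 < \<epsilon> \<and> \<epsilon> < \<delta>" using eventually_at_right[OF \<delta>(1)] \<delta>(1) by auto
      then show "\<forall>\<^sub>F \<epsilon> in at_right 0. (\<lambda>z. z /\<^sub>R \<epsilon>) ` (zero_set g \<inter> sphere 0 \<epsilon>) \<in> {K'. is_link K' \<and> isotopic K0 K'}"
        using link[unfolded link_of_singularity_def]
      proof eventually_elim
        case (elim \<epsilon>)
        then have \<epsilon>: "\<epsilon> > 0" "\<epsilon> \<le> \<delta>1" using \<delta>(2) by linarith+
        \<comment> \<open>For each radius below \<open>\<delta>\<close> the whole segment of
          coefficients from \<open>f\<close> to \<open>g\<close> stays within
          \<open>\<delta>1\<close> of \<open>f\<close>, so the two slices are compared on one and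
          the same sphere.\<close>
        have iso: "isotopic {x \<in> S3. ev K ?c (\<epsilon> *\<^sub>R x) = 0} {x \<in> S3. ev K (\<lambda>m. ?c m + E m) (\<epsilon> *\<^sub>R x) = 0}"
        proof (rule isotopic_slices[OF \<epsilon>(1)])
          fix t z assume t: "t \<in> {0..1::real}" and z: "norm (z :: complex \<times> complex) = \<epsilon>"
          show "transverse_at K (\<lambda>m. ?c m + t *\<^sub>R E m) z"
          proof (rule \<delta>1)
            show "norm (?c m + t *\<^sub>R E m - ?c m) \<le> \<delta>1" for m
            proof -
              have "t * norm (E m) \<le> 1 * norm (E m)" using t by (intro mult_right_mono) auto
              then show ?thesis using E_le[of m] \<delta>(2) t by simp
            qed
          qed (use z \<epsilon> in auto)
        qed
        show ?case
          using elim(2) iso is_link_isotopic[OF _ iso] isotopic_trans[OF _ iso]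
          unfolding slice_eq[OF K \<epsilon>(1)] slice_eq[OF K(1) gK \<epsilon>(1)] g by blast
      qed
    qed
  qed
qed

theorem theorem1p7:
  fixes L :: "(complex \<times> complex) set set"
  assumes "link_type L"
  shows "(\<exists>f. weakly_isolated_singularity f \<and> convenient f \<and> newton_nondegenerate f \<and> nice f \<and>
            link_of_singularity f L)
     \<longleftrightarrow> (\<exists>f. weakly_isolated_singularity f \<and> inner_nondegenerate f \<and> nice f \<and>
            link_of_singularity f L)"
proof
  assume "\<exists>f. weakly_isolated_singularity f \<and> convenient f \<and> newton_nondegenerate f \<and> nice f \<and>
            link_of_singularity f L"
  then show "\<exists>f. weakly_isolated_singularity f \<and> inner_nondegenerate f \<and> nice f \<and>
            link_of_singularity f L"
    using convenient_newton_nondegenerate_imp_inner_nondegenerate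
    unfolding weakly_isolated_singularity_def by blast
next
  obtain K where L: "L = {K'. is_link K' \<and> isotopic K K'}"
    using assms unfolding link_type_def by blast
  assume "\<exists>f. weakly_isolated_singularity f \<and> inner_nondegenerate f \<and> nice f \<and>
            link_of_singularity f L"
  then obtain f where f: "weakly_isolated_singularity f" "inner_nondegenerate f" "nice f" "link_of_singularity f L"
    by blast
  show "\<exists>f. weakly_isolated_singularity f \<and> convenient f \<and> newton_nondegenerate f \<and> nice f \<and>
            link_of_singularity f L"
    using inner_nondegenerate_imp_convenient[OF f(1-3) f(4)[unfolded L]] unfolding L by metis
qed

end
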